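(* Let $0<\alpha<1$, $T>0$, $\lambda\in\mathbb R$, $r\ge1$, and let $n\ge0$ be an integer. Let $f$ be a bounded function on $[0,T]$ such that $f(0)$ and $f'(0)$ exist and, on $(0,T]$, $|f'(t)|\le Qt^{-\sigma}$ and $|f''(t)|\le Qt^{-\tilde\sigma}$ for some $\sigma<1$ and $\tilde\sigma<1$. Let $u$ be the solution of $$\partial_t^\alpha u(t)+\lambda u(t)=f(t),\quad t\in(0,T];\qquad u(0)=0.$$ For $M\in\mathbb N$, $M\geq 1$, let $\tau=T^{1/r}/M$, $t_m=(m\tau)^r$ and $u^m=u(t_m)$ for $0\le m\le M$. Let $V^0,\dots,V^M$ be defined by $$D_M^\alpha V^m+\lambda V^m=\big((-\lambda I_t^\alpha)^nf\big)(t_m),\quad 1\le m\le M;\qquad V^0=0,$$ and let the numerical approximation $U^m$ of $u^m$ be $$U^m=V^m+\Big(I_t^\alpha\sum_{i=0}^{n-1}(-\lambda I_t^\alpha)^if\Big)(t_m).$$ Then $$|u^m-U^m|\le Q\,\tau^{\min\{2-\alpha,\;r(n+1)\alpha\}},\qquad 1\le m\le M,$$ where $Q$ is independent of $m$ and $M$ (equivalently of $\tau$).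
   Context: For $\nu>0$ set $\beta_\nu(t):=t^{\nu-1}/\Gamma(\nu)$ and $I_t^\nu g(t):=\frac1{\Gamma(\nu)}\int_0^t(t-s)^{\nu-1}g(s)\,ds$. For $0<\alpha<1$ the fractional derivative is $\partial_t^\alpha g:=I_t^{1-\alpha}g'$. Powers of operators denote iterated application, the zeroth power is the identity, and an empty sum ($n=0$) is zero. The nonuniform L1 operator on the graded mesh is, with $\tau_k=t_k-t_{k-1}$, $$D_M^\alpha V^m=\frac1{\Gamma(2-\alpha)}\sum_{k=0}^{m-1}\frac{V^{k+1}-V^k}{\tau_{k+1}}\big[(t_m-t_k)^{1-\alpha}-(t_m-t_{k+1})^{1-\alpha}\big]=\sum_{k=1}^m a^{(m)}_{m-k}(V^k-V^{k-1}),$$ where $a^{(m)}_{m-k}=\int_{t_{k-1}}^{t_k}\frac{\beta_{1-\alpha}(t_m-s)}{\tau_k}\,ds$. The scheme is understood to define $V^m$ uniquely, i.e. $a_0^{(m)}+\lambda\neq0$ for $1\le m\le M$ (automatic if $\lambda\ge0$). Here $f(0)$, $f'(0)$ denote finite values at $t=0$, taken as one-sided limits. $Q$ is a generic positive constant that may take different values at different occurrences (it may depend on $\alpha,\lambda,n,r,T$ and $f$). *)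

theory Defs
  imports "HOL-Analysis.Analysis"
begin

definition frac_kernel :: "real \<Rightarrow> real \<Rightarrow> real" where
  "frac_kernel \<nu> t = t powr (\<nu> - 1) / Gamma \<nu>"

text \<open>Riemann--Liouville integral \<open>I_t^\<nu> g(t)\<close>.\<close>

definition frac_int :: "real \<Rightarrow> (real \<Rightarrow> real) \<Rightarrow> real \<Rightarrow> real" where
  "frac_int \<nu> g t = 1 / Gamma \<nu> * integral {0..t} (\<lambda>s. (t - s) powr (\<nu> - 1) * g s)"

text \<open>Caputo derivative. Only the values of \<open>deriv g\<close> on the open interval \<open>(0,t)\<close> matter,
  so no one-sided derivatives are needed.\<close>

definition frac_deriv :: "real \<Rightarrow> (real \<Rightarrow> real) \<Rightarrow> real \<Rightarrow> real" where
  "frac_deriv \<alpha> g t = frac_int (1 - \<alpha>) (deriv g) t"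

text \<open>The integrability clause says that the integral defining \<open>\<partial>_t^\<alpha> u(t)\<close> exists (as a
  Lebesgue integral), since \<open>integral\<close> of a non-integrable function is \<open>0\<close>. Taken at
  \<open>t = T\<close>, it implies that \<open>u'\<close> is in \<open>L^1(0,T)\<close>.\<close>

definition frac_solution ::
  "real \<Rightarrow> real \<Rightarrow> real \<Rightarrow> (real \<Rightarrow> real) \<Rightarrow> (real \<Rightarrow> real) \<Rightarrow> bool" where
  "frac_solution T \<alpha> lam f u \<longleftrightarrow>
     u 0 = 0 \<and>
     continuous_on {0..T} u \<and>
     (\<forall>t\<in>{0<..<T}. u differentiable (at t)) \<and>
     (\<forall>t\<in>{0<..T}.
        (\<lambda>s. (t - s) powr (- \<alpha>) * deriv u s) absolutely_integrable_on {0..t} \<and>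
        frac_deriv \<alpha> u t + lam * u t = f t)"

text \<open>\<open>(-lam I_t^\<alpha>)^i f\<close>\<close>

definition frac_pow :: "real \<Rightarrow> real \<Rightarrow> nat \<Rightarrow> (real \<Rightarrow> real) \<Rightarrow> real \<Rightarrow> real" where
  "frac_pow \<alpha> lam i f = ((\<lambda>g t. - lam * frac_int \<alpha> g t) ^^ i) f"

definition graded_step :: "real \<Rightarrow> real \<Rightarrow> nat \<Rightarrow> real" where
  "graded_step T r M = T powr (1 / r) / real M"

definition graded_mesh :: "real \<Rightarrow> real \<Rightarrow> nat \<Rightarrow> nat \<Rightarrow> real" where
  "graded_mesh T r M m = (real m * graded_step T r M) powr r"

text \<open>In the following definitions \<open>t\<close> is the sequence of mesh points.\<close>

definition L1_op :: "real \<Rightarrow> (nat \<Rightarrow> real) \<Rightarrow> (nat \<Rightarrow> real) \<Rightarrow> nat \<Rightarrow> real" where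
  "L1_op \<alpha> t V m =
     1 / Gamma (2 - \<alpha>) *
     (\<Sum>k<m. (V (k + 1) - V k) / (t (k + 1) - t k) *
            ((t m - t k) powr (1 - \<alpha>) - (t m - t (k + 1)) powr (1 - \<alpha>)))"

text \<open>\<open>L1_coeff \<alpha> t m j\<close> is the coefficient \<open>a^(m)_j\<close> of \<open>V^(m-j) - V^(m-j-1)\<close> in
  \<open>L1_op \<alpha> t V m\<close>, for \<open>j < m\<close>.\<close>

definition L1_coeff :: "real \<Rightarrow> (nat \<Rightarrow> real) \<Rightarrow> nat \<Rightarrow> nat \<Rightarrow> real" where
  "L1_coeff \<alpha> t m j =
     integral {t (m - j - 1)..t (m - j)}
       (\<lambda>s. frac_kernel (1 - \<alpha>) (t m - s) / (t (m - j) - t (m - j - 1)))"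

definition L1_scheme ::
  "real \<Rightarrow> real \<Rightarrow> nat \<Rightarrow> (real \<Rightarrow> real) \<Rightarrow> (nat \<Rightarrow> real) \<Rightarrow> nat \<Rightarrow> (nat \<Rightarrow> real) \<Rightarrow> bool" where
  "L1_scheme \<alpha> lam n f t M V \<longleftrightarrow>
     V 0 = 0 \<and>
     (\<forall>m\<in>{1..M}. L1_op \<alpha> t V m + lam * V m = frac_pow \<alpha> lam n f (t m))"

definition numerical_approx ::
  "real \<Rightarrow> real \<Rightarrow> nat \<Rightarrow> (real \<Rightarrow> real) \<Rightarrow> (nat \<Rightarrow> real) \<Rightarrow> (nat \<Rightarrow> real) \<Rightarrow> nat \<Rightarrow> real" where
  "numerical_approx \<alpha> lam n f t V m =
     V m + frac_int \<alpha> (\<lambda>s. \<Sum>i<n. frac_pow \<alpha> lam i f s) (t m)"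

end

theory Submission
  imports Defs
begin

text \<open>
  Write \<open>J = -\<lambda> I\<^sup>\<alpha>\<close>. A solution satisfies \<open>u = I\<^sup>\<alpha> f + J u\<close>, so the correction term of the
  approximation is the beginning of its Neumann series, and what remains is \<open>v = J\<^sup>n u\<close>
  (\<open>solution_expansion\<close>). Since \<open>v\<close> solves the same equation with right-hand side \<open>J\<^sup>n f\<close>, the quantity
  \<open>u(t\<^sub>m) - U\<^sup>m = v(t\<^sub>m) - V\<^sup>m\<close> is the error of the plain L1 scheme for \<open>v\<close>. The gain is that \<open>v\<close> is
  smoother at the origin than \<open>u\<close>: it behaves like \<open>t\<^sup>\<delta>\<close> with \<open>\<delta> = (n+1)\<alpha>\<close>. Let
  \<open>p = min {2 - \<alpha>, r\<delta>}\<close> be the order to be proved.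

  Regularity is expressed through the derivative \<open>w\<close> of \<open>v\<close>, namely by
  \<open>\<bar>w(t)\<bar> \<le> C t\<^bsup>\<delta>-1\<^esup>\<close> and \<open>\<bar>w(x) - w(y)\<bar> \<le> C (x-y) y\<^bsup>\<delta>-2\<^esup>\<close> for comparable \<open>x \<ge> y\<close>
  (\<open>weighted_lip\<close>). This class is invariant under dilations, and so is \<open>I\<^sup>a\<close> up to a factor; therefore
  \<open>I\<^sup>a\<close> raises \<open>\<delta>\<close> by \<open>a\<close> with hardly any computation (\<open>weighted_lip_frac_int\<close>). For \<open>u\<close> itself
  the equation is iterated until the remainder \<open>I\<^bsup>N\<alpha>\<^esup>u\<close> is smooth (\<open>volterra_regular\<close>), and then
  each further application of \<open>J\<close> gains one \<open>\<alpha>\<close> (\<open>frac_pow_solution\<close>).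

  The truncation error \<open>R\<^sup>m\<close> is bounded by \<open>A \<tau>\<^sup>p t\<^sub>m\<^bsup>-\<alpha>\<^esup>\<close> (\<open>L1_truncation\<close>). In a cell away from both
  ends of \<open>[0,t\<^sub>m]\<close> the mean of \<open>w\<close> is subtracted, so only the increment of the kernel
  \<open>K(s) = (t\<^sub>m - s)\<^bsup>-\<alpha>\<^esup>\<close> over the cell counts, multiplied by \<open>\<tau>\<^sub>k\<^sup>2 t\<^sub>k\<^bsup>\<delta>-2\<^esup>\<close>. On the graded mesh this factor is
  at most \<open>C \<tau>\<^sup>p k\<^bsup>-\<alpha>\<^esup>\<close>, and the sum of the kernel increments telescopes.

  The weight \<open>t\<^sub>m\<^bsup>-\<alpha>\<^esup>\<close> is the right one for stability: up to the factor \<open>\<Gamma>(1-\<alpha>)\<close> it is a lower bound for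
  the discrete derivative at \<open>t\<^sub>m\<close> of a unit jump at the origin. Hence a sequence with a jump of size \<open>C \<tau>\<^sup>p\<close>
  in the first step, continued as an exponential \<open>exp (\<mu>t)\<close> so as to absorb \<open>\<lambda>\<close>, is a barrier which
  dominates the error at every mesh point (\<open>L1_op_barrier\<close>, \<open>L1_stability\<close>). The barrier needs steps of
  length at most \<open>1/\<mu>\<close>, which leaves out finitely many \<open>M\<close>; for each of those there is at most one \<open>V\<close>
  (\<open>L1_scheme_unique\<close>), hence a finite error.
\<close>

section \<open>Kernel integrals and the semigroup law\<close>

lemma kernel_has_integral:
  fixes a b c \<nu> :: real
  assumes "0 < \<nu>" "a \<le> b" "b \<le> c"
  shows "((\<lambda>s. (c - s) powr (\<nu> - 1)) has_integral ((c - a) powr \<nu> - (c - b) powr \<nu>) / \<nu>) {a..b}"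
proof -
  have "((\<lambda>s. (c - s) powr (\<nu> - 1)) has_integral
      (- ((c - b) powr \<nu> / \<nu>) - - ((c - a) powr \<nu> / \<nu>))) {a..b}"
  proof (rule fundamental_theorem_of_calculus_interior)
    show "continuous_on {a..b} (\<lambda>s. - ((c - s) powr \<nu> / \<nu>))"
      using assms by (intro continuous_intros continuous_on_powr') auto
    fix s assume "s \<in> {a<..<b}"
    then show "((\<lambda>s. - ((c - s) powr \<nu> / \<nu>)) has_vector_derivative (c - s) powr (\<nu> - 1)) (at s)"
      unfolding has_real_derivative_iff_has_vector_derivative[symmetric]
      using assms by (auto intro!: derivative_eq_intros)
  qed fact
  then show ?thesis by (simp add: diff_divide_distrib)
qed

lemma beta_has_integral:
  fixes a b x t :: real
  assumes "0 < a" "0 < b" "x \<le> t"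
  shows "((\<lambda>s. (t - s) powr (a - 1) * (s - x) powr (b - 1)) has_integral
           Beta a b * (t - x) powr (a + b - 1)) {x..t}"
proof (cases "x = t")
  case False
  define d where "d = t - x"
  have d: "0 < d" using assms False by (simp add: d_def)
  have "((\<lambda>\<theta>. \<theta> powr (b - 1) * (1 - \<theta>) powr (a - 1)) has_integral Beta b a) {0..1}"
    using has_integral_Beta_real[of b a] assms by simp
  moreover have bounds: "(0 - (- x / d)) /\<^sub>R (1 / d) = x" "(1 - (- x / d)) /\<^sub>R (1 / d) = t"
    using d by (simp_all add: d_def field_simps)
  ultimately have "((\<lambda>s. (s / d + - x / d) powr (b - 1) * (1 - (s / d + - x / d)) powr (a - 1))
      has_integral d * Beta b a) {x..t}"
    using has_integral_affinity'[of "\<lambda>\<theta>. \<theta> powr (b - 1) * (1 - \<theta>) powr (a - 1)"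
        "Beta b a" 0 1 "1/d" "- x/d"] bounds d
    by (simp add: mult.commute)
  then have "((\<lambda>s. d powr (a + b - 2) * ((s / d + - x / d) powr (b - 1) * (1 - (s / d + - x / d)) powr (a - 1)))
      has_integral d powr (a + b - 2) * (d * Beta b a)) {x..t}"
    by (rule has_integral_mult_right)
  moreover have "d powr (a + b - 2) * (d * Beta b a) = Beta a b * (t - x) powr (a + b - 1)"
  proof -
    have "d * d powr (a + b - 2) = d powr (a + b - 1)"
      using d powr_mult_base[of d "a + b - 2"] by (simp add: algebra_simps)
    then show ?thesis unfolding d_def[symmetric]
      by (metis Beta_commute mult.commute mult.left_commute)
  qed
  moreover have "d powr (a + b - 2) * ((s / d + - x / d) powr (b - 1) * (1 - (s / d + - x / d)) powr (a - 1))
      = (t - s) powr (a - 1) * (s - x) powr (b - 1)" if "s \<in> {x..t}" for s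
  proof -
    have one: "1 = (t - x) / d" using d by (simp add: d_def)
    have 1: "s / d + - x / d = (s - x) / d" by (simp add: diff_divide_distrib)
    have 2: "1 - (s / d + - x / d) = (t - s) / d"
      unfolding 1 by (subst one) (simp add: diff_divide_distrib)
    have "d powr (a + b - 2) = d powr (a - 1) * d powr (b - 1)"
      by (simp add: powr_add[symmetric] algebra_simps)
    then show ?thesis unfolding 2 unfolding 1 using that d by (simp add: powr_divide)
  qed
  ultimately show ?thesis by (metis (no_types, lifting) has_integral_cong)
qed (simp add: has_integral_refl)

lemma frac_int_cong_AE:
  fixes g h :: "real \<Rightarrow> real"
  assumes "AE s in lebesgue. s \<in> {0<..<t} \<longrightarrow> g s = h s"
  shows "frac_int \<nu> g t = frac_int \<nu> h t"
proof -
  obtain N where N: "negligible N" "\<And>s. s \<notin> N \<Longrightarrow> s \<in> {0<..<t} \<Longrightarrow> g s = h s"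
    using assms by (auto simp: eventually_ae_filter negligible_iff_null_sets subset_iff)
  have "integral {0..t} (\<lambda>s. (t - s) powr (\<nu> - 1) * g s) = integral {0..t} (\<lambda>s. (t - s) powr (\<nu> - 1) * h s)"
  proof (rule integral_spike)
    show "negligible (N \<union> {0, t})" using N(1) by (intro negligible_Un) auto
  qed (use N(2) in force)
  then show ?thesis by (simp add: frac_int_def)
qed

lemma frac_int_cong:
  fixes g h :: "real \<Rightarrow> real"
  assumes "\<And>s. s \<in> {0<..<t} \<Longrightarrow> g s = h s"
  shows "frac_int \<nu> g t = frac_int \<nu> h t"
  using assms by (intro frac_int_cong_AE) auto

lemma Beta_real_pos: "0 < a \<Longrightarrow> 0 < b \<Longrightarrow> 0 < Beta a (b::real)"
  by (simp add: Beta_def Gamma_real_pos)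

text \<open>
  Fubini's theorem on the triangle \<open>0 < x < s < t\<close>. Integrating out the middle variable \<open>s\<close> leaves a beta
  integral, which turns the product of the kernels of orders \<open>a\<close> and \<open>b\<close> into the kernel of order
  \<open>a + b\<close>; so the hypothesis that the single integral of order \<open>a + b\<close> converges absolutely is exactly what makes
  the double integral converge. For \<open>a + b = 1\<close> it is plain integrability, as available for the derivative
  of a solution.
\<close>

lemma frac_int_semigroup_borel:
  fixes a b t :: real and g :: "real \<Rightarrow> real"
  assumes a: "0 < a" and b: "0 < b" and g[measurable]: "g \<in> borel_measurable borel"
    and int: "integrable lborel (\<lambda>x. indicator {0<..<t} x * ((t - x) powr (a + b - 1) * g x))"
  shows "(\<lambda>s. (t - s) powr (a - 1) * frac_int b g s) absolutely_integrable_on {0..t}" (is ?A)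
    and "frac_int a (frac_int b g) t = frac_int (a + b) g t" (is ?B)
proof -
  define F where "F = (\<lambda>(x, s). (if 0 < x \<and> x < s \<and> s < t then
     (t - s) powr (a - 1) * (s - x) powr (b - 1) * g x else (0::real)))"
  have F_meas[measurable]: "F \<in> borel_measurable (lborel \<Otimes>\<^sub>M lborel)"
    unfolding F_def by measurable
  have inner: "has_bochner_integral lborel (\<lambda>s. F (x, s))
      (Beta a b * (indicator {0<..<t} x * ((t - x) powr (a + b - 1) * g x)))"
    and inner_abs: "has_bochner_integral lborel (\<lambda>s. norm (F (x, s)))
      (Beta a b * norm (indicator {0<..<t} x * ((t - x) powr (a + b - 1) * g x)))" for x
  proof -
    have *: "has_bochner_integral lborel (\<lambda>s. F (x, s))
      (Beta a b * (indicator {0<..<t} x * ((t - x) powr (a + b - 1) * g x)))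
     \<and> has_bochner_integral lborel (\<lambda>s. norm (F (x, s)))
      (Beta a b * norm (indicator {0<..<t} x * ((t - x) powr (a + b - 1) * g x)))"
    proof (cases "x \<in> {0<..<t}")
      case False
      then have "F (x, s) = 0" for s by (auto simp: F_def)
      with False show ?thesis by (auto intro: has_bochner_integral_zero)
    next
      case True
      let ?k = "\<lambda>s. if x < s \<and> s < t then (t - s) powr (a - 1) * (s - x) powr (b - 1) else 0"
      have "((\<lambda>s. (t - s) powr (a - 1) * (s - x) powr (b - 1)) has_integral
           Beta a b * (t - x) powr (a + b - 1)) {x..t}"
        using beta_has_integral[of a b x t] a b True by simp
      then have "((\<lambda>s. if s \<in> {x..t} then (t - s) powr (a - 1) * (s - x) powr (b - 1) else 0) has_integral
           Beta a b * (t - x) powr (a + b - 1)) UNIV"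
        by (simp only: has_integral_restrict_UNIV)
      then have "(?k has_integral Beta a b * (t - x) powr (a + b - 1)) UNIV"
        by (rule has_integral_spike[rotated 2, where S = "{x, t}"]) auto
      then have "has_bochner_integral lborel ?k (Beta a b * (t - x) powr (a + b - 1))"
        by (intro has_bochner_integral_nn_integral nn_integral_has_integral_lborel)
            (use Beta_real_pos[OF a b] in auto)
      then have k: "has_bochner_integral lborel (\<lambda>s. c * ?k s) (c * (Beta a b * (t - x) powr (a + b - 1)))" for c
        by (rule has_bochner_integral_mult_right)
      have F: "(\<lambda>s. F (x, s)) = (\<lambda>s. g x * ?k s)" "(\<lambda>s. norm (F (x, s))) = (\<lambda>s. \<bar>g x\<bar> * ?k s)"
        using True by (auto simp: F_def abs_mult fun_eq_iff)
      have eqs: "Beta a b * (indicator {0<..<t} x * ((t - x) powr (a + b - 1) * g x))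
          = g x * (Beta a b * (t - x) powr (a + b - 1))"
        "Beta a b * norm (indicator {0<..<t} x * ((t - x) powr (a + b - 1) * g x))
          = \<bar>g x\<bar> * (Beta a b * (t - x) powr (a + b - 1))"
        using True by (simp_all add: abs_mult)
      show ?thesis unfolding F eqs using k by blast
    qed
    then show "has_bochner_integral lborel (\<lambda>s. F (x, s))
      (Beta a b * (indicator {0<..<t} x * ((t - x) powr (a + b - 1) * g x)))"
    "has_bochner_integral lborel (\<lambda>s. norm (F (x, s)))
      (Beta a b * norm (indicator {0<..<t} x * ((t - x) powr (a + b - 1) * g x)))"
      by auto
  qed
  have F_int: "integrable (lborel \<Otimes>\<^sub>M lborel) F"
  proof (rule lborel_pair.Fubini_integrable[OF F_meas])
    show "integrable lborel (\<lambda>x. \<integral>s. norm (F (x, s)) \<partial>lborel)"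
      unfolding has_bochner_integral_integral_eq[OF inner_abs]
      using int by (intro integrable_mult_right integrable_norm) auto
    show "AE x in lborel. integrable lborel (\<lambda>s. F (x, s))"
      using inner by (auto simp: has_bochner_integral_iff)
  qed
  have F_int': "integrable (lborel \<Otimes>\<^sub>M lborel) (case_prod (\<lambda>x s. F (x, s)))" using F_int by simp
  have swap: "(\<integral>s. (\<integral>x. F (x, s) \<partial>lborel) \<partial>lborel) = (\<integral>x. (\<integral>s. F (x, s) \<partial>lborel) \<partial>lborel)"
    using lborel_pair.Fubini_integral[OF F_int'] by simp
  have AEs: "AE s in lborel. integrable lborel (\<lambda>x. F (x, s))"
    using lborel_pair.AE_integrable_snd[OF F_int'] by simp
  have int_s: "integrable lborel (\<lambda>s. \<integral>x. F (x, s) \<partial>lborel)"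
    using lborel_pair.integrable_snd[OF F_int'] by simp
  have slice: "(\<integral>x. F (x, s) \<partial>lborel) =
      indicator {0<..<t} s * ((t - s) powr (a - 1) * (Gamma b * frac_int b g s))"
    if "integrable lborel (\<lambda>x. F (x, s))" for s
  proof (cases "s \<in> {0<..<t}")
    case False
    then have "F (x, s) = 0" for x by (auto simp: F_def)
    with False show ?thesis by simp
  next
    case True
    have "((\<lambda>x. F (x, s)) has_integral (\<integral>x. F (x, s) \<partial>lborel)) UNIV"
      using that by (rule has_integral_integral_lborel)
    then have "((\<lambda>x. if x \<in> {0..s} then (t - s) powr (a - 1) * ((s - x) powr (b - 1) * g x) else 0)
        has_integral (\<integral>x. F (x, s) \<partial>lborel)) UNIV"
      by (rule has_integral_spike[rotated 2, where S = "{0, s}"]) (use True in \<open>auto simp: F_def\<close>)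
    then have "((\<lambda>x. (t - s) powr (a - 1) * ((s - x) powr (b - 1) * g x))
        has_integral (\<integral>x. F (x, s) \<partial>lborel)) {0..s}"
      by (simp only: has_integral_restrict_UNIV)
    then have "integral {0..s} (\<lambda>x. (t - s) powr (a - 1) * ((s - x) powr (b - 1) * g x)) = (\<integral>x. F (x, s) \<partial>lborel)"
      by (rule integral_unique)
    then show ?thesis using True Gamma_real_pos[OF b] by (simp add: frac_int_def)
  qed
  define h where "h = (\<lambda>s. (t - s) powr (a - 1) * frac_int b g s)"
  have AEh: "AE s in lborel. (\<integral>x. F (x, s) \<partial>lborel) = indicator {0<..<t} s * (Gamma b * h s)"
    using AEs by eventually_elim (simp add: slice h_def mult_ac)
  let ?G = "\<lambda>s. \<integral>x. F (x, s) \<partial>lborel"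
  have "AE s in lebesgue. ?G s = indicator {0<..<t} s * (Gamma b * h s)"
    using AEh by (rule AE_completion)
  then obtain N where N: "negligible N" "\<And>s. s \<notin> N \<Longrightarrow> ?G s = indicator {0<..<t} s * (Gamma b * h s)"
    by (auto simp: eventually_ae_filter negligible_iff_null_sets subset_iff)
  have G_has: "(?G has_integral (\<integral>s. ?G s \<partial>lborel)) UNIV"
    using int_s by (rule has_integral_integral_lborel)
  have G_abs: "?G absolutely_integrable_on {0..t}"
  proof (rule set_integrable_subset[where A = UNIV])
    show "set_integrable lebesgue UNIV ?G"
      using int_s by (simp add: set_integrable_def integrable_completion)
  qed auto
  have nz: "Gamma b \<noteq> 0" "Gamma a \<noteq> 0" "Gamma (a + b) \<noteq> 0"
    using Gamma_real_pos[OF a] Gamma_real_pos[OF b] Gamma_real_pos[OF add_pos_pos[OF a b]] by linarith+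
  have "(\<lambda>s. Gamma b * h s) absolutely_integrable_on {0..t}"
  proof (rule absolutely_integrable_spike[OF G_abs])
    show "negligible (N \<union> {0, t})" using N(1) by (intro negligible_Un) auto
  qed (use N(2) in auto)
  then have "(\<lambda>s. 1 / Gamma b * (Gamma b * h s)) absolutely_integrable_on {0..t}"
    by (rule set_integrable_mult_right)
  then show "?A" using nz by (simp add: h_def)
  have "(?G has_integral (\<integral>s. ?G s \<partial>lborel)) {0..t}"
  proof -
    have "((\<lambda>s. if s \<in> {0..t} then ?G s else 0) has_integral (\<integral>s. ?G s \<partial>lborel)) UNIV"
    proof (rule has_integral_eq[OF _ G_has])
      fix s
      have "?G s = 0" if "s \<notin> {0..t}"
      proof -
        have "(\<lambda>x. F (x, s)) = (\<lambda>x. 0)" using that by (auto simp: F_def)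
        then show ?thesis by simp
      qed
      then show "?G s = (if s \<in> {0..t} then ?G s else 0)" by auto
    qed
    then show ?thesis by (simp only: has_integral_restrict_UNIV)
  qed
  then have "((\<lambda>s. Gamma b * h s) has_integral (\<integral>s. ?G s \<partial>lborel)) {0..t}"
  proof (rule has_integral_spike[rotated 2])
    show "negligible (N \<union> {0, t})" using N(1) by (intro negligible_Un) auto
  qed (use N(2) in auto)
  then have "Gamma b * integral {0..t} h = (\<integral>s. ?G s \<partial>lborel)"
    by (simp add: integral_unique flip: integral_mult_right)
  also have "\<dots> = Beta a b * (\<integral>x. indicator {0<..<t} x * ((t - x) powr (a + b - 1) * g x) \<partial>lborel)"
    unfolding swap has_bochner_integral_integral_eq[OF inner] by simp
  also have "(\<integral>x. indicator {0<..<t} x * ((t - x) powr (a + b - 1) * g x) \<partial>lborel)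
      = integral {0..t} (\<lambda>x. (t - x) powr (a + b - 1) * g x)"
  proof -
    let ?I = "\<integral>x. indicator {0<..<t} x * ((t - x) powr (a + b - 1) * g x) \<partial>lborel"
    have "((\<lambda>x. indicator {0<..<t} x * ((t - x) powr (a + b - 1) * g x)) has_integral ?I) UNIV"
      using int by (rule has_integral_integral_lborel)
    then have "((\<lambda>x. if x \<in> {0..t} then (t - x) powr (a + b - 1) * g x else 0) has_integral ?I) UNIV"
      by (rule has_integral_spike[rotated 2, where S = "{0, t}"]) auto
    then show ?thesis by (simp only: has_integral_restrict_UNIV integral_unique)
  qed
  finally have "Gamma b * integral {0..t} h =
      Beta a b * integral {0..t} (\<lambda>x. (t - x) powr (a + b - 1) * g x)" .
  then have e1: "Gamma (a + b) * integral {0..t} h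
      = Gamma a * integral {0..t} (\<lambda>x. (t - x) powr (a + b - 1) * g x)"
    using nz by (simp add: Beta_def field_simps)
  have e2: "frac_int a (frac_int b g) t = 1 / Gamma a * integral {0..t} h"
    by (simp only: frac_int_def[of a] h_def)
  have e3: "frac_int (a + b) g t = 1 / Gamma (a + b) * integral {0..t} (\<lambda>x. (t - x) powr (a + b - 1) * g x)"
    by (simp only: frac_int_def[of "a + b"])
  have "Gamma (a + b) * (Gamma a * frac_int a (frac_int b g) t)
      = Gamma (a + b) * (Gamma a * frac_int (a + b) g t)"
    using nz e1 unfolding e2 e3 by simp
  then show "?B" using nz by simp
qed

text \<open>
  Both sides see the density only up to a null set, so a Lebesgue measurable density can be replaced by
  a Borel representative.
\<close>

lemma
  fixes a b t :: real and w :: "real \<Rightarrow> real"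
  assumes a: "0 < a" and b: "0 < b"
    and int: "(\<lambda>s. (t - s) powr (a + b - 1) * w s) absolutely_integrable_on {0..t}"
  shows frac_int_semigroup_integrable:
      "(\<lambda>s. (t - s) powr (a - 1) * frac_int b w s) absolutely_integrable_on {0..t}"
    and frac_int_semigroup: "frac_int a (frac_int b w) t = frac_int (a + b) w t"
proof -
  have "(\<lambda>s. (t - s) powr (a + b - 1) * w s) absolutely_integrable_on {0<..<t}"
    by (rule set_integrable_subset[OF int]) auto
  then have I: "integrable lebesgue (\<lambda>s. indicator {0<..<t} s * ((t - s) powr (a + b - 1) * w s))"
    by (simp add: set_integrable_def)
  obtain \<phi> where \<phi>[measurable]: "\<phi> \<in> borel_measurable lborel"
    and AE: "AE s in lborel. indicator {0<..<t} s * ((t - s) powr (a + b - 1) * w s) = \<phi> s"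
    using completion_ex_borel_measurable_real[OF borel_measurable_integrable[OF I]] by blast
  have AE': "AE s in lebesgue. indicator {0<..<t} s * ((t - s) powr (a + b - 1) * w s) = \<phi> s"
    using AE by (rule AE_completion)
  have "integrable lebesgue \<phi>"
    using I AE' \<phi> borel_measurable_integrable[OF I] by (subst (asm) integrable_cong_AE[where g = \<phi>]) (auto intro: measurable_completion)
  then have "integrable lborel \<phi>"
    by (simp add: integrable_completion)
  \<comment> \<open>Dividing the kernel out again gives a Borel version of the density itself.\<close>
  define g where "g = (\<lambda>s. (t - s) powr (1 - a - b) * \<phi> s)"
  have wg: "AE s in lebesgue. s \<in> {0<..<t} \<longrightarrow> w s = g s"
    using AE'
  proof eventually_elim
    case (elim s)
    show ?case
    proof
      assume s: "s \<in> {0<..<t}"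
      have "(t - s) powr (1 - a - b) * (t - s) powr (a + b - 1) = 1"
        using s by (simp flip: powr_add)
      moreover have "\<phi> s = (t - s) powr (a + b - 1) * w s" using s elim by simp
      ultimately show "w s = g s" unfolding g_def by (metis mult.assoc mult_1)
    qed
  qed
  have g: "g \<in> borel_measurable borel" unfolding g_def by measurable
  have "AE s in lborel. \<phi> s = indicator {0<..<t} s * ((t - s) powr (a + b - 1) * g s)"
    using AE
  proof eventually_elim
    case (elim s)
    have "(t - s) powr (a + b - 1) * (t - s) powr (1 - a - b) = 1" if "s \<in> {0<..<t}"
      using that by (simp flip: powr_add)
    then have "s \<in> {0<..<t} \<Longrightarrow> (t - s) powr (a + b - 1) * g s = \<phi> s"
      unfolding g_def by (metis mult.assoc mult_1)
    then show ?case using elim by (cases "s \<in> {0<..<t}") auto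
  qed
  then have gint: "integrable lborel (\<lambda>s. indicator {0<..<t} s * ((t - s) powr (a + b - 1) * g s))"
    using \<open>integrable lborel \<phi>\<close> g by (subst (asm) integrable_cong_AE) auto
  have eq: "frac_int b w s = frac_int b g s" if "s \<in> {0<..<t}" for s
    using wg that by (intro frac_int_cong_AE) (auto elim: eventually_mono)
  show "(\<lambda>s. (t - s) powr (a - 1) * frac_int b w s) absolutely_integrable_on {0..t}"
    by (rule absolutely_integrable_spike[OF frac_int_semigroup_borel(1)[OF a b g gint], where S = "{0, t}"])
       (auto simp: eq)
  have "frac_int a (frac_int b w) t = frac_int a (frac_int b g) t"
    by (rule frac_int_cong) (simp add: eq)
  also have "\<dots> = frac_int (a + b) g t" by (rule frac_int_semigroup_borel(2)[OF a b g gint])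
  also have "\<dots> = frac_int (a + b) w t" using wg by (intro frac_int_cong_AE) (auto elim: eventually_mono)
  finally show "frac_int a (frac_int b w) t = frac_int (a + b) w t" .
qed

section \<open>Elementary properties of the fractional integral\<close>

lemma frac_int_1: "frac_int 1 w t = integral {0..t} w"
proof -
  have "integral {0..t} (\<lambda>s. (t - s) powr (1 - 1) * w s) = integral {0..t} w"
    by (rule integral_spike[where S = "{t}"]) auto
  then show ?thesis by (simp add: frac_int_def)
qed

lemma frac_int_0: "frac_int a w 0 = 0"
  by (simp add: frac_int_def)

lemma frac_int_cmult: "frac_int a (\<lambda>s. c * w s) t = c * frac_int a w t"
proof -
  have "integral {0..t} (\<lambda>s. (t - s) powr (a - 1) * (c * w s)) = integral {0..t} (\<lambda>s. c * ((t - s) powr (a - 1) * w s))"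
    by (simp add: mult_ac)
  then show ?thesis by (simp add: frac_int_def)
qed

lemma frac_int_add:
  assumes "(\<lambda>s. (t - s) powr (a - 1) * g s) absolutely_integrable_on {0..t}"
    and "(\<lambda>s. (t - s) powr (a - 1) * h s) absolutely_integrable_on {0..t}"
  shows "frac_int a (\<lambda>s. g s + h s) t = frac_int a g t + frac_int a h t"
proof -
  have "integral {0..t} (\<lambda>s. (t - s) powr (a - 1) * (g s + h s)) =
     integral {0..t} (\<lambda>s. (t - s) powr (a - 1) * g s + (t - s) powr (a - 1) * h s)"
    by (simp add: algebra_simps)
  also have "\<dots> = integral {0..t} (\<lambda>s. (t - s) powr (a - 1) * g s) + integral {0..t} (\<lambda>s. (t - s) powr (a - 1) * h s)"
    using assms by (intro integral_add) (auto simp: absolutely_integrable_on_def)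
  finally show ?thesis by (simp add: frac_int_def distrib_left)
qed

text \<open>
  Comparison with the power \<open>s\<^bsup>b-1\<^esup>\<close>, whose fractional integral is a beta integral. The value of the
  density at the two endpoints is left open, because the densities that occur are singular at \<open>0\<close> and
  known only in the interior.
\<close>

lemma
  fixes a b C t :: real and w :: "real \<Rightarrow> real"
  assumes a: "0 < a" and b: "0 < b" and t: "0 \<le> t"
    and meas: "w \<in> borel_measurable (lebesgue_on {0<..<t})"
    and bnd: "\<And>s. s \<in> {0<..<t} \<Longrightarrow> \<bar>w s\<bar> \<le> C * s powr (b - 1)"
  shows frac_integrand_absolutely_integrable:
      "(\<lambda>s. (t - s) powr (a - 1) * w s) absolutely_integrable_on {0..t}"
    and frac_int_bound: "\<bar>frac_int a w t\<bar> \<le> C * Beta a b / Gamma a * t powr (a + b - 1)"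
proof -
  let ?w = "\<lambda>s. if s \<in> {0<..<t} then w s else 0"
  have beta: "((\<lambda>s. C * ((t - s) powr (a - 1) * s powr (b - 1))) has_integral
      C * (Beta a b * t powr (a + b - 1))) {0..t}"
    using has_integral_mult_right[OF beta_has_integral[of a b 0 t], of C] a b t by simp
  have "?w \<in> borel_measurable lebesgue"
    using meas by (subst borel_measurable_if) auto
  then have "?w \<in> borel_measurable (lebesgue_on {0..t})"
    by (rule measurable_restrict_space1)
  moreover have "(\<lambda>s. (t - s) powr (a - 1)) \<in> borel_measurable (lebesgue_on {0..t})"
    by (intro measurable_restrict_space1 measurable_completion) measurable
  ultimately have m: "(\<lambda>s. (t - s) powr (a - 1) * ?w s) \<in> borel_measurable (lebesgue_on {0..t})"
    by (intro borel_measurable_times)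
  have le: "norm ((t - s) powr (a - 1) * ?w s) \<le> C * ((t - s) powr (a - 1) * s powr (b - 1))"
    if "s \<in> {0..t}" for s
  proof (cases "s \<in> {0<..<t}")
    case True
    then show ?thesis
      using mult_left_mono[OF bnd[OF True], of "(t - s) powr (a - 1)"] by (simp add: abs_mult mult_ac)
  next
    case False
    then have "s = 0 \<or> s = t" using that by auto
    then show ?thesis by auto
  qed
  have 1: "(\<lambda>s. (t - s) powr (a - 1) * ?w s) absolutely_integrable_on {0..t}"
    by (rule measurable_bounded_by_integrable_imp_absolutely_integrable[OF m _ _ le])
       (use beta in auto)
  then show "(\<lambda>s. (t - s) powr (a - 1) * w s) absolutely_integrable_on {0..t}"
    by (rule absolutely_integrable_spike[where S = "{0, t}"]) auto
  have "norm (integral {0..t} (\<lambda>s. (t - s) powr (a - 1) * ?w s)) \<le>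
      integral {0..t} (\<lambda>s. C * ((t - s) powr (a - 1) * s powr (b - 1)))"
    using 1 beta le by (intro integral_norm_bound_integral) (auto simp: absolutely_integrable_on_def)
  also have "\<dots> = C * (Beta a b * t powr (a + b - 1))" using beta by (rule integral_unique)
  finally have 2: "\<bar>Gamma a * frac_int a ?w t\<bar> \<le> C * (Beta a b * t powr (a + b - 1))"
    using Gamma_real_pos[OF a] by (simp add: frac_int_def)
  have "frac_int a ?w t = frac_int a w t" by (rule frac_int_cong) auto
  then show "\<bar>frac_int a w t\<bar> \<le> C * Beta a b / Gamma a * t powr (a + b - 1)"
    using 2 Gamma_real_pos[OF a] by (simp add: abs_mult field_simps)
qed

text \<open>
  A class that contains \<open>f\<close> and \<open>u\<close>, is closed under fractional integration, and on which fractional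
  integrals are linear and obey the semigroup law at every point of \<open>[0,T]\<close>. The open interval avoids
  any reference to \<open>f(0)\<close>, which may differ from the limit of \<open>f\<close> at the origin.
\<close>

definition bounded_measurable :: "real \<Rightarrow> (real \<Rightarrow> real) \<Rightarrow> bool" where
  "bounded_measurable T g \<longleftrightarrow>
     g \<in> borel_measurable (lebesgue_on {0<..<T}) \<and> (\<exists>B. \<forall>s\<in>{0<..<T}. \<bar>g s\<bar> \<le> B)"

lemma lebesgue_on_mono_measurable:
  assumes "g \<in> borel_measurable (lebesgue_on {0<..<T})" "t \<le> (T::real)"
  shows "g \<in> borel_measurable (lebesgue_on {0<..<t})"
  by (rule measurable_restrict_mono[OF assms(1)]) (use assms(2) in auto)

lemma bounded_measurable_integrand:
  assumes "bounded_measurable T g" "0 < a" "t \<in> {0..T}"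
  shows "(\<lambda>s. (t - s) powr (a - 1) * g s) absolutely_integrable_on {0..t}"
proof -
  obtain B where B: "\<forall>s\<in>{0<..<T}. \<bar>g s\<bar> \<le> B"
    using assms by (auto simp: bounded_measurable_def)
  show ?thesis
    by (rule frac_integrand_absolutely_integrable[where b = 1 and C = B])
       (use assms B in \<open>auto simp: bounded_measurable_def intro: lebesgue_on_mono_measurable\<close>)
qed

lemma bounded_measurable_frac_int:
  assumes g: "bounded_measurable T g" and a: "0 < a"
  shows "bounded_measurable T (frac_int a g)"
proof (cases "0 < T")
  case True
  obtain B where B: "\<forall>s\<in>{0<..<T}. \<bar>g s\<bar> \<le> B"
    using g by (auto simp: bounded_measurable_def)
  have "0 \<le> B" using B[rule_format, of "T/2"] True by auto
  have "\<bar>frac_int a g t\<bar> \<le> B * Beta a 1 / Gamma a * T powr a" if "t \<in> {0<..<T}" for t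
  proof -
    have "\<bar>frac_int a g t\<bar> \<le> B * Beta a 1 / Gamma a * t powr (a + 1 - 1)"
      by (rule frac_int_bound)
       (use that a g B in \<open>auto simp: bounded_measurable_def intro: lebesgue_on_mono_measurable\<close>)
    also have "\<dots> \<le> B * Beta a 1 / Gamma a * T powr a"
      using that a \<open>0 \<le> B\<close> Beta_real_pos[of a 1] Gamma_real_pos[of a]
      by (intro mult_left_mono) (auto intro!: powr_mono2 divide_nonneg_nonneg mult_nonneg_nonneg)
    finally show ?thesis .
  qed
  moreover have "frac_int a g \<in> borel_measurable (lebesgue_on {0<..<T})"
  proof -
    \<comment> \<open>Measurability comes from Fubini's theorem, through the semigroup law with outer order 1.\<close>
    have "(\<lambda>s. (T - s) powr (1 - 1) * frac_int a g s) absolutely_integrable_on {0..T}"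
      by (rule frac_int_semigroup_integrable) (use bounded_measurable_integrand[OF g, of "1 + a" T] a True in auto)
    then have "(\<lambda>s. (T - s) powr (1 - 1) * frac_int a g s) absolutely_integrable_on {0<..<T}"
      by (rule set_integrable_subset) auto
    then have "frac_int a g absolutely_integrable_on {0<..<T}"
      by (rule absolutely_integrable_spike[where S = "{}"]) auto
    then show ?thesis by (rule absolutely_integrable_imp_borel_measurable) auto
  qed
  ultimately show ?thesis
    unfolding bounded_measurable_def by blast
qed (auto simp: bounded_measurable_def measurable_def space_restrict_space)

lemma bounded_measurable_add:
  "bounded_measurable T g \<Longrightarrow> bounded_measurable T h \<Longrightarrow> bounded_measurable T (\<lambda>s. g s + h s)"
  unfolding bounded_measurable_def
proof (intro conjI; elim conjE exE)
  fix B B' assume "\<forall>s\<in>{0<..<T}. \<bar>g s\<bar> \<le> B" "\<forall>s\<in>{0<..<T}. \<bar>h s\<bar> \<le> B'"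
  then have "\<forall>s\<in>{0<..<T}. \<bar>g s + h s\<bar> \<le> B + B'" by (meson abs_triangle_ineq add_mono order_trans)
  then show "\<exists>B. \<forall>s\<in>{0<..<T}. \<bar>g s + h s\<bar> \<le> B" ..
qed auto

lemma bounded_measurable_cmult:
  "bounded_measurable T g \<Longrightarrow> bounded_measurable T (\<lambda>s. c * g s)"
  unfolding bounded_measurable_def
proof (intro conjI; elim conjE exE)
  fix B assume "\<forall>s\<in>{0<..<T}. \<bar>g s\<bar> \<le> B"
  then have "\<forall>s\<in>{0<..<T}. \<bar>c * g s\<bar> \<le> \<bar>c\<bar> * B" by (simp add: abs_mult mult_left_mono)
  then show "\<exists>B. \<forall>s\<in>{0<..<T}. \<bar>c * g s\<bar> \<le> B" ..
qed auto

section \<open>Weighted Lipschitz densities\<close>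

text \<open>
  Functions with the size and the modulus of continuity of \<open>t\<^bsup>\<delta>-1\<^esup>\<close>. The Lipschitz bound stands in for a bound
  on the derivative, so that differentiability need not be carried through the fractional integrals. It is required only for points within a
  ratio \<open>\<kappa>\<close> of each other: for these all powers of \<open>x\<close> and \<open>y\<close> are comparable, and neighbouring mesh points have
  ratio at most \<open>2\<^sup>r\<close>.
\<close>

definition weighted_lip :: "real \<Rightarrow> real \<Rightarrow> real \<Rightarrow> (real \<Rightarrow> real) \<Rightarrow> bool" where
  "weighted_lip T \<kappa> \<delta> w \<longleftrightarrow> (\<exists>C. \<forall>y\<in>{0<..T}. \<bar>w y\<bar> \<le> C * y powr (\<delta> - 1) \<and>
     (\<forall>x\<in>{y..T}. x \<le> \<kappa> * y \<longrightarrow> \<bar>w x - w y\<bar> \<le> C * (x - y) * y powr (\<delta> - 2)))"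

lemma weighted_lipI:
  assumes "\<And>y. 0 < y \<Longrightarrow> y \<le> T \<Longrightarrow> \<bar>w y\<bar> \<le> C * y powr (\<delta> - 1)"
    and "\<And>x y. 0 < y \<Longrightarrow> y \<le> x \<Longrightarrow> x \<le> T \<Longrightarrow> x \<le> \<kappa> * y \<Longrightarrow>
      \<bar>w x - w y\<bar> \<le> C * (x - y) * y powr (\<delta> - 2)"
  shows "weighted_lip T \<kappa> \<delta> w"
  unfolding weighted_lip_def using assms by (intro exI[of _ C]) auto

lemma weighted_lipE:
  assumes "weighted_lip T \<kappa> \<delta> w"
  obtains C where "0 \<le> C" and "\<And>y. 0 < y \<Longrightarrow> y \<le> T \<Longrightarrow> \<bar>w y\<bar> \<le> C * y powr (\<delta> - 1)"
    and "\<And>x y. 0 < y \<Longrightarrow> y \<le> x \<Longrightarrow> x \<le> T \<Longrightarrow> x \<le> \<kappa> * y \<Longrightarrow>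
      \<bar>w x - w y\<bar> \<le> C * (x - y) * y powr (\<delta> - 2)"
proof -
  obtain C where C0: "\<forall>y\<in>{0<..T}. \<bar>w y\<bar> \<le> C * y powr (\<delta> - 1) \<and>
     (\<forall>x\<in>{y..T}. x \<le> \<kappa> * y \<longrightarrow> \<bar>w x - w y\<bar> \<le> C * (x - y) * y powr (\<delta> - 2))"
    using assms unfolding weighted_lip_def by blast
  have C: "\<And>y. 0 < y \<Longrightarrow> y \<le> T \<Longrightarrow> \<bar>w y\<bar> \<le> C * y powr (\<delta> - 1)"
     "\<And>x y. 0 < y \<Longrightarrow> y \<le> x \<Longrightarrow> x \<le> T \<Longrightarrow> x \<le> \<kappa> * y \<Longrightarrow>
      \<bar>w x - w y\<bar> \<le> C * (x - y) * y powr (\<delta> - 2)"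
    using C0 by auto
  show thesis
  proof (rule that[of "\<bar>C\<bar>"])
    show "\<bar>w y\<bar> \<le> \<bar>C\<bar> * y powr (\<delta> - 1)" if "0 < y" "y \<le> T" for y
      using C(1)[OF that] by (rule order_trans) (simp add: mult_right_mono)
    show "\<bar>w x - w y\<bar> \<le> \<bar>C\<bar> * (x - y) * y powr (\<delta> - 2)" if "0 < y" "y \<le> x" "x \<le> T" "x \<le> \<kappa> * y" for x y
      using C(2)[OF that] by (rule order_trans) (use that in \<open>simp add: mult_right_mono\<close>)
  qed simp
qed

lemma powr_comparable:
  fixes y z \<kappa> p :: real
  assumes "0 < y" "0 < z" "y \<le> \<kappa> * z" "z \<le> \<kappa> * y"
  shows "z powr p \<le> \<kappa> powr \<bar>p\<bar> * y powr p"
proof (cases "0 \<le> p")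
  case True
  have "0 < \<kappa>" using assms by (metis less_le_trans mult_pos_pos zero_less_mult_pos2)
  then have "z powr p \<le> (\<kappa> * y) powr p" using assms True by (intro powr_mono2) auto
  then show ?thesis using True assms \<open>0 < \<kappa>\<close> by (simp add: powr_mult)
next
  case False
  have k: "0 < \<kappa>" using assms by (metis less_le_trans mult_pos_pos zero_less_mult_pos2)
  have "y / \<kappa> \<le> z" using assms k by (simp add: field_simps)
  then have "z powr p \<le> (y / \<kappa>) powr p" using assms False k by (intro powr_mono2') auto
  then show ?thesis using False assms k by (simp add: powr_divide powr_minus field_simps)
qed

text \<open>
  On a bounded interval a higher power of \<open>t\<close> is dominated by a lower one.
\<close>

lemma weighted_lip_mono:
  assumes w: "weighted_lip T \<kappa> \<delta> w" and "\<delta>' \<le> \<delta>"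
  shows "weighted_lip T \<kappa> \<delta>' w"
proof -
  obtain C where C: "0 \<le> C" "\<And>y. 0 < y \<Longrightarrow> y \<le> T \<Longrightarrow> \<bar>w y\<bar> \<le> C * y powr (\<delta> - 1)"
     "\<And>x y. 0 < y \<Longrightarrow> y \<le> x \<Longrightarrow> x \<le> T \<Longrightarrow> x \<le> \<kappa> * y \<Longrightarrow>
      \<bar>w x - w y\<bar> \<le> C * (x - y) * y powr (\<delta> - 2)"
    using weighted_lipE[OF w] by metis
  have p: "y powr (\<delta> - q) \<le> T powr (\<delta> - \<delta>') * y powr (\<delta>' - q)" if "0 < y" "y \<le> T" for y q
  proof -
    have "y powr (\<delta> - q) = y powr (\<delta> - \<delta>') * y powr (\<delta>' - q)" by (simp flip: powr_add)
    also have "\<dots> \<le> T powr (\<delta> - \<delta>') * y powr (\<delta>' - q)"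
      using that assms by (intro mult_right_mono powr_mono2) auto
    finally show ?thesis .
  qed
  show ?thesis
  proof (rule weighted_lipI)
    fix y assume y: "0 < y" "y \<le> T"
    have "\<bar>w y\<bar> \<le> C * y powr (\<delta> - 1)" using C(2) y by simp
    also have "\<dots> \<le> C * (T powr (\<delta> - \<delta>') * y powr (\<delta>' - 1))" using p[OF y] C(1) by (rule mult_left_mono)
    finally show "\<bar>w y\<bar> \<le> C * T powr (\<delta> - \<delta>') * y powr (\<delta>' - 1)" by (simp add: mult_ac)
  next
    fix x y assume y: "0 < y" "y \<le> x" "x \<le> T" "x \<le> \<kappa> * y"
    have "\<bar>w x - w y\<bar> \<le> C * (x - y) * y powr (\<delta> - 2)" using C(3) y by simp
    also have "\<dots> \<le> C * (x - y) * (T powr (\<delta> - \<delta>') * y powr (\<delta>' - 2))" using p[of y 2] C(1) y by (intro mult_left_mono) auto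
    finally show "\<bar>w x - w y\<bar> \<le> C * T powr (\<delta> - \<delta>') * (x - y) * y powr (\<delta>' - 2)" by (simp add: mult_ac)
  qed
qed

lemma weighted_lip_add:
  assumes "weighted_lip T \<kappa> \<delta> v" "weighted_lip T \<kappa> \<delta> w"
  shows "weighted_lip T \<kappa> \<delta> (\<lambda>s. v s + w s)"
proof -
  obtain C where C: "\<And>y. 0 < y \<Longrightarrow> y \<le> T \<Longrightarrow> \<bar>v y\<bar> \<le> C * y powr (\<delta> - 1)"
     "\<And>x y. 0 < y \<Longrightarrow> y \<le> x \<Longrightarrow> x \<le> T \<Longrightarrow> x \<le> \<kappa> * y \<Longrightarrow>
      \<bar>v x - v y\<bar> \<le> C * (x - y) * y powr (\<delta> - 2)"
    using weighted_lipE[OF assms(1)] by metis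
  obtain D where D: "\<And>y. 0 < y \<Longrightarrow> y \<le> T \<Longrightarrow> \<bar>w y\<bar> \<le> D * y powr (\<delta> - 1)"
     "\<And>x y. 0 < y \<Longrightarrow> y \<le> x \<Longrightarrow> x \<le> T \<Longrightarrow> x \<le> \<kappa> * y \<Longrightarrow>
      \<bar>w x - w y\<bar> \<le> D * (x - y) * y powr (\<delta> - 2)"
    using weighted_lipE[OF assms(2)] by metis
  show ?thesis
  proof (rule weighted_lipI)
    fix y assume y: "0 < y" "y \<le> T"
    show "\<bar>v y + w y\<bar> \<le> (C + D) * y powr (\<delta> - 1)"
      using C(1)[OF y] D(1)[OF y] by (simp add: distrib_right)
  next
    fix x y assume y: "0 < y" "y \<le> x" "x \<le> T" "x \<le> \<kappa> * y"
    show "\<bar>v x + w x - (v y + w y)\<bar> \<le> (C + D) * (x - y) * y powr (\<delta> - 2)"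
      using C(2)[OF y] D(2)[OF y] by (simp add: distrib_right)
  qed
qed

lemma weighted_lip_cmult:
  assumes "weighted_lip T \<kappa> \<delta> w"
  shows "weighted_lip T \<kappa> \<delta> (\<lambda>s. c * w s)"
proof -
  obtain C where C: "\<And>y. 0 < y \<Longrightarrow> y \<le> T \<Longrightarrow> \<bar>w y\<bar> \<le> C * y powr (\<delta> - 1)"
     "\<And>x y. 0 < y \<Longrightarrow> y \<le> x \<Longrightarrow> x \<le> T \<Longrightarrow> x \<le> \<kappa> * y \<Longrightarrow>
      \<bar>w x - w y\<bar> \<le> C * (x - y) * y powr (\<delta> - 2)"
    using weighted_lipE[OF assms(1)] by metis
  show ?thesis
  proof (rule weighted_lipI)
    fix y assume y: "0 < y" "y \<le> T"
    show "\<bar>c * w y\<bar> \<le> (\<bar>c\<bar> * C) * y powr (\<delta> - 1)"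
      using mult_left_mono[OF C(1)[OF y], of "\<bar>c\<bar>"] by (simp add: abs_mult mult_ac)
  next
    fix x y assume y: "0 < y" "y \<le> x" "x \<le> T" "x \<le> \<kappa> * y"
    show "\<bar>c * w x - c * w y\<bar> \<le> (\<bar>c\<bar> * C) * (x - y) * y powr (\<delta> - 2)"
      using mult_left_mono[OF C(2)[OF y], of "\<bar>c\<bar>"]
      by (simp add: abs_mult mult_ac flip: right_diff_distrib)
  qed
qed

lemma powr_diff_le:
  fixes x y p \<kappa> :: real
  assumes "0 < y" "y \<le> x" "x \<le> \<kappa> * y"
  shows "\<bar>x powr p - y powr p\<bar> \<le> \<bar>p\<bar> * \<kappa> powr \<bar>p - 1\<bar> * (x - y) * y powr (p - 1)"
proof (cases "x = y")
  case False
  have "1 \<le> \<kappa>" using assms by (metis dual_order.trans mult_le_cancel_right1 not_less_iff_gr_or_eq)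
  obtain z where z: "y < z" "z < x" "x powr p - y powr p = (x - y) * (p * z powr (p - 1))"
  proof -
    have "((\<lambda>z. z powr p) has_real_derivative p * z powr (p - 1)) (at z)" if "y \<le> z" for z
      using that assms by (auto intro!: derivative_eq_intros)
    then show thesis
      using MVT2[of y x "\<lambda>z. z powr p" "\<lambda>z. p * z powr (p - 1)"] assms False that by auto
  qed
  have "y \<le> \<kappa> * z" using mult_mono[of 1 \<kappa> y z] z assms \<open>1 \<le> \<kappa>\<close> by auto
  then have "z powr (p - 1) \<le> \<kappa> powr \<bar>p - 1\<bar> * y powr (p - 1)"
    using z assms by (intro powr_comparable) auto
  then have "(x - y) * \<bar>p\<bar> * z powr (p - 1) \<le> (x - y) * \<bar>p\<bar> * (\<kappa> powr \<bar>p - 1\<bar> * y powr (p - 1))"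
    using assms by (intro mult_left_mono) auto
  then show ?thesis using z assms by (simp add: abs_mult mult_ac)
qed auto

lemma weighted_lip_powr: "weighted_lip T \<kappa> \<delta> (\<lambda>s. s powr (\<delta> - 1))"
proof (rule weighted_lipI)
  let ?C = "max 1 (\<bar>\<delta> - 1\<bar> * \<kappa> powr \<bar>\<delta> - 2\<bar>)"
  fix y :: real assume y: "0 < y" "y \<le> T"
  show "\<bar>y powr (\<delta> - 1)\<bar> \<le> ?C * y powr (\<delta> - 1)"
    using mult_right_mono[of 1 ?C "y powr (\<delta> - 1)"] by simp
next
  let ?C = "max 1 (\<bar>\<delta> - 1\<bar> * \<kappa> powr \<bar>\<delta> - 2\<bar>)"
  fix x y :: real assume y: "0 < y" "y \<le> x" "x \<le> T" "x \<le> \<kappa> * y"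
  have "\<bar>x powr (\<delta> - 1) - y powr (\<delta> - 1)\<bar> \<le> \<bar>\<delta> - 1\<bar> * \<kappa> powr \<bar>\<delta> - 1 - 1\<bar> * (x - y) * y powr (\<delta> - 1 - 1)"
    using y by (intro powr_diff_le) auto
  also have "\<dots> = \<bar>\<delta> - 1\<bar> * \<kappa> powr \<bar>\<delta> - 2\<bar> * (x - y) * y powr (\<delta> - 2)" by (simp add: algebra_simps)
  also have "\<dots> \<le> ?C * (x - y) * y powr (\<delta> - 2)"
    using y by (intro mult_right_mono) auto
  finally show "\<bar>x powr (\<delta> - 1) - y powr (\<delta> - 1)\<bar> \<le> ?C * (x - y) * y powr (\<delta> - 2)" .
qed

lemma weighted_lip_continuous_on:
  assumes w: "weighted_lip T \<kappa> \<delta> w" and \<kappa>: "1 < \<kappa>"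
  shows "continuous_on {0<..T} w"
  unfolding continuous_on_def
proof
  fix a assume a: "a \<in> {0<..T}"
  obtain C where C: "0 \<le> C" "\<And>x y. 0 < y \<Longrightarrow> y \<le> x \<Longrightarrow> x \<le> T \<Longrightarrow> x \<le> \<kappa> * y \<Longrightarrow>
      \<bar>w x - w y\<bar> \<le> C * (x - y) * y powr (\<delta> - 2)"
    using weighted_lipE[OF w] by metis
  define L where "L = C * (\<kappa> powr \<bar>\<delta> - 2\<bar> * a powr (\<delta> - 2))"
  have L: "\<bar>w x - w a\<bar> \<le> L * \<bar>x - a\<bar>" if x: "0 < x" "x \<le> T" "x \<le> \<kappa> * a" "a \<le> \<kappa> * x" for x
  proof -
    have 1: "\<bar>w x - w a\<bar> \<le> C * \<bar>x - a\<bar> * (min x a) powr (\<delta> - 2)"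
      using C(2)[of a x] C(2)[of x a] x a by (cases "a \<le> x") (auto simp: min_def abs_minus_commute)
    have "(min x a) powr (\<delta> - 2) \<le> \<kappa> powr \<bar>\<delta> - 2\<bar> * a powr (\<delta> - 2)"
      using x a \<kappa> mult_mono[of 1 \<kappa> a a] by (intro powr_comparable) (auto simp: min_def)
    then have "C * \<bar>x - a\<bar> * (min x a) powr (\<delta> - 2) \<le> C * \<bar>x - a\<bar> * (\<kappa> powr \<bar>\<delta> - 2\<bar> * a powr (\<delta> - 2))"
      using C(1) by (intro mult_left_mono) auto
    with 1 show ?thesis by (simp add: L_def mult_ac)
  qed
  have "((\<lambda>x. w x - w a) \<longlongrightarrow> 0) (at a within {0<..T})"
  proof (rule Lim_null_comparison)
    have "eventually (\<lambda>x. \<bar>x - a\<bar> < min (a - a / \<kappa>) (\<kappa> * a - a)) (at a within {0<..T})"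
      using a \<kappa> unfolding eventually_at by (intro exI[of _ "min (a - a / \<kappa>) (\<kappa> * a - a)"])
        (auto simp: dist_real_def field_simps)
    moreover have "eventually (\<lambda>x. x \<in> {0<..T}) (at a within {0<..T})"
      by (simp add: eventually_at_filter)
    ultimately show "eventually (\<lambda>x. norm (w x - w a) \<le> L * \<bar>x - a\<bar>) (at a within {0<..T})"
    proof eventually_elim
      case (elim x)
      have "a / \<kappa> \<le> x" using elim by auto
      then have "a \<le> \<kappa> * x" using \<kappa> by (simp add: field_simps)
      then show ?case using elim L[of x] by auto
    qed
    have "((\<lambda>x. L * \<bar>x - a\<bar>) \<longlongrightarrow> L * \<bar>a - a\<bar>) (at a within {0<..T})"
      by (intro tendsto_intros)
    then show "((\<lambda>x. L * \<bar>x - a\<bar>) \<longlongrightarrow> 0) (at a within {0<..T})" by simp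
  qed
  then show "(w \<longlongrightarrow> w a) (at a within {0<..T})" by (simp add: LIM_zero_iff)
qed

lemma weighted_lip_measurable:
  assumes "weighted_lip T \<kappa> \<delta> w" "1 < \<kappa>" "t \<le> T"
  shows "w \<in> borel_measurable (lebesgue_on {0<..<t})"
  by (intro continuous_imp_measurable_on_sets_lebesgue
      continuous_on_subset[OF weighted_lip_continuous_on[OF assms(1,2)]]) (use assms in auto)

lemma weighted_lip_integrand:
  assumes w: "weighted_lip T \<kappa> \<delta> w" "1 < \<kappa>" and "0 < \<delta>" "0 < a" "t \<in> {0..T}"
  shows "(\<lambda>s. (t - s) powr (a - 1) * w s) absolutely_integrable_on {0..t}"
proof -
  obtain C where "\<And>y. 0 < y \<Longrightarrow> y \<le> T \<Longrightarrow> \<bar>w y\<bar> \<le> C * y powr (\<delta> - 1)"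
    using weighted_lipE[OF w(1)] by metis
  then show ?thesis
    using assms by (intro frac_integrand_absolutely_integrable[where b = \<delta> and C = C]
       weighted_lip_measurable[OF w]) auto
qed

lemma weighted_lip_integrable:
  assumes w: "weighted_lip T \<kappa> \<delta> w" "1 < \<kappa>" and "0 < \<delta>" "t \<in> {0..T}"
  shows "w absolutely_integrable_on {0..t}"
  by (rule absolutely_integrable_spike[OF weighted_lip_integrand[OF w assms(3) _ assms(4), of 1],
        where S = "{t}"]) auto

lemma frac_int_scaled:
  assumes int: "(\<lambda>s. (x - s) powr (a - 1) * w s) absolutely_integrable_on {0..x}" and x: "0 < x"
    and a: "0 < a"
  shows "((\<lambda>\<theta>. (1 - \<theta>) powr (a - 1) * w (x * \<theta>)) has_integral
     Gamma a * x powr (- a) * frac_int a w x) {0..1}"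
proof -
  have "((\<lambda>s. (x - s) powr (a - 1) * w s) has_integral Gamma a * frac_int a w x) {0..x}"
    using int Gamma_real_pos[OF a] by (simp add: frac_int_def absolutely_integrable_on_def integrable_integral)
  then have "((\<lambda>\<theta>. (x - x * \<theta>) powr (a - 1) * w (x * \<theta>)) has_integral Gamma a * frac_int a w x / x) {0..1}"
    using has_integral_affinity'[of "\<lambda>s. (x - s) powr (a - 1) * w s" "Gamma a * frac_int a w x" 0 x x 0] x
    by (simp add: divide_inverse mult.commute)
  then have "((\<lambda>\<theta>. x powr (1 - a) * ((x - x * \<theta>) powr (a - 1) * w (x * \<theta>))) has_integral
      x powr (1 - a) * (Gamma a * frac_int a w x / x)) {0..1}"
    by (rule has_integral_mult_right)
  moreover have "x powr (1 - a) * (Gamma a * frac_int a w x / x) = Gamma a * x powr (- a) * frac_int a w x"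
    using x by (simp add: powr_diff powr_minus field_simps)
  moreover have "x powr (1 - a) * ((x - x * \<theta>) powr (a - 1) * w (x * \<theta>)) = (1 - \<theta>) powr (a - 1) * w (x * \<theta>)"
    if "\<theta> \<in> {0..1}" for \<theta>
  proof -
    have "(x - x * \<theta>) powr (a - 1) = (x * (1 - \<theta>)) powr (a - 1)" by (simp add: algebra_simps)
    also have "\<dots> = x powr (a - 1) * (1 - \<theta>) powr (a - 1)" using that x by (simp add: powr_mult)
    also have "x powr (1 - a) * (x powr (a - 1) * (1 - \<theta>) powr (a - 1) * w (x * \<theta>)) =
        (x powr (1 - a) * x powr (a - 1)) * ((1 - \<theta>) powr (a - 1) * w (x * \<theta>))" by (simp add: mult_ac)
    also have "x powr (1 - a) * x powr (a - 1) = 1" using x by (simp flip: powr_add)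
    finally show ?thesis using \<open>(x - x * \<theta>) powr (a - 1) = (x * (1 - \<theta>)) powr (a - 1)\<close>
      \<open>(x * (1 - \<theta>)) powr (a - 1) = x powr (a - 1) * (1 - \<theta>) powr (a - 1)\<close> by simp
  qed
  ultimately show ?thesis by (metis (no_types, lifting) has_integral_cong)
qed

text \<open>
  Substituting \<open>s = x\<theta>\<close> gives \<open>\<Gamma>(a) I\<^sup>a w(x) = x\<^sup>a A(x)\<close> with
  \<open>A(x) = \<integral> (1-\<theta>)\<^bsup>a-1\<^esup> w(x\<theta>) d\<theta>\<close> over \<open>[0,1]\<close>. The ratio of \<open>x\<theta>\<close> and \<open>y\<theta>\<close> is that of \<open>x\<close> and \<open>y\<close>, so
  the hypothesis on \<open>w\<close> can be integrated in \<open>\<theta>\<close> and yields the same bounds for \<open>A\<close>; the factor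
  \<open>x\<^sup>a\<close> then shifts the exponent by \<open>a\<close>.
\<close>

lemma weighted_lip_frac_int:
  assumes w: "weighted_lip T \<kappa> \<delta> w" and \<kappa>: "1 < \<kappa>" and \<delta>: "0 < \<delta>" and a: "0 < a"
  shows "weighted_lip T \<kappa> (\<delta> + a) (frac_int a w)"
proof -
  obtain C where C: "0 \<le> C" "\<And>y. 0 < y \<Longrightarrow> y \<le> T \<Longrightarrow> \<bar>w y\<bar> \<le> C * y powr (\<delta> - 1)"
     "\<And>x y. 0 < y \<Longrightarrow> y \<le> x \<Longrightarrow> x \<le> T \<Longrightarrow> x \<le> \<kappa> * y \<Longrightarrow>
      \<bar>w x - w y\<bar> \<le> C * (x - y) * y powr (\<delta> - 2)"
    using weighted_lipE[OF w] by metis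
  define B where "B = Beta a \<delta>"
  have B: "0 < B" unfolding B_def using a \<delta> by (rule Beta_real_pos)
  have G: "0 < Gamma a" using a by (rule Gamma_real_pos)
  define K where "K = \<kappa> powr \<bar>a\<bar> + \<bar>a\<bar> * \<kappa> powr \<bar>a - 1\<bar>"
  have K: "1 \<le> K"
  proof -
    have "1 \<le> \<kappa> powr \<bar>a\<bar>" using \<kappa> by (intro ge_one_powr_ge_zero) auto
    moreover have "0 \<le> \<bar>a\<bar> * \<kappa> powr \<bar>a - 1\<bar>" by simp
    ultimately show ?thesis unfolding K_def by linarith
  qed
  have size: "\<bar>frac_int a w y\<bar> \<le> C * B / Gamma a * y powr (\<delta> + a - 1)" if "0 < y" "y \<le> T" for y
    using frac_int_bound[of a \<delta> y w C] a \<delta> that C(2) weighted_lip_measurable[OF w \<kappa>]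
    by (simp add: B_def add.commute)
  define A where "A = (\<lambda>x. Gamma a * x powr (- a) * frac_int a w x)"
  have A: "((\<lambda>\<theta>. (1 - \<theta>) powr (a - 1) * w (x * \<theta>)) has_integral A x) {0..1}" if "0 < x" "x \<le> T" for x
    unfolding A_def using that a \<delta> by (intro frac_int_scaled weighted_lip_integrand[OF w \<kappa>]) auto
  have A_le: "\<bar>A y\<bar> \<le> C * B * y powr (\<delta> - 1)" if "0 < y" "y \<le> T" for y
  proof -
    have "\<bar>A y\<bar> = Gamma a * y powr (- a) * \<bar>frac_int a w y\<bar>"
      using G by (simp add: A_def abs_mult)
    also have "\<dots> \<le> Gamma a * y powr (- a) * (C * B / Gamma a * y powr (\<delta> + a - 1))"
      using size[OF that] G by (intro mult_left_mono) auto
    also have "\<dots> = C * B * (y powr (- a) * y powr (\<delta> + a - 1))" using G by simp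
    also have "y powr (- a) * y powr (\<delta> + a - 1) = y powr (\<delta> - 1)" by (simp flip: powr_add)
    finally show ?thesis .
  qed
  have A_diff: "\<bar>A x - A y\<bar> \<le> C * B * (x - y) * y powr (\<delta> - 2)"
    if xy: "0 < y" "y \<le> x" "x \<le> T" "x \<le> \<kappa> * y" for x y
  proof -
    have d: "((\<lambda>\<theta>. (1 - \<theta>) powr (a - 1) * w (x * \<theta>) - (1 - \<theta>) powr (a - 1) * w (y * \<theta>)) has_integral A x - A y) {0..1}"
      using xy by (intro has_integral_diff A) auto
    have b: "((\<lambda>\<theta>. C * (x - y) * y powr (\<delta> - 2) * ((1 - \<theta>) powr (a - 1) * (\<theta> - 0) powr (\<delta> - 1))) has_integral
        C * (x - y) * y powr (\<delta> - 2) * (Beta a \<delta> * (1 - 0) powr (a + \<delta> - 1))) {0..1}"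
      using a \<delta> by (intro has_integral_mult_right beta_has_integral) auto
    have "norm (A x - A y) \<le> C * (x - y) * y powr (\<delta> - 2) * (Beta a \<delta> * (1 - 0) powr (a + \<delta> - 1))"
      unfolding integral_unique[OF d, symmetric] integral_unique[OF b, symmetric]
    proof (rule integral_norm_bound_integral[OF has_integral_integrable[OF d] has_integral_integrable[OF b]])
      fix \<theta> :: real assume \<theta>: "\<theta> \<in> {0..1}"
      show "norm ((1 - \<theta>) powr (a - 1) * w (x * \<theta>) - (1 - \<theta>) powr (a - 1) * w (y * \<theta>)) \<le>
        C * (x - y) * y powr (\<delta> - 2) * ((1 - \<theta>) powr (a - 1) * (\<theta> - 0) powr (\<delta> - 1))"
      proof (cases "\<theta> = 0")
        case False
        have le: "x * \<theta> \<le> T" using mult_mono[of x T \<theta> 1] xy \<theta> by auto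
        have "\<bar>w (x * \<theta>) - w (y * \<theta>)\<bar> \<le> C * (x * \<theta> - y * \<theta>) * (y * \<theta>) powr (\<delta> - 2)"
        proof (rule C(3)[OF _ _ le])
          show "x * \<theta> \<le> \<kappa> * (y * \<theta>)" using mult_right_mono[OF xy(4), of \<theta>] \<theta> by (simp add: mult_ac)
        qed (use xy \<theta> False in \<open>auto intro: mult_right_mono\<close>)
        also have "\<dots> = C * (x - y) * y powr (\<delta> - 2) * (\<theta> * \<theta> powr (\<delta> - 2))"
          using xy \<theta> by (simp add: powr_mult algebra_simps)
        also have "\<theta> * \<theta> powr (\<delta> - 2) = \<theta> powr (\<delta> - 1)"
          using \<theta> False powr_mult_base[of \<theta> "\<delta> - 2"] by simp
        finally have "(1 - \<theta>) powr (a - 1) * \<bar>w (x * \<theta>) - w (y * \<theta>)\<bar> \<le>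
            (1 - \<theta>) powr (a - 1) * (C * (x - y) * y powr (\<delta> - 2) * \<theta> powr (\<delta> - 1))"
          by (rule mult_left_mono) simp
        moreover have "norm ((1 - \<theta>) powr (a - 1) * w (x * \<theta>) - (1 - \<theta>) powr (a - 1) * w (y * \<theta>)) =
            (1 - \<theta>) powr (a - 1) * \<bar>w (x * \<theta>) - w (y * \<theta>)\<bar>"
          by (simp add: abs_mult flip: right_diff_distrib)
        ultimately show ?thesis by (simp add: mult_ac)
      qed simp
    qed
    then show ?thesis by (simp add: B_def mult_ac)
  qed
  show ?thesis
  proof (rule weighted_lipI)
    fix y assume y: "0 < y" "y \<le> T"
    have "\<bar>frac_int a w y\<bar> \<le> C * B / Gamma a * y powr (\<delta> + a - 1)" using size y by simp
    also have "\<dots> \<le> C * B / Gamma a * K * y powr (\<delta> + a - 1)"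
      using K B C(1) G mult_left_mono[OF K, of "C * B / Gamma a * y powr (\<delta> + a - 1)"] by (simp add: mult_ac)
    finally show "\<bar>frac_int a w y\<bar> \<le> C * B / Gamma a * K * y powr (\<delta> + a - 1)" .
  next
    fix x y assume xy: "0 < y" "y \<le> x" "x \<le> T" "x \<le> \<kappa> * y"
    have I: "frac_int a w z = z powr a * A z / Gamma a" if "0 < z" for z
    proof -
      have "z powr a * A z = Gamma a * (z powr a * z powr (- a)) * frac_int a w z" by (simp add: A_def mult_ac)
      also have "z powr a * z powr (- a) = 1" using that by (simp flip: powr_add)
      finally show ?thesis using G by simp
    qed
    have "frac_int a w x - frac_int a w y = (x powr a * (A x - A y) + (x powr a - y powr a) * A y) / Gamma a"
      using xy by (simp add: I algebra_simps flip: diff_divide_distrib)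
    then have "\<bar>frac_int a w x - frac_int a w y\<bar> = \<bar>x powr a * (A x - A y) + (x powr a - y powr a) * A y\<bar> / Gamma a"
      using G by (simp add: abs_divide)
    also have "\<bar>x powr a * (A x - A y) + (x powr a - y powr a) * A y\<bar> \<le>
        x powr a * \<bar>A x - A y\<bar> + \<bar>x powr a - y powr a\<bar> * \<bar>A y\<bar>"
      by (rule order_trans[OF abs_triangle_ineq]) (simp add: abs_mult)
    also have "\<dots> \<le> (\<kappa> powr \<bar>a\<bar> * y powr a) * (C * B * (x - y) * y powr (\<delta> - 2)) +
        (\<bar>a\<bar> * \<kappa> powr \<bar>a - 1\<bar> * (x - y) * y powr (a - 1)) * (C * B * y powr (\<delta> - 1))"
    proof (intro add_mono mult_mono)
      have "y \<le> \<kappa> * x" using xy \<kappa> mult_mono[of 1 \<kappa> y x] by auto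
      then show "x powr a \<le> \<kappa> powr \<bar>a\<bar> * y powr a" using xy by (intro powr_comparable) auto
      show "\<bar>x powr a - y powr a\<bar> \<le> \<bar>a\<bar> * \<kappa> powr \<bar>a - 1\<bar> * (x - y) * y powr (a - 1)"
        using xy by (intro powr_diff_le) auto
    qed (use xy A_diff A_le in auto)
    also have "\<dots> = C * B * (x - y) * (\<kappa> powr \<bar>a\<bar> * (y powr a * y powr (\<delta> - 2)) +
         \<bar>a\<bar> * \<kappa> powr \<bar>a - 1\<bar> * (y powr (a - 1) * y powr (\<delta> - 1)))"
      by (simp add: algebra_simps)
    also have "y powr a * y powr (\<delta> - 2) = y powr (\<delta> + a - 2)" by (simp add: algebra_simps flip: powr_add)
    also have "y powr (a - 1) * y powr (\<delta> - 1) = y powr (\<delta> + a - 2)" by (simp add: algebra_simps flip: powr_add)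
    also have "C * B * (x - y) * (\<kappa> powr \<bar>a\<bar> * y powr (\<delta> + a - 2) + \<bar>a\<bar> * \<kappa> powr \<bar>a - 1\<bar> * y powr (\<delta> + a - 2))
        = C * B * K * (x - y) * y powr (\<delta> + a - 2)" by (simp add: K_def algebra_simps)
    finally show "\<bar>frac_int a w x - frac_int a w y\<bar> \<le> C * B / Gamma a * K * (x - y) * y powr (\<delta> + a - 2)"
      using G by (simp add: divide_right_mono)
  qed
qed

section \<open>Regularity of the solution\<close>

lemma frac_int_powr:
  assumes "0 < a" "0 < b" "0 \<le> t"
  shows "frac_int a (\<lambda>s. s powr (b - 1)) t = Gamma b / Gamma (a + b) * t powr (a + b - 1)"
proof -
  have "integral {0..t} (\<lambda>s. (t - s) powr (a - 1) * s powr (b - 1)) = Beta a b * t powr (a + b - 1)"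
    using beta_has_integral[of a b 0 t] assms by (simp add: integral_unique)
  then show ?thesis using Gamma_real_pos[OF assms(1)] by (simp add: frac_int_def Beta_def)
qed

lemma frac_int_commute:
  assumes "(\<lambda>s. (t - s) powr (a + b - 1) * w s) absolutely_integrable_on {0..t}" "0 < a" "0 < b"
  shows "frac_int a (frac_int b w) t = frac_int b (frac_int a w) t"
proof -
  have "frac_int b (frac_int a w) t = frac_int (b + a) w t"
    using assms by (intro frac_int_semigroup) (auto simp: add.commute)
  moreover have "frac_int a (frac_int b w) t = frac_int (a + b) w t"
    using assms by (intro frac_int_semigroup)
  ultimately show ?thesis by (simp add: add.commute)
qed

text \<open>
  Used for the smooth remainder of the iterated equation: a Lipschitz function vanishing at the origin
  has exponent \<open>\<delta> = 2\<close>; the weaker exponent \<open>1\<close> is enough, since \<open>\<alpha> \<le> 1\<close>.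
\<close>

lemma weighted_lip_frac_int_1:
  assumes g: "bounded_measurable T g"
  shows "weighted_lip T \<kappa> 1 (frac_int 1 g)"
proof -
  obtain B where B: "\<forall>s\<in>{0<..<T}. \<bar>g s\<bar> \<le> B"
    using g by (auto simp: bounded_measurable_def)
  let ?g = "\<lambda>s. if s \<in> {0<..<T} then g s else 0"
  have z: "frac_int 1 g t = integral {0..t} ?g" if "t \<le> T" for t
    using that frac_int_cong[of t g ?g 1] by (simp add: frac_int_1)
  have int: "?g integrable_on {0..t}" if t: "t \<in> {0..T}" for t
  proof (rule integrable_spike[where S = "{0, t}"])
    show "(\<lambda>s. (t - s) powr (1 - 1) * g s) integrable_on {0..t}"
      using bounded_measurable_integrand[OF g, of 1 t] t by (auto simp: absolutely_integrable_on_def)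
  qed (use t in auto)
  have lip: "\<bar>frac_int 1 g x - frac_int 1 g y\<bar> \<le> \<bar>B\<bar> * (x - y)" if "0 \<le> y" "y \<le> x" "x \<le> T" for x y
  proof -
    have ix: "?g integrable_on {0..x}" using int that by simp
    have "integral {0..y} ?g + integral {y..x} ?g = integral {0..x} ?g"
      using that ix by (intro Henstock_Kurzweil_Integration.integral_combine) auto
    then have "frac_int 1 g x - frac_int 1 g y = integral {y..x} ?g" using that by (simp add: z)
    also have "norm \<dots> \<le> integral {y..x} (\<lambda>_. \<bar>B\<bar>)"
    proof (rule integral_norm_bound_integral)
      show "?g integrable_on {y..x}" using ix by (rule integrable_subinterval_real) (use that in auto)
    qed (use B in \<open>auto intro: order_trans[OF _ abs_ge_self]\<close>)
    finally show ?thesis using that by (simp add: mult.commute)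
  qed
  show ?thesis
  proof (rule weighted_lipI)
    fix y assume y: "0 < y" "y \<le> T"
    have "\<bar>frac_int 1 g y\<bar> \<le> \<bar>B\<bar> * y" using lip[of 0 y] y by (simp add: frac_int_0)
    also have "\<dots> \<le> \<bar>B\<bar> * T" using y by (intro mult_left_mono) auto
    finally show "\<bar>frac_int 1 g y\<bar> \<le> \<bar>B\<bar> * T * y powr (1 - 1)" using y by simp
  next
    fix x y assume y: "0 < y" "y \<le> x" "x \<le> T" "x \<le> \<kappa> * y"
    have "\<bar>frac_int 1 g x - frac_int 1 g y\<bar> \<le> \<bar>B\<bar> * (x - y) * 1" using lip[of y x] y by simp
    also have "\<dots> \<le> \<bar>B\<bar> * (x - y) * (T / y)" using y by (intro mult_left_mono) auto
    also have "\<dots> = \<bar>B\<bar> * T * (x - y) * y powr (1 - 2)"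
      using y by (simp add: powr_minus divide_inverse mult_ac)
    finally show "\<bar>frac_int 1 g x - frac_int 1 g y\<bar> \<le> \<bar>B\<bar> * T * (x - y) * y powr (1 - 2)" .
  qed
qed

text \<open>
  The bounds on \<open>f'\<close> and \<open>f''\<close> put \<open>f'\<close> into a class with positive exponent. A negative \<open>\<sigma>\<close> is
  first replaced by \<open>0\<close>, so that a bound \<open>z\<^bsup>-\<sigma>'\<^esup> \<le> C z\<^bsup>-1-max \<sigma> 0\<^esup>\<close> with decreasing right-hand side is
  available between \<open>y\<close> and \<open>x\<close>.
\<close>

lemma weighted_lip_derivative:
  fixes f' f'' :: "real \<Rightarrow> real"
  assumes der: "\<And>t. t \<in> {0<..T} \<Longrightarrow> (f' has_real_derivative f'' t) (at t within {0<..T})"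
    and b1: "\<And>t. t \<in> {0<..T} \<Longrightarrow> \<bar>f' t\<bar> \<le> C1 * t powr (- \<sigma>)"
    and b2: "\<And>t. t \<in> {0<..T} \<Longrightarrow> \<bar>f'' t\<bar> \<le> C2 * t powr (- \<sigma>')"
    and "\<sigma>' \<le> 1"
  shows "weighted_lip T \<kappa> (1 - max \<sigma> 0) f'"
proof -
  define m where "m = max \<sigma> 0"
  have m: "0 \<le> m" "\<sigma> \<le> m" by (auto simp: m_def)
  have pw: "t powr (- a) \<le> T powr (b - a) * t powr (- b)" if "0 < t" "t \<le> T" "a \<le> b" for t a b
  proof -
    have "t powr (- a) = t powr (b - a) * t powr (- b)" by (simp flip: powr_add)
    also have "\<dots> \<le> T powr (b - a) * t powr (- b)"
      using that by (intro mult_right_mono powr_mono2) auto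
    finally show ?thesis .
  qed
  define C where "C = max (\<bar>C1\<bar> * T powr (m - \<sigma>)) (\<bar>C2\<bar> * T powr (1 + m - \<sigma>'))"
  have C: "\<bar>C1\<bar> * T powr (m - \<sigma>) \<le> C" "\<bar>C2\<bar> * T powr (1 + m - \<sigma>') \<le> C" by (auto simp: C_def)
  have "weighted_lip T \<kappa> (1 - m) f'"
  proof (rule weighted_lipI)
    fix y assume y: "0 < y" "y \<le> T"
    have "\<bar>f' y\<bar> \<le> C1 * y powr (- \<sigma>)" using b1 y by simp
    also have "\<dots> \<le> \<bar>C1\<bar> * (T powr (m - \<sigma>) * y powr (- m))"
      using y m pw[of y \<sigma> m] by (intro mult_mono) auto
    also have "\<dots> \<le> C * y powr (- m)" using C(1) by (simp add: mult_right_mono flip: mult.assoc)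
    finally show "\<bar>f' y\<bar> \<le> C * y powr (1 - m - 1)" by simp
  next
    fix x y assume y: "0 < y" "y \<le> x" "x \<le> T" "x \<le> \<kappa> * y"
    have "norm (f' x - f' y) \<le> C * y powr (- (1 + m)) * norm (x - y)"
    proof (rule field_differentiable_bound[where S = "{y..x}"])
      fix z assume z: "z \<in> {y..x}"
      show "(f' has_field_derivative f'' z) (at z within {y..x})"
        by (rule has_field_derivative_subset[OF der]) (use z y in auto)
      have "\<bar>f'' z\<bar> \<le> C2 * z powr (- \<sigma>')" using b2 y z by simp
      also have "\<dots> \<le> \<bar>C2\<bar> * (T powr (1 + m - \<sigma>') * z powr (- (1 + m)))"
        using y z m \<open>\<sigma>' \<le> 1\<close> pw[of z \<sigma>' "1 + m"] by (intro mult_mono) auto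
      also have "\<dots> \<le> C * z powr (- (1 + m))" using C(2) by (simp add: mult_right_mono flip: mult.assoc)
      also have "\<dots> \<le> C * y powr (- (1 + m))"
      proof (rule mult_left_mono)
        show "0 \<le> C" using C(1) by (rule order_trans[rotated]) simp
      qed (use y z m in \<open>auto intro!: powr_mono2'\<close>)
      finally show "norm (f'' z) \<le> C * y powr (- (1 + m))" by simp
    qed (use y in auto)
    moreover have "1 - m - 2 = - (1 + m)" by simp
    ultimately show "\<bar>f' x - f' y\<bar> \<le> C * (x - y) * y powr (1 - m - 2)"
      using y by (simp only: real_norm_def) (simp add: mult_ac)
  qed
  then show ?thesis by (simp add: m_def)
qed

lemma integral_derivative_right_limit:
  fixes f f' :: "real \<Rightarrow> real"
  assumes der: "\<And>t. t \<in> {0<..T} \<Longrightarrow> (f has_real_derivative f' t) (at t within {0<..T})"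
    and lim: "(f \<longlongrightarrow> f0) (at_right 0)" and t: "t \<in> {0<..T}"
  shows "integral {0..t} f' = f t - f0"
proof -
  define F where "F = (\<lambda>s. if s \<le> 0 then f0 else f s)"
  have cont: "continuous_on {0<..T} f"
    using der by (intro DERIV_continuous_on)
  have ev: "eventually (\<lambda>s. f s = F s) (at_right 0)"
    by (simp add: F_def eventually_at_filter)
  have derF: "(F has_real_derivative f' x) (at x)" if x: "0 < x" "x < t" for x
  proof -
    have "(f has_real_derivative f' x) (at x within {0<..<T})"
      by (rule has_field_derivative_subset[OF der]) (use x t in auto)
    then have "(f has_real_derivative f' x) (at x)"
      using x t by (subst (asm) at_within_open) auto
    then show ?thesis
      by (rule has_field_derivative_transform_within_open[where S = "{0<..}"]) (use x in \<open>auto simp: F_def\<close>)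
  qed
  have "(f' has_integral (F t - F 0)) {0..t}"
  proof (rule fundamental_theorem_of_calculus_interior)
    show "continuous_on {0..t} F"
    proof (rule continuous_on_IccI)
      show "(F \<longlongrightarrow> F 0) (at_right 0)"
        using lim by (subst tendsto_cong[OF eventually_mono[OF ev]]) (auto simp: F_def)
      have "(f \<longlongrightarrow> f t) (at t within {0<..T})" using cont t by (auto simp: continuous_on_def)
      then have "(f \<longlongrightarrow> f t) (at t within {0<..<t})" by (rule tendsto_within_subset) (use t in auto)
      moreover have "at t within {0<..<t} = at_left t"
        using t by (intro at_within_nhd[where S = "{0<..}"]) auto
      ultimately have "(f \<longlongrightarrow> f t) (at_left t)" by simp
      moreover have "eventually (\<lambda>s. F s = f s) (at_left t)"
        using t eventually_at_left_real[of 0 t] by (auto simp: F_def elim!: eventually_mono)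
      ultimately show "(F \<longlongrightarrow> F t) (at_left t)"
        using t tendsto_cong[of F f "at_left t"] by (simp add: F_def)
      fix x assume x: "0 < x" "x < t"
      then have "isCont F x" using DERIV_isCont[OF derF] by simp
      then show "F \<midarrow>x\<rightarrow> F x" by (simp add: isCont_def)
    qed (use t in auto)
    show "(F has_vector_derivative f' x) (at x)" if "x \<in> {0<..<t}" for x
      using derF[of x] that by (simp add: has_real_derivative_iff_has_vector_derivative)
  qed (use t in auto)
  then show ?thesis using t by (auto simp: F_def)
qed

lemma frac_int_diff:
  assumes "bounded_measurable T g" "bounded_measurable T h" "0 < a" "t \<in> {0..T}"
  shows "frac_int a (\<lambda>s. g s - c * h s) t = frac_int a g t - c * frac_int a h t"
  using frac_int_add[OF bounded_measurable_integrand[OF assms(1,3,4)]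
      bounded_measurable_integrand[OF bounded_measurable_cmult[OF assms(2), of "- c"] assms(3,4)]]
    frac_int_cmult[of a "- c" h t] by simp

text \<open>
  Apply \<open>I\<^sup>\<alpha>\<close> to the equation: \<open>I\<^sup>\<alpha> I\<^bsup>1-\<alpha>\<^esup> u' = I\<^sup>1 u' = u\<close>. The integrability of \<open>u'\<close> used in
  both steps follows from that of \<open>(t-s)\<^bsup>-\<alpha>\<^esup> u'(s)\<close>, because \<open>(t-s)\<^sup>\<alpha>\<close> is bounded.
\<close>

lemma frac_solution_volterra:
  assumes \<alpha>: "0 < \<alpha>" "\<alpha> < 1" and sol: "frac_solution T \<alpha> lam f u"
    and f: "bounded_measurable T f" and u: "bounded_measurable T u" and t: "t \<in> {0..T}"
  shows "u t = frac_int \<alpha> f t - lam * frac_int \<alpha> u t"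
proof (cases "t = 0")
  case True
  then show ?thesis using sol by (simp add: frac_solution_def frac_int_0)
next
  case False
  have u0: "u 0 = 0" and cont: "continuous_on {0..T} u"
    and diff: "\<And>s. s \<in> {0<..<T} \<Longrightarrow> u differentiable (at s)"
    and int: "(\<lambda>s. (t - s) powr (- \<alpha>) * deriv u s) absolutely_integrable_on {0..t}"
    and eq: "\<And>s. s \<in> {0<..T} \<Longrightarrow> frac_int (1 - \<alpha>) (deriv u) s + lam * u s = f s"
    using sol False t by (auto simp: frac_solution_def frac_deriv_def)
  have "(\<lambda>s. (t - s) powr \<alpha>) \<in> borel_measurable (lebesgue_on {0..t})"
    by (intro measurable_restrict_space1 measurable_completion) measurable
  moreover have "bounded ((\<lambda>s. (t - s) powr \<alpha>) ` {0..t})"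
    using \<alpha> by (intro compact_imp_bounded compact_continuous_image continuous_intros continuous_on_powr') auto
  ultimately have "(\<lambda>s. (t - s) powr \<alpha> * ((t - s) powr (- \<alpha>) * deriv u s)) absolutely_integrable_on {0..t}"
    using absolutely_integrable_bounded_measurable_product_real[OF _ _ _ int] by simp
  then have int1: "(\<lambda>s. (t - s) powr (\<alpha> + (1 - \<alpha>) - 1) * deriv u s) absolutely_integrable_on {0..t}"
    by (rule absolutely_integrable_spike[where S = "{t}"]) (auto simp flip: mult.assoc powr_add)
  have "((deriv u) has_integral (u t - u 0)) {0..t}"
  proof (rule fundamental_theorem_of_calculus_interior)
    show "continuous_on {0..t} u" using cont by (rule continuous_on_subset) (use t in auto)
    fix s assume "s \<in> {0<..<t}"
    then show "(u has_vector_derivative deriv u s) (at s)"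
      using diff[of s] t
      by (auto simp: DERIV_deriv_iff_real_differentiable simp flip: has_real_derivative_iff_has_vector_derivative)
  qed (use t in auto)
  then have "u t = frac_int 1 (deriv u) t" by (simp add: frac_int_1 u0 integral_unique)
  also have "\<dots> = frac_int \<alpha> (frac_int (1 - \<alpha>) (deriv u)) t"
    using frac_int_semigroup[OF _ _ int1] \<alpha> by simp
  also have "\<dots> = frac_int \<alpha> (\<lambda>s. f s - lam * u s) t"
  proof (rule frac_int_cong)
    show "frac_int (1 - \<alpha>) (deriv u) s = f s - lam * u s" if "s \<in> {0<..<t}" for s
      using eq[of s] that t by auto
  qed
  also have "\<dots> = frac_int \<alpha> f t - lam * frac_int \<alpha> u t"
    by (rule frac_int_diff[OF f u \<alpha>(1) t])
  finally show ?thesis .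
qed

text \<open>
  The density is \<open>q = f0 t\<^bsup>\<alpha>-1\<^esup>/\<Gamma>(\<alpha>) + I\<^sup>\<alpha> f'\<close>: insert \<open>f = f0 + I\<^sup>1 f'\<close> and commute the integrals. The
  first term is responsible for the singularity of the derivative of \<open>u\<close> at the origin.
\<close>

lemma frac_int_forcing:
  assumes \<alpha>: "0 < \<alpha>" and \<kappa>: "1 < \<kappa>"
    and der: "\<And>t. t \<in> {0<..T} \<Longrightarrow> (f has_real_derivative f' t) (at t within {0<..T})"
    and lim: "(f \<longlongrightarrow> f0) (at_right 0)"
    and f': "weighted_lip T \<kappa> \<delta> f'" "0 < \<delta>"
  shows "\<exists>q. weighted_lip T \<kappa> \<alpha> q \<and> (\<forall>t\<in>{0..T}. frac_int \<alpha> f t = frac_int 1 q t)"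
proof (intro exI conjI ballI)
  let ?p = "\<lambda>s. f0 / Gamma \<alpha> * s powr (\<alpha> - 1)"
  let ?q = "\<lambda>s. ?p s + frac_int \<alpha> f' s"
  have p: "weighted_lip T \<kappa> \<alpha> ?p" by (intro weighted_lip_cmult weighted_lip_powr)
  have r: "weighted_lip T \<kappa> \<alpha> (frac_int \<alpha> f')"
    by (rule weighted_lip_mono[OF weighted_lip_frac_int[OF f'(1) \<kappa> f'(2) \<alpha>]]) (use f' in auto)
  show "weighted_lip T \<kappa> \<alpha> ?q" using p r by (rule weighted_lip_add)
  fix t assume t: "t \<in> {0..T}"
  have G: "Gamma \<alpha> \<noteq> 0" using Gamma_real_pos[OF \<alpha>] by linarith
  have int: "(\<lambda>s. (t - s) powr (\<alpha> + 1 - 1) * f' s) absolutely_integrable_on {0..t}"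
    using weighted_lip_integrand[OF f'(1) \<kappa> f'(2), of "\<alpha> + 1" t] \<alpha> t by simp
  have "frac_int \<alpha> f t = frac_int \<alpha> (\<lambda>s. f0 * s powr (1 - 1) + frac_int 1 f' s) t"
  proof (rule frac_int_cong)
    fix s assume "s \<in> {0<..<t}"
    then show "f s = f0 * s powr (1 - 1) + frac_int 1 f' s"
      using integral_derivative_right_limit[OF der lim, of s] t by (simp add: frac_int_1)
  qed
  also have "\<dots> = frac_int \<alpha> (\<lambda>s. f0 * s powr (1 - 1)) t + frac_int \<alpha> (frac_int 1 f') t"
  proof (rule frac_int_add)
    have "weighted_lip T \<kappa> 1 (\<lambda>s. f0 * s powr (1 - 1))" by (intro weighted_lip_cmult weighted_lip_powr)
    then show "(\<lambda>s. (t - s) powr (\<alpha> - 1) * (f0 * s powr (1 - 1))) absolutely_integrable_on {0..t}"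
      using \<kappa> \<alpha> t by (intro weighted_lip_integrand[where T = T and \<kappa> = \<kappa> and \<delta> = 1]) auto
    show "(\<lambda>s. (t - s) powr (\<alpha> - 1) * frac_int 1 f' s) absolutely_integrable_on {0..t}"
      by (rule frac_int_semigroup_integrable[OF \<alpha> _ int]) simp
  qed
  also have "frac_int \<alpha> (\<lambda>s. f0 * s powr (1 - 1)) t = frac_int 1 ?p t"
    unfolding frac_int_cmult using frac_int_powr[of \<alpha> 1 t] frac_int_powr[of 1 \<alpha> t] \<alpha> t G
    by (simp add: add.commute)
  also have "frac_int \<alpha> (frac_int 1 f') t = frac_int 1 (frac_int \<alpha> f') t"
    by (rule frac_int_commute[OF int \<alpha>]) simp
  also have "frac_int 1 ?p t + frac_int 1 (frac_int \<alpha> f') t = frac_int 1 ?q t"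
    using t \<alpha> by (intro frac_int_add[symmetric] weighted_lip_integrand[OF p \<kappa>] weighted_lip_integrand[OF r \<kappa>]) auto
  finally show "frac_int \<alpha> f t = frac_int 1 ?q t" .
qed

text \<open>
  Each step replaces \<open>u\<close> inside the remainder by \<open>I\<^sup>\<alpha> f - \<lambda> I\<^sup>\<alpha> u\<close>. The remainder is kept as a single
  fractional integral of \<open>u\<close>, about which only boundedness is known so far; the exponents start at
  \<open>\<alpha>\<close> because \<open>I\<^sup>0\<close> is not given by the integral formula.
\<close>

lemma volterra_iterate:
  assumes \<alpha>: "0 < \<alpha>" and \<kappa>: "1 < \<kappa>"
    and f: "bounded_measurable T f" and u: "bounded_measurable T u"
    and volterra: "\<And>t. t \<in> {0..T} \<Longrightarrow> u t = frac_int \<alpha> f t - lam * frac_int \<alpha> u t"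
    and q0: "weighted_lip T \<kappa> \<alpha> q0" "\<And>t. t \<in> {0..T} \<Longrightarrow> frac_int \<alpha> f t = frac_int 1 q0 t"
  shows "\<exists>q. weighted_lip T \<kappa> \<alpha> q \<and>
     (\<forall>t\<in>{0..T}. u t = frac_int 1 q t + (- lam) ^ Suc N * frac_int (real (Suc N) * \<alpha>) u t)"
proof (induction N)
  case 0
  show ?case using volterra q0 by (intro exI[of _ q0]) auto
next
  case (Suc N)
  then obtain q where q: "weighted_lip T \<kappa> \<alpha> q"
    "\<And>t. t \<in> {0..T} \<Longrightarrow> u t = frac_int 1 q t + (- lam) ^ Suc N * frac_int (real (Suc N) * \<alpha>) u t" by blast
  define \<beta> where "\<beta> = real (Suc N) * \<alpha>"
  have \<beta>: "0 < \<beta>" using \<alpha> by (simp add: \<beta>_def)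
  have \<beta>': "\<beta> + \<alpha> = real (Suc (Suc N)) * \<alpha>" by (simp add: \<beta>_def algebra_simps)
  let ?r = "\<lambda>s. (- lam) ^ Suc N * frac_int \<beta> q0 s"
  have r: "weighted_lip T \<kappa> \<alpha> ?r"
    using \<beta> \<alpha> by (intro weighted_lip_cmult weighted_lip_mono[OF weighted_lip_frac_int[OF q0(1) \<kappa> \<alpha> \<beta>]]) simp
  show ?case
  proof (intro exI[of _ "\<lambda>s. q s + ?r s"] conjI ballI)
    show "weighted_lip T \<kappa> \<alpha> (\<lambda>s. q s + ?r s)" using q(1) r by (rule weighted_lip_add)
    fix t assume t: "t \<in> {0..T}"
    have int: "(\<lambda>s. (t - s) powr (\<beta> + 1 - 1) * q0 s) absolutely_integrable_on {0..t}"
      using weighted_lip_integrand[OF q0(1) \<kappa> \<alpha>, of "\<beta> + 1" t] \<beta> t by simp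
    have "frac_int \<beta> u t = frac_int \<beta> (\<lambda>s. frac_int \<alpha> f s - lam * frac_int \<alpha> u s) t"
      using volterra t by (intro frac_int_cong) auto
    also have "\<dots> = frac_int \<beta> (frac_int \<alpha> f) t - lam * frac_int \<beta> (frac_int \<alpha> u) t"
      using f u t \<alpha> \<beta> by (intro frac_int_diff bounded_measurable_frac_int)
    also have "frac_int \<beta> (frac_int \<alpha> f) t = frac_int \<beta> (frac_int 1 q0) t"
      using q0(2) t by (intro frac_int_cong) auto
    also have "\<dots> = frac_int 1 (frac_int \<beta> q0) t"
      by (rule frac_int_commute[OF int \<beta>]) simp
    also have "frac_int \<beta> (frac_int \<alpha> u) t = frac_int (\<beta> + \<alpha>) u t"
      using \<alpha> \<beta> t u by (intro frac_int_semigroup bounded_measurable_integrand) auto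
    finally have step: "frac_int \<beta> u t = frac_int 1 (frac_int \<beta> q0) t - lam * frac_int (\<beta> + \<alpha>) u t" .
    have "u t = frac_int 1 q t + (- lam) ^ Suc N * (frac_int 1 (frac_int \<beta> q0) t - lam * frac_int (\<beta> + \<alpha>) u t)"
      using q(2)[OF t] unfolding \<beta>_def[symmetric] step .
    then have "u t = frac_int 1 q t + frac_int 1 ?r t + (- lam) ^ Suc (Suc N) * frac_int (\<beta> + \<alpha>) u t"
      unfolding frac_int_cmult power_Suc[of "- lam" "Suc N"] right_diff_distrib
      by (simp del: power_Suc)
    moreover have "frac_int 1 (\<lambda>s. q s + ?r s) t = frac_int 1 q t + frac_int 1 ?r t"
      using t \<alpha> by (intro frac_int_add weighted_lip_integrand[OF q(1) \<kappa>] weighted_lip_integrand[OF r \<kappa>]) auto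
    ultimately show "u t = frac_int 1 (\<lambda>s. q s + ?r s) t +
        (- lam) ^ Suc (Suc N) * frac_int (real (Suc (Suc N)) * \<alpha>) u t"
      by (simp only: \<beta>')
  qed
qed

text \<open>
  Once \<open>N\<alpha> > 2\<close>, the remainder is \<open>I\<^sup>1\<close> of the Lipschitz function \<open>I\<^sup>1 I\<^bsup>N\<alpha>-2\<^esup> u\<close>, hence as regular as the
  terms that were split off.
\<close>

lemma volterra_regular:
  assumes \<alpha>: "0 < \<alpha>" "\<alpha> \<le> 1" and \<kappa>: "1 < \<kappa>"
    and f: "bounded_measurable T f" and u: "bounded_measurable T u"
    and volterra: "\<And>t. t \<in> {0..T} \<Longrightarrow> u t = frac_int \<alpha> f t - lam * frac_int \<alpha> u t"
    and q0: "weighted_lip T \<kappa> \<alpha> q0" "\<And>t. t \<in> {0..T} \<Longrightarrow> frac_int \<alpha> f t = frac_int 1 q0 t"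
  shows "\<exists>w. weighted_lip T \<kappa> \<alpha> w \<and> (\<forall>t\<in>{0..T}. u t = frac_int 1 w t)"
proof -
  obtain N where "2 < real N * \<alpha>" using reals_Archimedean3[OF \<alpha>(1)] by blast
  then have N: "2 < real (Suc N) * \<alpha>" using \<alpha> by (simp add: distrib_right)
  define b where "b = real (Suc N) * \<alpha> - 2"
  have b: "0 < b" "real (Suc N) * \<alpha> = 1 + (1 + b)" using N by (auto simp: b_def)
  obtain q where q: "weighted_lip T \<kappa> \<alpha> q"
    "\<And>t. t \<in> {0..T} \<Longrightarrow> u t = frac_int 1 q t + (- lam) ^ Suc N * frac_int (real (Suc N) * \<alpha>) u t"
    using volterra_iterate[OF \<alpha>(1) \<kappa> f u volterra q0, of N] by blast
  let ?z = "\<lambda>s. (- lam) ^ Suc N * frac_int 1 (frac_int b u) s"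
  have z: "weighted_lip T \<kappa> \<alpha> ?z"
    using \<alpha> by (intro weighted_lip_cmult weighted_lip_mono[OF weighted_lip_frac_int_1[OF bounded_measurable_frac_int[OF u b(1)]]])
  show ?thesis
  proof (intro exI[of _ "\<lambda>s. q s + ?z s"] conjI ballI)
    show "weighted_lip T \<kappa> \<alpha> (\<lambda>s. q s + ?z s)" using q(1) z by (rule weighted_lip_add)
    fix t assume t: "t \<in> {0..T}"
    have "frac_int (1 + (1 + b)) u t = frac_int 1 (frac_int (1 + b) u) t"
      using b t u by (intro frac_int_semigroup[symmetric] bounded_measurable_integrand) auto
    also have "\<dots> = frac_int 1 (frac_int 1 (frac_int b u)) t"
    proof (rule frac_int_cong)
      fix s assume "s \<in> {0<..<t}"
      then show "frac_int (1 + b) u s = frac_int 1 (frac_int b u) s"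
        using b t u by (intro frac_int_semigroup[symmetric] bounded_measurable_integrand) auto
    qed
    finally have "u t = frac_int 1 q t + frac_int 1 ?z t" using q(2)[OF t] b(2) unfolding frac_int_cmult by simp
    moreover have "frac_int 1 (\<lambda>s. q s + ?z s) t = frac_int 1 q t + frac_int 1 ?z t"
      using t \<alpha> by (intro frac_int_add weighted_lip_integrand[OF q(1) \<kappa>] weighted_lip_integrand[OF z \<kappa>]) auto
    ultimately show "u t = frac_int 1 (\<lambda>s. q s + ?z s) t" by simp
  qed
qed

lemma deriv_frac_int_1:
  assumes w: "weighted_lip T \<kappa> \<delta> w" "1 < \<kappa>" "0 < \<delta>"
    and u: "\<And>t. t \<in> {0..T} \<Longrightarrow> u t = frac_int 1 w t" and x: "x \<in> {0<..<T}"
  shows "deriv u x = w x"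
proof -
  have "continuous_on {0<..<T} w"
    using weighted_lip_continuous_on[OF w(1,2)] by (rule continuous_on_subset) auto
  then have "isCont w x" using x by (simp add: continuous_on_eq_continuous_at)
  then have "((\<lambda>t. integral {0..t} w) has_vector_derivative w x) (at x within {0..T} - {})"
    using weighted_lip_integrable[OF w, of T] x
    by (intro integral_has_vector_derivative_continuous_at)
       (auto simp: absolutely_integrable_on_def intro: continuous_at_imp_continuous_at_within)
  then have "((\<lambda>t. integral {0..t} w) has_real_derivative w x) (at x)"
    using x by (simp add: has_real_derivative_iff_has_vector_derivative at_within_Icc_at)
  then have "(u has_real_derivative w x) (at x)"
    by (rule has_field_derivative_transform_within_open[where S = "{0<..<T}"])
       (use x u in \<open>auto simp: frac_int_1\<close>)
  then show ?thesis by (rule DERIV_imp_deriv)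
qed

lemma frac_pow_0: "frac_pow \<alpha> lam 0 g = g"
  by (simp add: frac_pow_def)

lemma frac_pow_Suc: "frac_pow \<alpha> lam (Suc k) g t = - lam * frac_int \<alpha> (frac_pow \<alpha> lam k g) t"
  by (simp add: frac_pow_def)

lemma bounded_measurable_frac_pow:
  assumes "bounded_measurable T g" "0 < \<alpha>"
  shows "bounded_measurable T (frac_pow \<alpha> lam k g)"
proof (induction k)
  case (Suc k)
  have "frac_pow \<alpha> lam (Suc k) g = (\<lambda>t. - lam * frac_int \<alpha> (frac_pow \<alpha> lam k g) t)"
    by (rule ext) (rule frac_pow_Suc)
  then show ?case using bounded_measurable_cmult[OF bounded_measurable_frac_int[OF Suc assms(2)], of "- lam"] by simp
qed (use assms in \<open>simp add: frac_pow_0\<close>)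

text \<open>
  All operators are fractional integrals of the one density \<open>w0\<close> and therefore commute: applying \<open>J\<close> to
  \<open>I\<^bsup>1-\<alpha>\<^esup> w0 = f - \<lambda> u\<close> and to \<open>u = I\<^sup>1 w0\<close> produces the equation for \<open>J u\<close> with density \<open>J w0\<close>.
\<close>

lemma frac_pow_solution:
  assumes \<alpha>: "0 < \<alpha>" "\<alpha> < 1" and \<kappa>: "1 < \<kappa>"
    and f: "bounded_measurable T f" and u: "bounded_measurable T u"
    and w0: "weighted_lip T \<kappa> \<alpha> w0" "\<And>t. t \<in> {0..T} \<Longrightarrow> u t = frac_int 1 w0 t"
      "\<And>t. t \<in> {0<..T} \<Longrightarrow> frac_int (1 - \<alpha>) w0 t = f t - lam * u t"
  shows "\<exists>w. weighted_lip T \<kappa> (real (Suc k) * \<alpha>) w \<and>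
     (\<forall>t\<in>{0..T}. frac_pow \<alpha> lam k u t = frac_int 1 w t) \<and>
     (\<forall>t\<in>{0<..T}. frac_int (1 - \<alpha>) w t = frac_pow \<alpha> lam k f t - lam * frac_pow \<alpha> lam k u t)"
proof (induction k)
  case 0
  show ?case using w0 by (intro exI[of _ w0]) (auto simp: frac_pow_0)
next
  case (Suc k)
  then obtain w where w: "weighted_lip T \<kappa> (real (Suc k) * \<alpha>) w"
    "\<And>t. t \<in> {0..T} \<Longrightarrow> frac_pow \<alpha> lam k u t = frac_int 1 w t"
    "\<And>t. t \<in> {0<..T} \<Longrightarrow> frac_int (1 - \<alpha>) w t = frac_pow \<alpha> lam k f t - lam * frac_pow \<alpha> lam k u t"
    by blast
  define \<delta> where "\<delta> = real (Suc k) * \<alpha>"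
  have \<delta>: "0 < \<delta>" "\<delta> + \<alpha> = real (Suc (Suc k)) * \<alpha>"
    unfolding \<delta>_def using \<alpha> by (simp, simp add: algebra_simps)
  note w1 = w(1)[folded \<delta>_def]
  have int: "(\<lambda>s. (t - s) powr (a - 1) * w s) absolutely_integrable_on {0..t}" if "0 < a" "t \<in> {0..T}" for a t
    using weighted_lip_integrand[OF w1 \<kappa> \<delta>(1)] that by auto
  let ?w = "\<lambda>s. - lam * frac_int \<alpha> w s"
  show ?case
  proof (intro exI[of _ ?w] conjI ballI)
    show "weighted_lip T \<kappa> (real (Suc (Suc k)) * \<alpha>) ?w"
      using weighted_lip_frac_int[OF w1 \<kappa> \<delta>(1) \<alpha>(1)] unfolding \<delta>(2) by (rule weighted_lip_cmult)
  next
    fix t assume t: "t \<in> {0..T}"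
    have "frac_pow \<alpha> lam (Suc k) u t = - lam * frac_int \<alpha> (frac_int 1 w) t"
      unfolding frac_pow_Suc using w(2) t by (intro arg_cong2[of _ _ _ _ "(*)"] frac_int_cong) auto
    also have "frac_int \<alpha> (frac_int 1 w) t = frac_int 1 (frac_int \<alpha> w) t"
      using \<alpha> t by (intro frac_int_commute int) auto
    finally show "frac_pow \<alpha> lam (Suc k) u t = frac_int 1 ?w t" by (simp only: frac_int_cmult)
  next
    fix t assume t: "t \<in> {0<..T}"
    have "frac_int (1 - \<alpha>) ?w t = - lam * frac_int \<alpha> (frac_int (1 - \<alpha>) w) t"
      unfolding frac_int_cmult using \<alpha> t by (subst frac_int_commute[OF int]) auto
    also have "frac_int \<alpha> (frac_int (1 - \<alpha>) w) t =
        frac_int \<alpha> (\<lambda>s. frac_pow \<alpha> lam k f s - lam * frac_pow \<alpha> lam k u s) t"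
      using w(3) t by (intro frac_int_cong) auto
    also have "\<dots> = frac_int \<alpha> (frac_pow \<alpha> lam k f) t - lam * frac_int \<alpha> (frac_pow \<alpha> lam k u) t"
      using f u t \<alpha> by (intro frac_int_diff bounded_measurable_frac_pow) auto
    finally show "frac_int (1 - \<alpha>) ?w t = frac_pow \<alpha> lam (Suc k) f t - lam * frac_pow \<alpha> lam (Suc k) u t"
      by (simp add: frac_pow_Suc algebra_simps)
  qed
qed

text \<open>
  The step from \<open>n\<close> to \<open>n + 1\<close> is the integrated equation \<open>J\<^sup>n u = I\<^sup>\<alpha> J\<^sup>n f + J\<^bsup>n+1\<^esup> u\<close>.
\<close>

lemma solution_expansion:
  assumes \<alpha>: "0 < \<alpha>" "\<alpha> < 1" and \<kappa>: "1 < \<kappa>"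
    and f: "bounded_measurable T f" and u: "bounded_measurable T u"
    and w0: "weighted_lip T \<kappa> \<alpha> w0" "\<And>t. t \<in> {0..T} \<Longrightarrow> u t = frac_int 1 w0 t"
      "\<And>t. t \<in> {0<..T} \<Longrightarrow> frac_int (1 - \<alpha>) w0 t = f t - lam * u t"
    and t: "t \<in> {0..T}"
  shows "u t = frac_pow \<alpha> lam n u t + frac_int \<alpha> (\<lambda>s. \<Sum>i<n. frac_pow \<alpha> lam i f s) t"
proof (induction n)
  case 0
  have "frac_int \<alpha> (\<lambda>s. 0) t = 0" by (simp add: frac_int_def)
  then show ?case by (simp add: frac_pow_0)
next
  case (Suc n)
  obtain w where w: "weighted_lip T \<kappa> (real (Suc n) * \<alpha>) w"
    "\<And>t. t \<in> {0..T} \<Longrightarrow> frac_pow \<alpha> lam n u t = frac_int 1 w t"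
    "\<And>t. t \<in> {0<..T} \<Longrightarrow> frac_int (1 - \<alpha>) w t = frac_pow \<alpha> lam n f t - lam * frac_pow \<alpha> lam n u t"
    using frac_pow_solution[OF \<alpha> \<kappa> f u w0, of n] by blast
  have bm: "bounded_measurable T (\<lambda>s. \<Sum>i<n. frac_pow \<alpha> lam i f s)"
  proof (induction n)
    case 0
    show ?case by (auto simp: bounded_measurable_def)
  next
    case (Suc n)
    then show ?case using bounded_measurable_frac_pow[OF f \<alpha>(1)] by (simp add: bounded_measurable_add)
  qed
  have "frac_pow \<alpha> lam n u t = frac_int (\<alpha> + (1 - \<alpha>)) w t" using w(2) t by simp
  also have "\<dots> = frac_int \<alpha> (frac_int (1 - \<alpha>) w) t"
    using \<alpha> t weighted_lip_integrand[OF w(1) \<kappa>, of 1 t] by (intro frac_int_semigroup[symmetric]) auto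
  also have "\<dots> = frac_int \<alpha> (\<lambda>s. frac_pow \<alpha> lam n f s - lam * frac_pow \<alpha> lam n u s) t"
    using w(3) t by (intro frac_int_cong) auto
  also have "\<dots> = frac_int \<alpha> (frac_pow \<alpha> lam n f) t + frac_pow \<alpha> lam (Suc n) u t"
    using f u t \<alpha> frac_int_diff[of T "frac_pow \<alpha> lam n f" "frac_pow \<alpha> lam n u" \<alpha> t lam]
    by (simp add: bounded_measurable_frac_pow frac_pow_Suc)
  finally have "frac_pow \<alpha> lam n u t = frac_int \<alpha> (frac_pow \<alpha> lam n f) t + frac_pow \<alpha> lam (Suc n) u t" .
  moreover have "frac_int \<alpha> (\<lambda>s. \<Sum>i<Suc n. frac_pow \<alpha> lam i f s) t =
      frac_int \<alpha> (\<lambda>s. \<Sum>i<n. frac_pow \<alpha> lam i f s) t + frac_int \<alpha> (frac_pow \<alpha> lam n f) t"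
    using frac_int_add[OF bounded_measurable_integrand[OF bm \<alpha>(1) t]
        bounded_measurable_integrand[OF bounded_measurable_frac_pow[OF f \<alpha>(1)] \<alpha>(1) t]] by simp
  ultimately show ?case using Suc by simp
qed

section \<open>Monotonicity and stability of the L1 operator\<close>

definition L1_weight :: "real \<Rightarrow> (nat \<Rightarrow> real) \<Rightarrow> nat \<Rightarrow> nat \<Rightarrow> real" where
  "L1_weight \<alpha> t m k = ((t m - t k) powr (1 - \<alpha>) - (t m - t (k + 1)) powr (1 - \<alpha>)) /
     (Gamma (2 - \<alpha>) * (t (k + 1) - t k))"

lemma L1_op_weight: "L1_op \<alpha> t V m = (\<Sum>k<m. L1_weight \<alpha> t m k * (V (k + 1) - V k))"
  by (simp add: L1_op_def L1_weight_def sum_distrib_left mult_ac)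

lemma Gamma_2_minus:
  assumes "(\<alpha>::real) < 1"
  shows "Gamma (2 - \<alpha>) = (1 - \<alpha>) * Gamma (1 - \<alpha>)"
proof -
  have "Gamma ((1 - \<alpha>) + 1) = (1 - \<alpha>) * Gamma (1 - \<alpha>)"
    by (rule Gamma_plus1) (use assms in \<open>auto elim!: nonpos_Ints_cases\<close>)
  then show ?thesis by (simp add: algebra_simps)
qed

text \<open>
  The weight of a cell is the kernel \<open>(t\<^sub>m - s)\<^bsup>-\<alpha>\<^esup>/\<Gamma>(1-\<alpha>)\<close> averaged over the cell, hence one of its
  values in the interior. For the last cell an interior point matters, as the kernel blows up
  at \<open>t\<^sub>m\<close>.
\<close>

lemma L1_weight_mean_value:
  assumes \<alpha>: "0 < \<alpha>" "\<alpha> < 1" and t: "t k < t (k + 1)" "t (k + 1) \<le> t m"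
  obtains z where "t k < z" "z < t (k + 1)" "L1_weight \<alpha> t m k = (t m - z) powr (- \<alpha>) / Gamma (1 - \<alpha>)"
proof -
  let ?F = "\<lambda>s. - ((t m - s) powr (1 - \<alpha>) / (1 - \<alpha>))"
  have D: "(?F has_real_derivative (t m - z) powr (- \<alpha>)) (at z)" if "z < t (k + 1)" for z
    using that t \<alpha> by (auto intro!: derivative_eq_intros)
  have "\<exists>l z. t k < z \<and> z < t (k + 1) \<and> (?F has_real_derivative l) (at z) \<and>
     ?F (t (k + 1)) - ?F (t k) = (t (k + 1) - t k) * l"
  proof (rule MVT[OF t(1)])
    show "continuous_on {t k..t (k + 1)} ?F"
      using \<alpha> t by (intro continuous_intros continuous_on_powr') auto
  qed (use D real_differentiable_def in blast)
  then obtain l z where z: "t k < z" "z < t (k + 1)" "(?F has_real_derivative l) (at z)"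
    "?F (t (k + 1)) - ?F (t k) = (t (k + 1) - t k) * l" by blast
  have "l = (t m - z) powr (- \<alpha>)" using z D DERIV_unique by blast
  then have "(t m - t k) powr (1 - \<alpha>) - (t m - t (k + 1)) powr (1 - \<alpha>) =
     (1 - \<alpha>) * (t (k + 1) - t k) * (t m - z) powr (- \<alpha>)"
  proof -
    have "((t m - t k) powr (1 - \<alpha>) - (t m - t (k + 1)) powr (1 - \<alpha>)) / (1 - \<alpha>) =
        (t (k + 1) - t k) * l"
      using z(4) by (simp add: diff_divide_distrib)
    then show ?thesis
      using \<alpha> unfolding \<open>l = _\<close> by (simp add: divide_eq_eq mult_ac)
  qed
  then have "L1_weight \<alpha> t m k = (t m - z) powr (- \<alpha>) / Gamma (1 - \<alpha>)"
    using \<alpha> t unfolding L1_weight_def Gamma_2_minus[OF \<alpha>(2)]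
    by (simp del: right_diff_distrib_numeral left_diff_distrib_numeral)
  with z show thesis by (intro that) auto
qed

lemma
  assumes \<alpha>: "0 < \<alpha>" "\<alpha> < 1" and t: "t k < t (k + 1)" "t (k + 1) \<le> t m"
  shows L1_weight_ge: "(t m - t k) powr (- \<alpha>) / Gamma (1 - \<alpha>) \<le> L1_weight \<alpha> t m k"
    and L1_weight_le: "t (k + 1) < t m \<Longrightarrow>
      L1_weight \<alpha> t m k \<le> (t m - t (k + 1)) powr (- \<alpha>) / Gamma (1 - \<alpha>)"
proof -
  obtain z where z: "t k < z" "z < t (k + 1)" "L1_weight \<alpha> t m k = (t m - z) powr (- \<alpha>) / Gamma (1 - \<alpha>)"
    using L1_weight_mean_value[where t = t and k = k and m = m] assms by metis
  have G: "0 < Gamma (1 - \<alpha>)" using \<alpha> by (intro Gamma_real_pos) auto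
  show "(t m - t k) powr (- \<alpha>) / Gamma (1 - \<alpha>) \<le> L1_weight \<alpha> t m k"
    unfolding z(3) using G z t \<alpha> by (intro divide_right_mono powr_mono2') auto
  show "L1_weight \<alpha> t m k \<le> (t m - t (k + 1)) powr (- \<alpha>) / Gamma (1 - \<alpha>)" if "t (k + 1) < t m"
    unfolding z(3) using G z t \<alpha> that by (intro divide_right_mono powr_mono2') auto
qed

lemma L1_weight_mono:
  assumes \<alpha>: "0 < \<alpha>" "\<alpha> < 1" and t: "strict_mono_on {..m} t" "k + 1 < m"
  shows "L1_weight \<alpha> t m k \<le> L1_weight \<alpha> t m (k + 1)"
proof -
  have "t k < t (k + 1)" "t (k + 1) < t (k + 2)" "t (k + 1) < t m"
    using t by (auto simp: strict_mono_on_def)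
  moreover have "t (k + 2) \<le> t m"
    using t strict_mono_on_leD[OF t(1), of "k + 2" m] by auto
  ultimately show ?thesis
    using L1_weight_le[OF \<alpha>, of t k m] L1_weight_ge[OF \<alpha>, of t "k + 1" m] by auto
qed

lemma L1_weight_pos:
  assumes \<alpha>: "0 < \<alpha>" "\<alpha> < 1" and t: "strict_mono_on {..m} t" "k < m"
  shows "0 < L1_weight \<alpha> t m k"
proof -
  have 1: "t k < t (k + 1)" "t (k + 1) \<le> t m"
    using t strict_mono_on_leD[OF t(1), of "k + 1" m] by (auto simp: strict_mono_on_def)
  have "0 < (t m - t k) powr (- \<alpha>) / Gamma (1 - \<alpha>)"
    using 1 \<alpha> by (intro divide_pos_pos Gamma_real_pos) auto
  also have "\<dots> \<le> L1_weight \<alpha> t m k" using L1_weight_ge[OF \<alpha> 1] .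
  finally show ?thesis .
qed

lemma sum_by_parts_weights:
  fixes w V :: "nat \<Rightarrow> real"
  shows "(\<Sum>k<Suc j. w k * (V (k + 1) - V k)) =
     w j * V (Suc j) - (\<Sum>k<j. (w (k + 1) - w k) * V (k + 1)) - w 0 * V 0"
  by (induction j) (simp_all add: algebra_simps)

text \<open>
  The discrete maximum principle. After summation by parts the earlier values enter with nonpositive
  coefficients, because the weights increase towards \<open>t\<^sub>m\<close>.
\<close>

lemma L1_op_le_of_nonneg:
  assumes \<alpha>: "0 < \<alpha>" "\<alpha> < 1" and t: "strict_mono_on {..m} t" "0 < m"
    and V: "\<And>k. k < m \<Longrightarrow> 0 \<le> V k"
  shows "L1_op \<alpha> t V m \<le> L1_weight \<alpha> t m (m - 1) * V m"
proof -
  obtain j where m: "m = Suc j" using t by (cases m) auto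
  have "0 \<le> (\<Sum>k<j. (L1_weight \<alpha> t m (k + 1) - L1_weight \<alpha> t m k) * V (k + 1))"
    using L1_weight_mono[OF \<alpha> t(1)] V m by (intro sum_nonneg mult_nonneg_nonneg) auto
  moreover have "0 \<le> L1_weight \<alpha> t m 0 * V 0"
    using L1_weight_pos[OF \<alpha> t(1), of 0] V[of 0] m by simp
  ultimately show ?thesis
    unfolding L1_op_weight unfolding m sum_by_parts_weights by simp
qed

lemma L1_op_diff: "L1_op \<alpha> t (\<lambda>k. V k - U k) m = L1_op \<alpha> t V m - L1_op \<alpha> t U m"
  by (simp add: L1_op_weight sum_subtractf[symmetric] algebra_simps)

lemma L1_op_add: "L1_op \<alpha> t (\<lambda>k. V k + U k) m = L1_op \<alpha> t V m + L1_op \<alpha> t U m"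
  by (simp add: L1_op_weight sum.distrib[symmetric] algebra_simps)

lemma L1_op_cmult: "L1_op \<alpha> t (\<lambda>k. c * V k) m = c * L1_op \<alpha> t V m"
  by (simp add: L1_op_weight sum_distrib_left algebra_simps)

text \<open>
  The value \<open>0\<close> at the origin instead of \<open>1\<close> creates the jump that produces the term \<open>t\<^sub>m\<^bsup>-\<alpha>\<^esup>\<close>.
\<close>

definition barrier :: "real \<Rightarrow> (nat \<Rightarrow> real) \<Rightarrow> nat \<Rightarrow> real" where
  "barrier \<mu> t k = (if k = 0 then 0 else exp (\<mu> * t k))"

text \<open>
  The discrete derivative splits into the contribution of the jump, at least \<open>t\<^sub>m\<^bsup>-\<alpha>\<^esup>/\<Gamma>(1-\<alpha>)\<close>, and the
  nonnegative one of the exponential \<open>E\<close>. If \<open>t\<^sub>m \<le> 2/\<mu>\<close>, half of the former is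
  already at least \<open>\<Lambda> E\<^sub>m\<close>, as \<open>E\<^sub>m \<le> e\<^sup>2\<close>. Otherwise the last stretch of length between \<open>1/\<mu>\<close> and \<open>2/\<mu>\<close>
  suffices: there all weights are at least \<open>(\<mu>/2)\<^sup>\<alpha>/\<Gamma>(1-\<alpha>)\<close>, and \<open>E\<close> at least doubles.
\<close>

lemma L1_op_barrier:
  assumes \<alpha>: "0 < \<alpha>" "\<alpha> < 1" and t: "strict_mono_on {..m} t" "0 < m" "t 0 = 0"
    and \<mu>: "0 < \<mu>" and step: "\<And>k. k < m \<Longrightarrow> t (k + 1) - t k \<le> 1 / \<mu>"
    and \<Lambda>: "0 \<le> \<Lambda>" "2 * Gamma (1 - \<alpha>) * \<Lambda> * exp 2 \<le> (\<mu> / 2) powr \<alpha>"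
  shows "\<Lambda> * barrier \<mu> t m + t m powr (- \<alpha>) / (2 * Gamma (1 - \<alpha>)) \<le> L1_op \<alpha> t (barrier \<mu> t) m"
proof -
  define G where "G = Gamma (1 - \<alpha>)"
  have G: "0 < G" unfolding G_def using \<alpha> by (intro Gamma_real_pos) auto
  define E where "E = (\<lambda>k. exp (\<mu> * t k))"
  define w where "w = L1_weight \<alpha> t m"
  have le: "t i \<le> t j" if "i \<le> j" "j \<le> m" for i j
    using strict_mono_on_leD[OF t(1), of i j] that by auto
  have lt: "t i < t j" if "i < j" "j \<le> m" for i j
    using t(1) that by (auto simp: strict_mono_on_def)
  have E_mono: "E k \<le> E (k + 1)" if "k < m" for k
    using le[of k "k + 1"] that \<mu> by (simp add: E_def)
  have w_ge: "(t m - t k) powr (- \<alpha>) / G \<le> w k" if "k < m" for k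
    unfolding w_def G_def using that by (intro L1_weight_ge[OF \<alpha>] lt le) auto
  have w_pos: "0 \<le> w k" if "k < m" for k
    using L1_weight_pos[OF \<alpha> t(1), of k] that by (auto simp: w_def)
  have "L1_op \<alpha> t (barrier \<mu> t) m = (\<Sum>k<m. w k * (E (k + 1) - E k) + (if k = 0 then w k else 0))"
    unfolding L1_op_weight w_def by (intro sum.cong) (auto simp: barrier_def E_def t(3) algebra_simps)
  also have "\<dots> = (\<Sum>k<m. w k * (E (k + 1) - E k)) + w 0"
    using t(2) by (simp add: sum.distrib)
  finally have op: "L1_op \<alpha> t (barrier \<mu> t) m = (\<Sum>k<m. w k * (E (k + 1) - E k)) + w 0" .
  have w0: "t m powr (- \<alpha>) / G \<le> w 0" using w_ge[of 0] t by simp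
  have sum_pos: "0 \<le> (\<Sum>k<m. w k * (E (k + 1) - E k))"
    using E_mono w_pos by (intro sum_nonneg mult_nonneg_nonneg) auto
  have e2: "1 \<le> exp (2::real)" by simp
  have m: "barrier \<mu> t m = E m" using t by (simp add: barrier_def E_def)
  show ?thesis
  proof (cases "t m \<le> 2 / \<mu>")
    case True
    have "(\<mu> / 2) powr \<alpha> \<le> (1 / t m) powr \<alpha>"
      using True \<mu> lt[of 0 m] t \<alpha> by (intro powr_mono2) (auto simp: field_simps)
    also have "\<dots> = t m powr (- \<alpha>)" using lt[of 0 m] t by (simp add: powr_divide powr_minus_divide)
    finally have "2 * G * \<Lambda> * exp 2 \<le> t m powr (- \<alpha>)" using \<Lambda> by (simp add: G_def)
    moreover have "E m \<le> exp 2" using True \<mu> by (simp add: E_def field_simps)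
    then have "2 * G * \<Lambda> * E m \<le> 2 * G * \<Lambda> * exp 2" using G \<Lambda> by (intro mult_left_mono) auto
    ultimately have "2 * G * \<Lambda> * E m \<le> t m powr (- \<alpha>)" by linarith
    then have "\<Lambda> * E m \<le> t m powr (- \<alpha>) / (2 * G)" using G by (simp add: pos_le_divide_eq mult_ac)
    then show ?thesis using w0 sum_pos unfolding op m G_def[symmetric] by simp
  next
    case False
    \<comment> \<open>The step bound prevents the stretch from being shorter than \<open>1/\<mu>\<close>.\<close>
    define k where "k = (LEAST k. t m - t k \<le> 2 / \<mu>)"
    have k: "t m - t k \<le> 2 / \<mu>" "k \<le> m"
      unfolding k_def using LeastI[of "\<lambda>k. t m - t k \<le> 2 / \<mu>" m] Least_le[of "\<lambda>k. t m - t k \<le> 2 / \<mu>" m] \<mu> by auto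
    have "k \<noteq> 0" using k False t by (intro notI) simp
    then have "\<not> t m - t (k - 1) \<le> 2 / \<mu>" unfolding k_def by (intro not_less_Least) auto
    moreover have "t k - t (k - 1) \<le> 1 / \<mu>" using step[of "k - 1"] k \<open>k \<noteq> 0\<close> by simp
    moreover have "2 / \<mu> = 1 / \<mu> + 1 / \<mu>" by simp
    ultimately have k': "1 / \<mu> \<le> t m - t k" by linarith
    have "(\<mu> / 2) powr \<alpha> / G * (E m - E k) = (\<Sum>i = k..<m. (\<mu> / 2) powr \<alpha> / G * (E (i + 1) - E i))"
      using k sum_Suc_diff'[of k m E] unfolding sum_distrib_left[symmetric] by simp
    also have "\<dots> \<le> (\<Sum>i = k..<m. w i * (E (i + 1) - E i))"
    proof (intro sum_mono mult_right_mono)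
      fix i assume i: "i \<in> {k..<m}"
      have "(\<mu> / 2) powr \<alpha> \<le> (1 / (t m - t i)) powr \<alpha>"
      proof (rule powr_mono2)
        have d: "0 < t m - t i" "t m - t i \<le> 2 / \<mu>" using le[of k i] lt[of i m] i k(1) by auto
        then have "\<mu> * (t m - t i) \<le> 2" using \<mu> by (simp add: pos_le_divide_eq mult.commute)
        then show "\<mu> / 2 \<le> 1 / (t m - t i)" using d(1) by (simp add: pos_le_divide_eq)
      qed (use \<mu> \<alpha> in auto)
      also have "\<dots> = (t m - t i) powr (- \<alpha>)" using lt[of i m] i by (simp add: powr_divide powr_minus_divide)
      finally show "(\<mu> / 2) powr \<alpha> / G \<le> w i"
        using w_ge[of i] i G by (simp add: field_simps)
    qed (use E_mono in auto)
    also have "\<dots> \<le> (\<Sum>i<m. w i * (E (i + 1) - E i))"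
      using E_mono w_pos by (intro sum_mono2) auto
    finally have 1: "(\<mu> / 2) powr \<alpha> / G * (E m - E k) \<le> (\<Sum>i<m. w i * (E (i + 1) - E i))" .
    have "2 * E k \<le> E m"
    proof -
      have "2 \<le> exp (\<mu> * (t m - t k))"
        using k' \<mu> exp_ge_add_one_self[of "\<mu> * (t m - t k)"] by (simp add: field_simps)
      moreover have "E m = exp (\<mu> * (t m - t k)) * E k" by (simp add: E_def algebra_simps flip: exp_add)
      ultimately show ?thesis by (simp add: E_def)
    qed
    have "\<Lambda> * E m \<le> 2 * \<Lambda> * exp 2 * (E m / 2)"
      using mult_left_mono[OF e2, of "\<Lambda> * E m"] \<Lambda>(1) by (simp add: E_def mult_ac)
    also have "\<dots> \<le> (\<mu> / 2) powr \<alpha> / G * (E m - E k)"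
    proof (rule mult_mono)
      show "2 * \<Lambda> * exp 2 \<le> (\<mu> / 2) powr \<alpha> / G" using \<Lambda> G by (simp add: G_def field_simps)
    qed (use \<open>2 * E k \<le> E m\<close> G in \<open>auto simp: E_def\<close>)
    finally have "\<Lambda> * E m \<le> (\<Sum>i<m. w i * (E (i + 1) - E i))" using 1 by simp
    moreover have "t m powr (- \<alpha>) / (2 * G) \<le> t m powr (- \<alpha>) / G" using G by (simp add: field_simps)
    ultimately show ?thesis using w0 unfolding op m G_def[symmetric] by simp
  qed
qed

text \<open>
  Strong induction: if \<open>\<bar>e\<bar>\<close> lies below the scaled barrier \<open>W\<close> before \<open>m\<close>, the maximum principle applied
  to \<open>W - e\<close> and \<open>W + e\<close> carries this over to \<open>m\<close>, provided that the diagonal weight exceeds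
  \<open>\<bar>\<lambda>\<bar>\<close>. That in turn follows from the maximum principle for the barrier itself, so \<open>\<lambda>\<close> may have
  either sign.
\<close>

lemma L1_stability:
  assumes \<alpha>: "0 < \<alpha>" "\<alpha> < 1" and t: "strict_mono_on {..M} t" "t 0 = 0"
    and \<mu>: "0 < \<mu>" and step: "\<And>k. k < M \<Longrightarrow> t (k + 1) - t k \<le> 1 / \<mu>"
    and \<Lambda>: "2 * Gamma (1 - \<alpha>) * \<bar>lam\<bar> * exp 2 \<le> (\<mu> / 2) powr \<alpha>"
    and e0: "e 0 = 0" and "0 \<le> \<epsilon>"
    and res: "\<And>m. m \<in> {1..M} \<Longrightarrow> \<bar>L1_op \<alpha> t e m + lam * e m\<bar> \<le> \<epsilon> * t m powr (- \<alpha>)"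
  shows "m \<le> M \<Longrightarrow> \<bar>e m\<bar> \<le> 2 * Gamma (1 - \<alpha>) * \<epsilon> * barrier \<mu> t m"
proof (induction m rule: less_induct)
  case (less m)
  define G where "G = Gamma (1 - \<alpha>)"
  have G: "0 < G" unfolding G_def using \<alpha> by (intro Gamma_real_pos) auto
  show ?case
  proof (cases "m = 0")
    case False
    define W where "W = (\<lambda>k. 2 * G * \<epsilon> * barrier \<mu> t k)"
    define a where "a = L1_weight \<alpha> t m (m - 1)"
    have tm: "strict_mono_on {..m} t" using t(1) less.prems by (auto simp: strict_mono_on_def)
    have W0: "0 \<le> W k" for k using G \<open>0 \<le> \<epsilon>\<close> by (simp add: W_def barrier_def)
    have bar: "\<bar>lam\<bar> * barrier \<mu> t m + t m powr (- \<alpha>) / (2 * G) \<le> L1_op \<alpha> t (barrier \<mu> t) m"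
      unfolding G_def using False less.prems step \<Lambda> t(2) by (intro L1_op_barrier[OF \<alpha> tm _ _ \<mu>]) auto
    have "L1_op \<alpha> t (barrier \<mu> t) m \<le> a * barrier \<mu> t m"
      unfolding a_def using False by (intro L1_op_le_of_nonneg[OF \<alpha> tm]) (auto simp: barrier_def)
    moreover have "0 < t m powr (- \<alpha>) / (2 * G)"
      using G strict_mono_onD[OF tm, of 0 m] t(2) False by simp
    ultimately have "\<bar>lam\<bar> * barrier \<mu> t m < a * barrier \<mu> t m" using bar by linarith
    then have a: "\<bar>lam\<bar> < a" by (auto simp: barrier_def False mult_less_cancel_right)
    have "2 * G * \<epsilon> * (\<bar>lam\<bar> * barrier \<mu> t m + t m powr (- \<alpha>) / (2 * G)) \<le> 2 * G * \<epsilon> * L1_op \<alpha> t (barrier \<mu> t) m"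
      using bar G \<open>0 \<le> \<epsilon>\<close> by (intro mult_left_mono) auto
    then have opW: "\<bar>lam\<bar> * W m + \<epsilon> * t m powr (- \<alpha>) \<le> L1_op \<alpha> t W m"
      using G unfolding W_def L1_op_cmult distrib_left by (simp add: mult_ac)
    have r: "\<bar>L1_op \<alpha> t e m + lam * e m\<bar> \<le> \<epsilon> * t m powr (- \<alpha>)" using res[of m] False less.prems by simp
    have IH: "\<bar>e k\<bar> \<le> W k" if "k < m" for k
      using less.IH[of k] that less.prems by (simp add: W_def G_def)
    have "L1_op \<alpha> t (\<lambda>k. W k - e k) m \<le> a * (W m - e m)"
      unfolding a_def using False IH by (intro L1_op_le_of_nonneg[OF \<alpha> tm]) (auto simp: abs_le_iff)
    then have 1: "\<bar>lam\<bar> * W m + lam * e m \<le> a * (W m - e m)"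
      using opW r unfolding L1_op_diff by linarith
    have "L1_op \<alpha> t (\<lambda>k. W k + e k) m \<le> a * (W m + e m)"
      unfolding a_def using False IH by (intro L1_op_le_of_nonneg[OF \<alpha> tm]) (force simp: abs_le_iff)+
    then have 2: "\<bar>lam\<bar> * W m - lam * e m \<le> a * (W m + e m)"
      using opW r unfolding L1_op_add by linarith
    have "e m \<le> W m"
    proof (rule ccontr)
      assume *: "\<not> e m \<le> W m"
      then have "0 \<le> e m" using W0[of m] by linarith
      then have "- \<bar>lam\<bar> * e m \<le> lam * e m" by (intro mult_right_mono) auto
      with 1 have "0 \<le> (a - \<bar>lam\<bar>) * (W m - e m)" by (simp add: algebra_simps)
      with a * show False by (simp add: zero_le_mult_iff)
    qed
    moreover have "- e m \<le> W m"
    proof (rule ccontr)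
      assume *: "\<not> - e m \<le> W m"
      then have "0 \<le> - e m" using W0[of m] by linarith
      then have "- \<bar>lam\<bar> * (- e m) \<le> lam * (- e m)" by (intro mult_right_mono) auto
      with 2 have "0 \<le> (a - \<bar>lam\<bar>) * (W m + e m)" by (simp add: algebra_simps)
      with a * show False by (simp add: zero_le_mult_iff)
    qed
    ultimately show ?thesis by (simp add: W_def G_def abs_le_iff)
  qed (simp add: e0 barrier_def)
qed

section \<open>The graded mesh\<close>

lemma graded_mesh_0: "graded_mesh T r M 0 = 0"
  by (simp add: graded_mesh_def)

lemma graded_step_pos: "0 < T \<Longrightarrow> 1 \<le> M \<Longrightarrow> 0 < graded_step T r M"
  by (simp add: graded_step_def)

lemma graded_mesh_strict_mono:
  assumes "0 < T" "1 \<le> r" "1 \<le> M"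
  shows "strict_mono_on A (graded_mesh T r M)"
  using graded_step_pos[OF assms(1,3), of r] assms
  by (auto simp: strict_mono_on_def graded_mesh_def intro!: powr_less_mono2)

lemma graded_step_times_le:
  assumes "0 < T" "1 \<le> M" "k \<le> M"
  shows "real k * graded_step T r M \<le> T powr (1 / r)"
  using assms mult_right_mono[of "real k" "real M" "T powr (1 / r)"]
  by (simp add: graded_step_def field_simps)

lemma graded_mesh_le:
  assumes "0 < T" "1 \<le> r" "1 \<le> M" "k \<le> M"
  shows "graded_mesh T r M k \<le> T"
proof -
  have "graded_mesh T r M k \<le> (T powr (1 / r)) powr r"
    unfolding graded_mesh_def
    using graded_step_times_le[of T M k r] graded_step_pos[of T M r] assms by (intro powr_mono2) auto
  also have "\<dots> = T" using assms by (simp add: powr_powr)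
  finally show ?thesis .
qed

lemma graded_mesh_ratio:
  assumes "0 < T" "1 \<le> r" "1 \<le> M" "0 < m"
  shows "graded_mesh T r M k = (real k / real m) powr r * graded_mesh T r M m"
proof -
  have "graded_mesh T r M k = (real k / real m * (real m * graded_step T r M)) powr r"
    using assms by (simp add: graded_mesh_def)
  also have "\<dots> = (real k / real m) powr r * graded_mesh T r M m"
    unfolding graded_mesh_def by (rule powr_mult)
  finally show ?thesis .
qed

lemma graded_mesh_nonneg: "0 \<le> graded_mesh T r M k"
  by (simp add: graded_mesh_def)

lemma graded_mesh_convex:
  assumes "0 < T" "1 \<le> r" "1 \<le> M" "0 < m" "k \<le> m"
  shows "graded_mesh T r M k \<le> real k / real m * graded_mesh T r M m"
proof -
  have "(real k / real m) powr r \<le> (real k / real m) powr 1"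
    using assms by (intro powr_mono') auto
  then have "(real k / real m) powr r \<le> real k / real m" by simp
  then have "(real k / real m) powr r * graded_mesh T r M m \<le> real k / real m * graded_mesh T r M m"
    using graded_mesh_nonneg by (rule mult_right_mono)
  then show ?thesis unfolding graded_mesh_ratio[OF assms(1-4), of k, symmetric] .
qed

lemma graded_mesh_double:
  assumes "0 < T" "1 \<le> r" "1 \<le> M" "0 < k"
  shows "graded_mesh T r M (k + 1) \<le> 2 powr r * graded_mesh T r M k"
proof -
  have "(real (k + 1) / real k) powr r \<le> 2 powr r"
    using assms by (intro powr_mono2) (auto simp: field_simps)
  then show ?thesis
    using assms graded_mesh_nonneg[of T r M k]
    by (subst graded_mesh_ratio[OF assms]) (auto intro!: mult_right_mono)
qed

lemma one_minus_powr_le: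
  fixes x r :: real
  assumes "0 \<le> x" "x \<le> 1" "1 \<le> r"
  shows "1 - x powr r \<le> r * (1 - x)"
proof (cases "0 < x \<and> x < 1")
  case True
  have "((\<lambda>z. z powr r) has_real_derivative r * z powr (r - 1)) (at z)" if "x \<le> z" for z
    using that True by (auto intro!: derivative_eq_intros)
  then obtain z where z: "x < z" "z < 1" "1 powr r - x powr r = (1 - x) * (r * z powr (r - 1))"
    using MVT2[of x 1 "\<lambda>z. z powr r" "\<lambda>z. r * z powr (r - 1)"] True by auto
  have "z powr (r - 1) \<le> 1" using z True assms by (intro powr_le1) auto
  then have "(1 - x) * (r * z powr (r - 1)) \<le> (1 - x) * (r * 1)"
    using assms by (intro mult_left_mono) auto
  with z show ?thesis by (simp add: mult.commute)
qed (use assms in \<open>auto simp: not_less\<close>)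

text \<open>
  For \<open>t\<^sub>k = (k\<tau>)\<^sup>r\<close> this is Bernoulli's inequality \<open>(1 - 1/j)\<^sup>r \<ge> 1 - r/j\<close> with \<open>j = k + 1\<close>.
\<close>

lemma graded_mesh_width:
  assumes "0 < T" "1 \<le> r" "1 \<le> M"
  shows "graded_mesh T r M (k + 1) - graded_mesh T r M k \<le> r * graded_mesh T r M (k + 1) / real (k + 1)"
proof -
  have "1 - (real k / real (k + 1)) powr r \<le> r * (1 - real k / real (k + 1))"
    using assms by (intro one_minus_powr_le) auto
  also have "r * (1 - real k / real (k + 1)) = r / real (k + 1)" by (simp add: field_simps)
  finally have "(1 - (real k / real (k + 1)) powr r) * graded_mesh T r M (k + 1)
      \<le> r / real (k + 1) * graded_mesh T r M (k + 1)"
    using graded_mesh_nonneg by (rule mult_right_mono)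
  then show ?thesis
    using graded_mesh_ratio[OF assms, of "k + 1" k] by (simp add: left_diff_distrib)
qed

lemma graded_mesh_width_uniform:
  assumes "0 < T" "1 \<le> r" "1 \<le> M" "k < M"
  shows "graded_mesh T r M (k + 1) - graded_mesh T r M k \<le> r * T / real M"
proof -
  have "graded_mesh T r M (k + 1) \<le> real (k + 1) / real M * graded_mesh T r M M"
    using assms by (intro graded_mesh_convex) auto
  also have "\<dots> \<le> real (k + 1) / real M * T"
    using assms by (intro mult_left_mono graded_mesh_le) auto
  finally have "r * graded_mesh T r M (k + 1) / real (k + 1) \<le> r * (real (k + 1) / real M * T) / real (k + 1)"
    using assms by (intro divide_right_mono mult_left_mono) auto
  also have "\<dots> = r * T / real M" by simp
  finally show ?thesis using graded_mesh_width[OF assms(1-3), of k] by linarith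
qed

text \<open>
  Convexity of the mesh, \<open>t\<^sub>k \<le> (k/m) t\<^sub>m\<close>, compares the kernel with that on the uniform mesh.
\<close>

lemma graded_mesh_kernel:
  assumes "0 < T" "1 \<le> r" "1 \<le> M" "k < m" "0 < \<alpha>"
  shows "(graded_mesh T r M m - graded_mesh T r M k) powr (- \<alpha>) \<le>
     (real m / real (m - k)) powr \<alpha> * graded_mesh T r M m powr (- \<alpha>)"
proof -
  define t where "t = graded_mesh T r M m"
  have t: "0 < t" using graded_step_pos[of T M r] assms by (simp add: t_def graded_mesh_def)
  have "graded_mesh T r M k \<le> real k / real m * t"
    unfolding t_def using assms by (intro graded_mesh_convex) auto
  moreover have "t - real k / real m * t = real (m - k) / real m * t"
    using assms by (simp add: field_simps of_nat_diff)
  ultimately have "real (m - k) / real m * t \<le> t - graded_mesh T r M k" by linarith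
  then have "(t - graded_mesh T r M k) powr (- \<alpha>) \<le> (real (m - k) / real m * t) powr (- \<alpha>)"
    using assms t by (intro powr_mono2') auto
  also have "\<dots> = (real m / real (m - k)) powr \<alpha> * t powr (- \<alpha>)"
    by (simp only: powr_mult powr_divide powr_minus) (simp add: divide_inverse mult.commute)
  finally show ?thesis by (simp add: t_def)
qed

text \<open>
  Up to the index \<open>m/2\<close> the factor \<open>j\<^bsup>-\<alpha>\<^esup>\<close> is bounded by \<open>1\<close>, and the increments sum to at most
  \<open>K\<^bsub>m/2\<^esub> \<le> 2\<^sup>\<alpha> t\<^sub>m\<^bsup>-\<alpha>\<^esup>\<close>. Beyond it, \<open>j\<^bsup>-\<alpha>\<^esup> \<le> 2\<^sup>\<alpha> m\<^bsup>-\<alpha>\<^esup>\<close> compensates for the growth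
  \<open>K\<^bsub>m-1\<^esub> \<le> m\<^sup>\<alpha> t\<^sub>m\<^bsup>-\<alpha>\<^esup>\<close> of the kernel next to its singularity.
\<close>

lemma kernel_increment_sum:
  fixes T r \<alpha> :: real
  assumes T: "0 < T" "1 \<le> r" "1 \<le> M" and m: "2 \<le> m" and \<alpha>: "0 < \<alpha>"
  defines "t \<equiv> graded_mesh T r M"
  shows "(\<Sum>j=2..m-1. ((t m - t j) powr (- \<alpha>) - (t m - t (j - 1)) powr (- \<alpha>)) * real j powr (- \<alpha>))
     \<le> 2 * 2 powr \<alpha> * t m powr (- \<alpha>)"
proof -
  define K where "K = (\<lambda>j. (t m - t j) powr (- \<alpha>))"
  have lt: "t i < t j" if "i < j" for i j
    using graded_mesh_strict_mono[OF T, of UNIV] that by (auto simp: t_def strict_mono_on_def)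
  have K_mono: "K (j - 1) \<le> K j" if "1 \<le> j" "j < m" for j
    unfolding K_def using lt[of "j - 1" j] lt[of j m] that \<alpha> by (intro powr_mono2') auto
  have K0: "0 \<le> K j" for j by (simp add: K_def)
  have K_le: "K k \<le> (real m / real (m - k)) powr \<alpha> * t m powr (- \<alpha>)" if "k < m" for k
    unfolding K_def t_def using that \<alpha> by (intro graded_mesh_kernel[OF T])
  have tele: "(\<Sum>j=2..q. K j - K (j - 1)) \<le> K q" for q
  proof (cases "1 \<le> q")
    case True
    then have "(\<Sum>j=Suc 1..q. K j - K (j - 1)) = K q - K 1" by (rule sum_telescope'')
    then show ?thesis using K0[of 1] by (simp add: numeral_2_eq_2)
  qed (use K0 in auto)
  have "(\<Sum>j=2..m-1. (K j - K (j - 1)) * real j powr (- \<alpha>)) \<le>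
      (\<Sum>j=2..m-1. (if j \<le> m div 2 then K j - K (j - 1) else 0) + 2 powr \<alpha> * real m powr (- \<alpha>) * (K j - K (j - 1)))"
  proof (rule sum_mono)
    fix j assume j: "j \<in> {2..m-1}"
    have d: "0 \<le> K j - K (j - 1)" using K_mono[of j] j by auto
    have 0: "0 \<le> 2 powr \<alpha> * real m powr (- \<alpha>)" by simp
    have "real j powr (- \<alpha>) \<le> (if j \<le> m div 2 then 1 else 0) + 2 powr \<alpha> * real m powr (- \<alpha>)"
    proof (cases "j \<le> m div 2")
      case True
      have "real j powr (- \<alpha>) \<le> 1" using powr_mono2'[of "- \<alpha>" 1 "real j"] j \<alpha> by simp
      then show ?thesis using True 0 by (simp only: if_True)
    next
      case False
      then have "real m / 2 \<le> real j" by linarith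
      then have "real j powr (- \<alpha>) \<le> (real m / 2) powr (- \<alpha>)" using m \<alpha> by (intro powr_mono2') auto
      then show ?thesis using False by (simp add: powr_divide powr_minus field_simps)
    qed
    then have "(K j - K (j - 1)) * real j powr (- \<alpha>) \<le>
       (K j - K (j - 1)) * ((if j \<le> m div 2 then 1 else 0) + 2 powr \<alpha> * real m powr (- \<alpha>))"
      using d by (rule mult_left_mono)
    then show "(K j - K (j - 1)) * real j powr (- \<alpha>) \<le>
        (if j \<le> m div 2 then K j - K (j - 1) else 0) + 2 powr \<alpha> * real m powr (- \<alpha>) * (K j - K (j - 1))"
      by (cases "j \<le> m div 2") (simp_all add: distrib_left mult.commute)
  qed
  also have "\<dots> = (\<Sum>j=2..m-1. if j \<le> m div 2 then K j - K (j - 1) else 0) +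
      2 powr \<alpha> * real m powr (- \<alpha>) * (\<Sum>j=2..m-1. K j - K (j - 1))"
    by (simp add: sum.distrib sum_distrib_left)
  also have "(\<Sum>j=2..m-1. if j \<le> m div 2 then K j - K (j - 1) else 0) = (\<Sum>j=2..m div 2. K j - K (j - 1))"
    using m by (intro sum.mono_neutral_cong_right) auto
  also have "\<dots> \<le> 2 powr \<alpha> * t m powr (- \<alpha>)"
  proof -
    have "real (m div 2) \<le> real m / 2" by linarith
    then have "real m \<le> 2 * real (m - m div 2)" using m by (simp add: of_nat_diff)
    then have "real m / real (m - m div 2) \<le> 2" using m by (simp add: field_simps)
    then have "(real m / real (m - m div 2)) powr \<alpha> \<le> 2 powr \<alpha>" using \<alpha> by (intro powr_mono2) auto
    then have "(real m / real (m - m div 2)) powr \<alpha> * t m powr (- \<alpha>) \<le> 2 powr \<alpha> * t m powr (- \<alpha>)"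
      by (rule mult_right_mono) simp
    then show ?thesis using tele[of "m div 2"] K_le[of "m div 2"] m by simp
  qed
  also have "2 powr \<alpha> * real m powr (- \<alpha>) * (\<Sum>j=2..m-1. K j - K (j - 1)) \<le> 2 powr \<alpha> * t m powr (- \<alpha>)"
  proof -
    have "(\<Sum>j=2..m-1. K j - K (j - 1)) \<le> real m powr \<alpha> * t m powr (- \<alpha>)"
      using tele[of "m - 1"] K_le[of "m - 1"] m by simp
    then have "2 powr \<alpha> * real m powr (- \<alpha>) * (\<Sum>j=2..m-1. K j - K (j - 1)) \<le>
        2 powr \<alpha> * real m powr (- \<alpha>) * (real m powr \<alpha> * t m powr (- \<alpha>))"
      by (rule mult_left_mono) simp
    also have "\<dots> = 2 powr \<alpha> * (real m powr (- \<alpha>) * real m powr \<alpha>) * t m powr (- \<alpha>)" by (simp only: mult_ac)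
    also have "real m powr (- \<alpha>) * real m powr \<alpha> = 1" using m by (simp flip: powr_add)
    finally show ?thesis by simp
  qed
  finally show ?thesis unfolding K_def by (simp add: mult_ac)
qed

section \<open>Truncation error of the L1 operator\<close>

text \<open>
  Since \<open>d - w\<close> has mean zero on the cell, the kernel may be replaced by its deviation from its value at
  the left end, which is at most its increment over the cell.
\<close>

lemma cell_error_interior:
  fixes w :: "real \<Rightarrow> real"
  assumes ab: "a < b" "b < c" and \<alpha>: "0 < \<alpha>"
    and w: "w absolutely_integrable_on {a..b}" and d: "d = integral {a..b} w / (b - a)"
    and \<omega>: "\<And>s. s \<in> {a..b} \<Longrightarrow> \<bar>d - w s\<bar> \<le> \<omega>"
  shows "\<bar>integral {a..b} (\<lambda>s. (c - s) powr (- \<alpha>) * (d - w s))\<bar> \<le>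
     ((c - b) powr (- \<alpha>) - (c - a) powr (- \<alpha>)) * ((b - a) * \<omega>)"
proof -
  define K where "K = (\<lambda>s. (c - s) powr (- \<alpha>))"
  have wi: "w integrable_on {a..b}" using w by (simp add: absolutely_integrable_on_def)
  have dw: "(\<lambda>s. d - w s) absolutely_integrable_on {a..b}"
    by (intro set_integral_diff w) simp
  have dwi: "(\<lambda>s. d - w s) integrable_on {a..b}" using dw by (simp add: absolutely_integrable_on_def)
  have zero: "integral {a..b} (\<lambda>s. d - w s) = 0"
    using wi ab by (subst Henstock_Kurzweil_Integration.integral_diff) (auto simp: d)
  have cont: "continuous_on {a..b} K"
    unfolding K_def using ab by (intro continuous_intros) auto
  have Ki: "(\<lambda>s. K s * (d - w s)) integrable_on {a..b}"
  proof -
    have "(\<lambda>s. K s * (d - w s)) absolutely_integrable_on {a..b}"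
      using cont by (intro absolutely_integrable_bounded_measurable_product_real dw
          continuous_imp_measurable_on_sets_lebesgue compact_imp_bounded compact_continuous_image) auto
    then show ?thesis by (simp add: absolutely_integrable_on_def)
  qed
  have Kai: "(\<lambda>s. K a * (d - w s)) integrable_on {a..b}"
    using has_integral_mult_right[OF integrable_integral[OF dwi]] by (rule has_integral_integrable)
  have mono: "K a \<le> K s" "K s \<le> K b" if "s \<in> {a..b}" for s
    unfolding K_def using that ab \<alpha> by (auto intro!: powr_mono2')
  have "integral {a..b} (\<lambda>s. K s * (d - w s)) =
      integral {a..b} (\<lambda>s. K s * (d - w s)) - K a * integral {a..b} (\<lambda>s. d - w s)"
    by (simp add: zero)
  also have "\<dots> = integral {a..b} (\<lambda>s. K s * (d - w s) - K a * (d - w s))"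
    unfolding Henstock_Kurzweil_Integration.integral_diff[OF Ki Kai] by (simp only: integral_mult_right)
  also have "norm \<dots> \<le> integral {a..b} (\<lambda>_. (K b - K a) * \<omega>)"
  proof (rule integral_norm_bound_integral)
    show "(\<lambda>s. K s * (d - w s) - K a * (d - w s)) integrable_on {a..b}"
      using Ki Kai by (intro integrable_diff)
    fix s assume s: "s \<in> {a..b}"
    have "norm (K s * (d - w s) - K a * (d - w s)) = (K s - K a) * \<bar>d - w s\<bar>"
      using mono[OF s] by (simp add: abs_mult flip: left_diff_distrib)
    also have "\<dots> \<le> (K b - K a) * \<omega>"
      using mono[OF s] \<omega>[OF s] by (intro mult_mono) auto
    finally show "norm (K s * (d - w s) - K a * (d - w s)) \<le> (K b - K a) * \<omega>" .
  qed auto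
  also have "\<dots> = (K b - K a) * ((b - a) * \<omega>)" using ab by simp
  finally show ?thesis by (simp add: K_def)
qed

lemma cell_error_last:
  fixes w :: "real \<Rightarrow> real"
  assumes ac: "a < c" and \<alpha>: "0 < \<alpha>" "\<alpha> < 1"
    and int: "(\<lambda>s. (c - s) powr (- \<alpha>) * (d - w s)) integrable_on {a..c}"
    and \<omega>: "\<And>s. s \<in> {a..c} \<Longrightarrow> \<bar>d - w s\<bar> \<le> \<omega>"
  shows "\<bar>integral {a..c} (\<lambda>s. (c - s) powr (- \<alpha>) * (d - w s))\<bar> \<le>
     (c - a) powr (- \<alpha>) * ((c - a) * \<omega>) / (1 - \<alpha>)"
proof -
  have k: "((\<lambda>s. (c - s) powr (- \<alpha>) * \<omega>) has_integral (c - a) powr (1 - \<alpha>) / (1 - \<alpha>) * \<omega>) {a..c}"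
    using kernel_has_integral[of "1 - \<alpha>" a c c] ac \<alpha> by (intro has_integral_mult_left) simp
  have "norm (integral {a..c} (\<lambda>s. (c - s) powr (- \<alpha>) * (d - w s))) \<le>
      integral {a..c} (\<lambda>s. (c - s) powr (- \<alpha>) * \<omega>)"
    using k \<omega> by (intro integral_norm_bound_integral int) (auto simp: abs_mult intro!: mult_left_mono)
  also have "\<dots> = (c - a) powr (1 - \<alpha>) / (1 - \<alpha>) * \<omega>" using k by (rule integral_unique)
  also have "(c - a) powr (1 - \<alpha>) = (c - a) * (c - a) powr (- \<alpha>)"
    using ac powr_mult_base[of "c - a" "- \<alpha>"] by simp
  finally show ?thesis by (simp add: mult_ac)
qed

text \<open>
  Next to the origin \<open>w\<close> is singular and has no Lipschitz bound; its integrability there is enough, because the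
  integral over \<open>[0,t\<^sub>1]\<close> of \<open>s\<^bsup>\<delta>-1\<^esup>\<close> is already of order \<open>t\<^sub>1\<^sup>\<delta> = \<tau>\<^bsup>r\<delta>\<^esup>\<close>.
\<close>

lemma cell_error_first:
  fixes w :: "real \<Rightarrow> real"
  assumes b: "0 < b" "b < c" and \<alpha>: "0 < \<alpha>" and \<delta>: "0 < \<delta>" and C: "0 \<le> C"
    and w: "w absolutely_integrable_on {0..b}" and d: "d = integral {0..b} w / b"
    and bnd: "\<And>s. s \<in> {0<..b} \<Longrightarrow> \<bar>w s\<bar> \<le> C * s powr (\<delta> - 1)"
  shows "\<bar>integral {0..b} (\<lambda>s. (c - s) powr (- \<alpha>) * (d - w s))\<bar> \<le>
     (c - b) powr (- \<alpha>) * (2 * C / \<delta> * b powr \<delta>)"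
    and cell_average_first: "\<bar>d\<bar> \<le> C / \<delta> * b powr (\<delta> - 1)"
proof -
  have pw: "((\<lambda>s. C * s powr (\<delta> - 1)) has_integral C * (b powr \<delta> / \<delta>)) {0..b}"
  proof -
    have "((\<lambda>s. (b - s) powr (1 - 1) * (s - 0) powr (\<delta> - 1)) has_integral Beta 1 \<delta> * (b - 0) powr (1 + \<delta> - 1)) {0..b}"
      using b \<delta> by (intro beta_has_integral) auto
    then have "((\<lambda>s. s powr (\<delta> - 1)) has_integral Beta 1 \<delta> * (b - 0) powr (1 + \<delta> - 1)) {0..b}"
      by (rule has_integral_spike[rotated 2, where S = "{b}"]) auto
    moreover have "Gamma (1 + \<delta>) = \<delta> * Gamma \<delta>"
    proof -
      have "\<delta> \<notin> \<int>\<^sub>\<le>\<^sub>0" using \<delta> by (auto elim!: nonpos_Ints_cases)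
      then show ?thesis using Gamma_plus1[of \<delta>] by (simp add: add.commute)
    qed
    then have "Beta 1 \<delta> = 1 / \<delta>" using Gamma_real_pos[OF \<delta>] by (simp add: Beta_def)
    ultimately show ?thesis by (intro has_integral_mult_right) simp
  qed
  have wi: "w integrable_on {0..b}" using w by (simp add: absolutely_integrable_on_def)
  have w0: "(\<lambda>s. if s = 0 then 0 else w s) integrable_on {0..b}"
    by (rule integrable_spike[OF wi, where S = "{0}"]) auto
  have "norm (integral {0..b} (\<lambda>s. if s = 0 then 0 else w s)) \<le> integral {0..b} (\<lambda>s. C * s powr (\<delta> - 1))"
    using pw bnd by (intro integral_norm_bound_integral w0) auto
  also have "integral {0..b} (\<lambda>s. if s = 0 then 0 else w s) = integral {0..b} w"
    by (rule integral_spike[where S = "{0}"]) auto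
  finally have I: "\<bar>integral {0..b} w\<bar> \<le> C * (b powr \<delta> / \<delta>)"
    using integral_unique[OF pw] by simp
  have d': "\<bar>d\<bar> * b \<le> C * (b powr \<delta> / \<delta>)" using I b by (simp add: d abs_divide)
  have "C / \<delta> * b powr (\<delta> - 1) = C * (b powr \<delta> / \<delta>) / b" using b by (simp add: powr_diff)
  then show "\<bar>d\<bar> \<le> C / \<delta> * b powr (\<delta> - 1)" using d' b by (simp only: pos_le_divide_eq)
  have dw: "(\<lambda>s. d - w s) absolutely_integrable_on {0..b}"
    by (intro set_integral_diff w) simp
  have cont: "continuous_on {0..b} (\<lambda>s. (c - s) powr (- \<alpha>))"
    using b by (intro continuous_intros) auto
  have "(\<lambda>s. (c - s) powr (- \<alpha>) * (d - w s)) absolutely_integrable_on {0..b}"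
    using cont by (intro absolutely_integrable_bounded_measurable_product_real dw
          continuous_imp_measurable_on_sets_lebesgue compact_imp_bounded compact_continuous_image) auto
  then have int: "(\<lambda>s. (c - s) powr (- \<alpha>) * (d - w s)) integrable_on {0..b}"
    by (simp add: absolutely_integrable_on_def)
  let ?g = "\<lambda>s. if s = 0 then 0 else (c - s) powr (- \<alpha>) * (d - w s)"
  have gi: "?g integrable_on {0..b}" by (rule integrable_spike[OF int, where S = "{0}"]) auto
  have k: "((\<lambda>s. (c - b) powr (- \<alpha>) * (\<bar>d\<bar> + C * s powr (\<delta> - 1))) has_integral
     (c - b) powr (- \<alpha>) * (\<bar>d\<bar> * b + C * (b powr \<delta> / \<delta>))) {0..b}"
    using has_integral_const_real[of "\<bar>d\<bar>" 0 b] b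
    by (intro has_integral_mult_right has_integral_add pw) (simp add: mult.commute)
  have "norm (integral {0..b} ?g) \<le> integral {0..b} (\<lambda>s. (c - b) powr (- \<alpha>) * (\<bar>d\<bar> + C * s powr (\<delta> - 1)))"
  proof (rule integral_norm_bound_integral[OF gi])
    fix s assume s: "s \<in> {0..b}"
    have "(c - s) powr (- \<alpha>) * \<bar>d - w s\<bar> \<le> (c - b) powr (- \<alpha>) * (\<bar>d\<bar> + C * s powr (\<delta> - 1))" if "s \<noteq> 0"
      using s that b \<alpha> bnd[of s] abs_triangle_ineq4[of d "w s"] by (intro mult_mono powr_mono2') auto
    then show "norm (?g s) \<le> (c - b) powr (- \<alpha>) * (\<bar>d\<bar> + C * s powr (\<delta> - 1))"
      using C by (auto simp: abs_mult)
  qed (use k in auto)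
  also have "integral {0..b} ?g = integral {0..b} (\<lambda>s. (c - s) powr (- \<alpha>) * (d - w s))"
    by (rule integral_spike[where S = "{0}"]) auto
  also have "integral {0..b} (\<lambda>s. (c - b) powr (- \<alpha>) * (\<bar>d\<bar> + C * s powr (\<delta> - 1))) =
     (c - b) powr (- \<alpha>) * (\<bar>d\<bar> * b + C * (b powr \<delta> / \<delta>))" using k by (rule integral_unique)
  also have "\<dots> \<le> (c - b) powr (- \<alpha>) * (2 * C / \<delta> * b powr \<delta>)"
    using d' by (intro mult_left_mono) auto
  finally show "\<bar>integral {0..b} (\<lambda>s. (c - s) powr (- \<alpha>) * (d - w s))\<bar> \<le>
     (c - b) powr (- \<alpha>) * (2 * C / \<delta> * b powr \<delta>)" by simp
qed

text \<open>
  The mean differs from any value by at most the oscillation, and within the cell every point is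
  comparable to the right end \<open>b\<close>.
\<close>

lemma cell_oscillation:
  fixes w :: "real \<Rightarrow> real"
  assumes a: "0 < a" "a < b" "b \<le> T" "b \<le> \<kappa> * a" and C: "0 \<le> C"
    and lip: "\<And>x y. 0 < y \<Longrightarrow> y \<le> x \<Longrightarrow> x \<le> T \<Longrightarrow> x \<le> \<kappa> * y \<Longrightarrow>
      \<bar>w x - w y\<bar> \<le> C * (x - y) * y powr (\<delta> - 2)"
    and w: "w integrable_on {a..b}" and d: "d = integral {a..b} w / (b - a)" and s: "s \<in> {a..b}"
  shows "\<bar>d - w s\<bar> \<le> C * \<kappa> powr \<bar>\<delta> - 2\<bar> * (b - a) * b powr (\<delta> - 2)"
proof -
  define \<omega> where "\<omega> = C * \<kappa> powr \<bar>\<delta> - 2\<bar> * (b - a) * b powr (\<delta> - 2)"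
  have \<kappa>: "1 \<le> \<kappa>" using a by (metis less_eq_real_def less_le_trans mult_le_cancel_right1 not_less)
  have ord: "\<bar>w x - w y\<bar> \<le> \<omega>" if xy: "a \<le> y" "y \<le> x" "x \<le> b" for x y
  proof -
    have *: "b \<le> \<kappa> * y" using a xy \<kappa> by (meson dual_order.trans mult_left_mono order.trans zero_le_one)
    have "y \<le> \<kappa> * b" using a xy \<kappa> mult_mono[of 1 \<kappa> y b] by auto
    then have "y powr (\<delta> - 2) \<le> \<kappa> powr \<bar>\<delta> - 2\<bar> * b powr (\<delta> - 2)"
      using a xy * by (intro powr_comparable) auto
    then have "C * (x - y) * y powr (\<delta> - 2) \<le> C * (b - a) * (\<kappa> powr \<bar>\<delta> - 2\<bar> * b powr (\<delta> - 2))"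
      using C xy a by (intro mult_mono) auto
    moreover have "\<bar>w x - w y\<bar> \<le> C * (x - y) * y powr (\<delta> - 2)" using a xy * by (intro lip) auto
    ultimately show ?thesis by (simp add: \<omega>_def mult_ac)
  qed
  have osc: "\<bar>w x - w s\<bar> \<le> \<omega>" if "x \<in> {a..b}" for x
    using ord[of s x] ord[of x s] that s by (cases "s \<le> x") (auto simp: abs_minus_commute)
  have "(b - a) * d = integral {a..b} w" using a by (simp add: d)
  then have "(b - a) * (d - w s) = integral {a..b} (\<lambda>x. w x - w s)"
    using w a by (subst Henstock_Kurzweil_Integration.integral_diff) (auto simp: right_diff_distrib)
  also have "norm \<dots> \<le> integral {a..b} (\<lambda>_. \<omega>)"
    using osc w by (intro integral_norm_bound_integral integrable_diff) auto
  also have "\<dots> = (b - a) * \<omega>" using a by simp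
  finally have "(b - a) * \<bar>d - w s\<bar> \<le> (b - a) * \<omega>" using a by (simp add: abs_mult)
  then show ?thesis using a by (simp add: \<omega>_def)
qed

lemma integral_mesh_sum:
  fixes g :: "real \<Rightarrow> real" and t :: "nat \<Rightarrow> real"
  assumes "g integrable_on {t 0..t m}" and mono: "\<And>i j. i \<le> j \<Longrightarrow> j \<le> m \<Longrightarrow> t i \<le> t j"
  shows "integral {t 0..t m} g = (\<Sum>k<m. integral {t k..t (k + 1)} g)"
proof -
  have "j \<le> m \<Longrightarrow> integral {t 0..t j} g = (\<Sum>k<j. integral {t k..t (k + 1)} g)" for j
  proof (induction j)
    case (Suc j)
    have "g integrable_on {t 0..t (Suc j)}"
      using assms(1) by (rule integrable_subinterval_real) (use mono Suc.prems in auto)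
    then have "integral {t 0..t j} g + integral {t j..t (Suc j)} g = integral {t 0..t (Suc j)} g"
      using mono Suc.prems by (intro Henstock_Kurzweil_Integration.integral_combine) auto
    then show ?case using Suc by simp
  qed simp
  then show ?thesis by simp
qed

lemma L1_truncation_cells:
  fixes w :: "real \<Rightarrow> real" and t :: "nat \<Rightarrow> real"
  assumes \<alpha>: "0 < \<alpha>" "\<alpha> < 1" and t: "strict_mono_on {..m} t" "t 0 = 0"
    and w: "w integrable_on {0..t m}"
    and Kw: "(\<lambda>s. (t m - s) powr (- \<alpha>) * w s) integrable_on {0..t m}"
    and d: "\<And>k. k < m \<Longrightarrow> d k = integral {t k..t (k + 1)} w / (t (k + 1) - t k)"
  shows "L1_op \<alpha> t (\<lambda>k. frac_int 1 w (t k)) m - frac_int (1 - \<alpha>) w (t m) =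
     (\<Sum>k<m. integral {t k..t (k + 1)} (\<lambda>s. (t m - s) powr (- \<alpha>) * (d k - w s))) / Gamma (1 - \<alpha>)"
    and "\<And>k. k < m \<Longrightarrow> (\<lambda>s. (t m - s) powr (- \<alpha>) * (d k - w s)) integrable_on {t k..t (k + 1)}"
proof -
  define G where "G = Gamma (1 - \<alpha>)"
  have G: "0 < G" unfolding G_def using \<alpha> by (intro Gamma_real_pos) auto
  define K where "K = (\<lambda>s. (t m - s) powr (- \<alpha>))"
  have lt: "t i < t j" if "i < j" "j \<le> m" for i j
    using t(1) that by (auto simp: strict_mono_on_def)
  have le: "t i \<le> t j" if "i \<le> j" "j \<le> m" for i j
    using strict_mono_on_leD[OF t(1), of i j] that by auto
  have sub: "{t k..t (k + 1)} \<subseteq> {0..t m}" if "k < m" for k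
    using le[of 0 k] le[of "k + 1" m] that t(2) by auto
  have k: "(K has_integral (1 - \<alpha>) * G / (1 - \<alpha>) * (L1_weight \<alpha> t m k * (t (k + 1) - t k))) {t k..t (k + 1)}" if "k < m" for k
  proof -
    have "L1_weight \<alpha> t m k * (t (k + 1) - t k) = ((t m - t k) powr (1 - \<alpha>) - (t m - t (k + 1)) powr (1 - \<alpha>)) / ((1 - \<alpha>) * G)"
      using lt[of k "k + 1"] that unfolding L1_weight_def Gamma_2_minus[OF \<alpha>(2)] G_def by simp
    then have e: "(1 - \<alpha>) * G / (1 - \<alpha>) * (L1_weight \<alpha> t m k * (t (k + 1) - t k)) =
      ((t m - t k) powr (1 - \<alpha>) - (t m - t (k + 1)) powr (1 - \<alpha>)) / (1 - \<alpha>)"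
      using \<alpha> G by simp
    show ?thesis unfolding e K_def
      using kernel_has_integral[of "1 - \<alpha>" "t k" "t (k + 1)" "t m"] \<alpha> le[of k "k + 1"] le[of "k + 1" m] that by simp
  qed
  have Kwk: "(\<lambda>s. K s * w s) integrable_on {t k..t (k + 1)}" if "k < m" for k
    unfolding K_def using Kw by (rule integrable_subinterval_real) (rule sub[OF that])
  have dK: "((\<lambda>s. K s * d k) has_integral G * (L1_weight \<alpha> t m k * (t (k + 1) - t k)) * d k) {t k..t (k + 1)}" if "k < m" for k
    using has_integral_mult_left[OF k[OF that], of "d k"] \<alpha> by simp
  have cell: "((\<lambda>s. K s * (d k - w s)) has_integral
     (G * (L1_weight \<alpha> t m k * (t (k + 1) - t k)) * d k - integral {t k..t (k + 1)} (\<lambda>s. K s * w s))) {t k..t (k + 1)}" if "k < m" for k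
    using has_integral_diff[OF dK[OF that] integrable_integral[OF Kwk[OF that]]] by (simp add: algebra_simps)
  show "\<And>k. k < m \<Longrightarrow> (\<lambda>s. (t m - s) powr (- \<alpha>) * (d k - w s)) integrable_on {t k..t (k + 1)}"
    using cell unfolding K_def by (rule has_integral_integrable)
  have v: "frac_int 1 w (t (k + 1)) - frac_int 1 w (t k) = (t (k + 1) - t k) * d k" if "k < m" for k
  proof -
    have "w integrable_on {0..t (k + 1)}"
      using w by (rule integrable_subinterval_real) (use le[of "k + 1" m] that in auto)
    then have "integral {0..t k} w + integral {t k..t (k + 1)} w = integral {0..t (k + 1)} w"
      using le[of 0 k] le[of k "k + 1"] that t(2) by (intro Henstock_Kurzweil_Integration.integral_combine) auto
    then show ?thesis using lt[of k "k + 1"] that by (simp add: frac_int_1 d)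
  qed
  have "(\<Sum>k<m. integral {t k..t (k + 1)} (\<lambda>s. K s * (d k - w s))) =
     (\<Sum>k<m. G * (L1_weight \<alpha> t m k * (frac_int 1 w (t (k + 1)) - frac_int 1 w (t k))) - integral {t k..t (k + 1)} (\<lambda>s. K s * w s))"
    using cell v by (intro sum.cong) (auto simp: integral_unique mult_ac)
  also have "\<dots> = G * L1_op \<alpha> t (\<lambda>k. frac_int 1 w (t k)) m - integral {t 0..t m} (\<lambda>s. K s * w s)"
    using integral_mesh_sum[of "\<lambda>s. K s * w s" t m] Kw le t(2)
    by (simp add: sum_subtractf L1_op_weight K_def flip: sum_distrib_left)
  also have "integral {t 0..t m} (\<lambda>s. K s * w s) = G * frac_int (1 - \<alpha>) w (t m)"
    using G by (simp add: frac_int_def K_def G_def t(2))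
  finally show "L1_op \<alpha> t (\<lambda>k. frac_int 1 w (t k)) m - frac_int (1 - \<alpha>) w (t m) =
     (\<Sum>k<m. integral {t k..t (k + 1)} (\<lambda>s. (t m - s) powr (- \<alpha>) * (d k - w s))) / Gamma (1 - \<alpha>)"
    using G by (simp add: K_def flip: G_def) (simp add: field_simps)
qed

text \<open>
  For \<open>m = 1\<close> the only cell touches both the singularity of \<open>w\<close> at \<open>0\<close> and that of the kernel at
  \<open>b = t\<^sub>1\<close>. The integral of the product of the two is a beta integral, so the mean and \<open>w\<close> can be estimated separately.
\<close>

lemma cell_error_single:
  fixes w :: "real \<Rightarrow> real"
  assumes b: "0 < b" and \<alpha>: "0 < \<alpha>" "\<alpha> < 1" and \<delta>: "0 < \<delta>" and C: "0 \<le> C"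
    and w: "w absolutely_integrable_on {0..b}" and d: "d = integral {0..b} w / b"
    and meas: "w \<in> borel_measurable (lebesgue_on {0<..<b})"
    and bnd: "\<And>s. s \<in> {0<..b} \<Longrightarrow> \<bar>w s\<bar> \<le> C * s powr (\<delta> - 1)"
  shows "\<bar>integral {0..b} (\<lambda>s. (b - s) powr (- \<alpha>) * (d - w s))\<bar> \<le>
     (C / \<delta> / (1 - \<alpha>) + C * Beta (1 - \<alpha>) \<delta>) * (b powr \<delta> * b powr (- \<alpha>))"
proof -
  have \<alpha>1: "(1 - \<alpha>) - 1 = - \<alpha>" by simp
  have G: "0 < Gamma (1 - \<alpha>)" using \<alpha> by (intro Gamma_real_pos) auto
  have Kw: "(\<lambda>s. (b - s) powr (- \<alpha>) * w s) integrable_on {0..b}"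
    using frac_integrand_absolutely_integrable[of "1 - \<alpha>" \<delta> b w C] \<alpha> \<delta> b meas bnd
    by (auto simp: absolutely_integrable_on_def)
  have "\<bar>frac_int (1 - \<alpha>) w b\<bar> \<le> C * Beta (1 - \<alpha>) \<delta> / Gamma (1 - \<alpha>) * b powr (1 - \<alpha> + \<delta> - 1)"
    using \<alpha> \<delta> b meas bnd by (intro frac_int_bound) auto
  then have "Gamma (1 - \<alpha>) * \<bar>frac_int (1 - \<alpha>) w b\<bar> \<le> C * Beta (1 - \<alpha>) \<delta> * b powr (1 - \<alpha> + \<delta> - 1)"
    using G by (simp add: field_simps)
  moreover have "Gamma (1 - \<alpha>) * \<bar>frac_int (1 - \<alpha>) w b\<bar> = \<bar>integral {0..b} (\<lambda>s. (b - s) powr (- \<alpha>) * w s)\<bar>"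
    using G unfolding frac_int_def \<alpha>1 by (simp add: abs_mult)
  moreover have "b powr (1 - \<alpha> + \<delta> - 1) = b powr \<delta> * b powr (- \<alpha>)" by (simp flip: powr_add)
  ultimately have 1: "\<bar>integral {0..b} (\<lambda>s. (b - s) powr (- \<alpha>) * w s)\<bar> \<le> C * Beta (1 - \<alpha>) \<delta> * (b powr \<delta> * b powr (- \<alpha>))"
    by simp
  have k: "((\<lambda>s. (b - s) powr (- \<alpha>) * d) has_integral b powr (1 - \<alpha>) / (1 - \<alpha>) * d) {0..b}"
    using kernel_has_integral[of "1 - \<alpha>" 0 b b] b \<alpha> by (intro has_integral_mult_left) simp
  have "\<bar>d\<bar> \<le> C / \<delta> * b powr (\<delta> - 1)"
    using b \<alpha> \<delta> C by (intro cell_average_first[OF b _ \<alpha>(1) \<delta> C w d bnd, of "b + 1"]) auto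
  then have "b powr (1 - \<alpha>) / (1 - \<alpha>) * \<bar>d\<bar> \<le> b powr (1 - \<alpha>) / (1 - \<alpha>) * (C / \<delta> * b powr (\<delta> - 1))"
    using \<alpha> by (intro mult_left_mono) auto
  also have "\<dots> = C / \<delta> / (1 - \<alpha>) * (b powr (\<delta> - 1) * b powr (1 - \<alpha>))" by (simp add: mult_ac)
  also have "b powr (\<delta> - 1) * b powr (1 - \<alpha>) = b powr \<delta> * b powr (- \<alpha>)" by (simp flip: powr_add)
  finally have 2: "\<bar>b powr (1 - \<alpha>) / (1 - \<alpha>) * d\<bar> \<le> C / \<delta> / (1 - \<alpha>) * (b powr \<delta> * b powr (- \<alpha>))"
    using \<alpha> by (simp add: abs_mult)
  have "((\<lambda>s. (b - s) powr (- \<alpha>) * d - (b - s) powr (- \<alpha>) * w s) has_integral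
     b powr (1 - \<alpha>) / (1 - \<alpha>) * d - integral {0..b} (\<lambda>s. (b - s) powr (- \<alpha>) * w s)) {0..b}"
    by (intro has_integral_diff k integrable_integral Kw)
  then have "integral {0..b} (\<lambda>s. (b - s) powr (- \<alpha>) * (d - w s)) =
     b powr (1 - \<alpha>) / (1 - \<alpha>) * d - integral {0..b} (\<lambda>s. (b - s) powr (- \<alpha>) * w s)"
    by (simp add: integral_unique right_diff_distrib)
  then show ?thesis using 1 2 unfolding distrib_right by linarith
qed

text \<open>
  With \<open>K\<^sub>j = (t\<^sub>m - t\<^sub>j)\<^bsup>-\<alpha>\<^esup>\<close>, the cell ending in \<open>t\<^sub>j\<close>, for \<open>2 \<le> j < m\<close>, contributes at most a multiple of
  \<open>(K\<^sub>j - K\<^bsub>j-1\<^esub>) \<tau>\<^sub>j\<^sup>2 t\<^sub>j\<^bsup>\<delta>-2\<^esup>\<close>. Because of \<open>\<tau>\<^sub>j \<le> r t\<^sub>j/j\<close>, the factor \<open>\<tau>\<^sub>j\<^sup>2 t\<^sub>j\<^bsup>\<delta>-2\<^esup>\<close> is at most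
  \<open>r\<^sup>2 t\<^sub>j\<^sup>\<delta> j\<^bsup>-2\<^esup> = r\<^sup>2 (j\<tau>)\<^bsup>r\<delta>\<^esup> j\<^bsup>-2\<^esup>\<close>, and the two restrictions on \<open>p\<close> are what reduces this to
  \<open>C \<tau>\<^sup>p j\<^bsup>-\<alpha>\<^esup>\<close>: \<open>p \<le> r\<delta>\<close> lets the excess power of \<open>j\<tau> \<le> T\<^bsup>1/r\<^esup>\<close> be bounded by a
  constant, and \<open>p \<le> 2 - \<alpha>\<close> gives \<open>j\<^bsup>p-2\<^esup> \<le> j\<^bsup>-\<alpha>\<^esup>\<close>. The first and the last cell
  contribute at most a multiple of \<open>\<tau>\<^sup>p t\<^sub>m\<^bsup>-\<alpha>\<^esup>\<close> as well.
\<close>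

lemma L1_truncation:
  fixes w :: "real \<Rightarrow> real"
  assumes \<alpha>: "0 < \<alpha>" "\<alpha> < 1" and T: "0 < T" "1 \<le> r" and \<delta>: "0 < \<delta>"
    and w: "weighted_lip T (2 powr r) \<delta> w" and p: "p \<le> 2 - \<alpha>" "p \<le> r * \<delta>"
  shows "\<exists>A\<ge>0. \<forall>M\<ge>1. \<forall>m\<in>{1..M}.
     \<bar>L1_op \<alpha> (graded_mesh T r M) (\<lambda>k. frac_int 1 w (graded_mesh T r M k)) m
        - frac_int (1 - \<alpha>) w (graded_mesh T r M m)\<bar>
       \<le> A * graded_step T r M powr p * graded_mesh T r M m powr (- \<alpha>)"
proof -
  define \<kappa> where "\<kappa> = 2 powr r"
  have \<kappa>: "1 < \<kappa>" unfolding \<kappa>_def using T(2) by (intro gr_one_powr) auto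
  note w = w[folded \<kappa>_def]
  obtain C where C: "0 \<le> C" "\<And>y. 0 < y \<Longrightarrow> y \<le> T \<Longrightarrow> \<bar>w y\<bar> \<le> C * y powr (\<delta> - 1)"
     "\<And>x y. 0 < y \<Longrightarrow> y \<le> x \<Longrightarrow> x \<le> T \<Longrightarrow> x \<le> \<kappa> * y \<Longrightarrow>
      \<bar>w x - w y\<bar> \<le> C * (x - y) * y powr (\<delta> - 2)"
    using weighted_lipE[OF w] by metis
  define S where "S = T powr (1 / r)"
  define D where "D = S powr (r * \<delta> - p)"
  have D: "0 \<le> D" by (simp add: D_def)
  \<comment> \<open>\<open>A1\<close> belongs to the cells with \<open>2 \<le> j \<le> m\<close>, \<open>A2\<close> to the first cell, and \<open>A3\<close> to the case \<open>m = 1\<close>.\<close>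
  define A1 where "A1 = C * \<kappa> powr \<bar>\<delta> - 2\<bar> * r\<^sup>2 * D"
  have A1: "0 \<le> A1" using C D by (simp add: A1_def)
  define A2 where "A2 = 2 powr \<alpha> * (2 * C / \<delta>) * D"
  have A2: "0 \<le> A2" using C D \<delta> by (simp add: A2_def)
  define A3 where "A3 = (C / \<delta> / (1 - \<alpha>) + C * Beta (1 - \<alpha>) \<delta>) * D"
  have A3: "0 \<le> A3" using C D \<delta> \<alpha> Beta_real_pos[of "1 - \<alpha>" \<delta>] by (simp add: A3_def)
  define G where "G = Gamma (1 - \<alpha>)"
  have G: "0 < G" unfolding G_def using \<alpha> by (intro Gamma_real_pos) auto
  define A where "A = (A2 + 2 * 2 powr \<alpha> * A1 + A1 / (1 - \<alpha>) + A3) / G"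
  have A0: "0 \<le> A" using A1 A2 A3 G \<alpha> by (simp add: A_def)
  show ?thesis
  proof (intro exI[of _ A] conjI allI impI ballI A0)
    fix M m :: nat assume M: "1 \<le> M" and m: "m \<in> {1..M}"
    define t where "t = graded_mesh T r M"
    define \<tau> where "\<tau> = graded_step T r M"
    have \<tau>: "0 < \<tau>" unfolding \<tau>_def using T M by (intro graded_step_pos)
    define P where "P = \<tau> powr p"
    define X where "X = t m powr (- \<alpha>)"
    have PX: "0 \<le> P" "0 \<le> X" by (auto simp: P_def X_def)
    have t0: "t 0 = 0" by (simp add: t_def graded_mesh_0)
    have sm: "strict_mono_on {..m} t" unfolding t_def using T M by (intro graded_mesh_strict_mono)
    have lt: "t i < t j" if "i < j" for i j
      using graded_mesh_strict_mono[OF T M, of UNIV] that by (auto simp: t_def strict_mono_on_def)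
    have tT: "t k \<le> T" if "k \<le> m" for k
      unfolding t_def using that m M T by (intro graded_mesh_le) auto
    have tpos: "0 < t k" if "0 < k" for k using lt[OF that] t0 by simp
    have wabs: "w absolutely_integrable_on {0..t k}" if "k \<le> m" for k
      using weighted_lip_integrable[OF w \<kappa> \<delta>, of "t k"] tT[OF that] t0 lt[of 0 k] by (cases "k = 0") auto
    have wint: "w integrable_on {t k..t (k + 1)}" if "k < m" for k
    proof (rule integrable_subinterval_real)
      show "w integrable_on {0..t m}" using wabs[of m] by (simp add: absolutely_integrable_on_def)
    qed (use that t0 lt[of 0 k] lt[of "k + 1" m] in \<open>cases "k = 0"; cases "k + 1 = m"; auto\<close>)
    have wabs': "w absolutely_integrable_on {t k..t (k + 1)}" if "k < m" for k
      by (rule set_integrable_subset[OF wabs[of m]])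
         (use that t0 lt[of 0 k] lt[of "k + 1" m] in \<open>cases "k = 0"; cases "k + 1 = m"; auto\<close>)+
    have pw: "(real j * \<tau>) powr (r * \<delta>) \<le> real j powr p * P * D" if "1 \<le> j" "j \<le> m" for j
    proof -
      have "(real j * \<tau>) powr (r * \<delta>) = (real j * \<tau>) powr p * (real j * \<tau>) powr (r * \<delta> - p)"
        by (simp flip: powr_add)
      also have "\<dots> \<le> (real j * \<tau>) powr p * D"
        unfolding D_def S_def using p \<tau> graded_step_times_le[OF T(1) M, of j r] that m
        by (intro mult_left_mono powr_mono2) (auto simp: \<tau>_def)
      also have "(real j * \<tau>) powr p = real j powr p * P" by (simp add: powr_mult P_def)
      finally show ?thesis .
    qed
    have t_powr: "t j powr \<delta> = (real j * \<tau>) powr (r * \<delta>)" for j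
      by (simp add: t_def \<tau>_def graded_mesh_def powr_powr)
    have t1: "t 1 powr \<delta> \<le> P * D" using pw[of 1] m unfolding t_powr by simp
    define d where "d = (\<lambda>k. integral {t k..t (k + 1)} w / (t (k + 1) - t k))"
    define E where "E = (\<lambda>k. integral {t k..t (k + 1)} (\<lambda>s. (t m - s) powr (- \<alpha>) * (d k - w s)))"
    have Kw: "(\<lambda>s. (t m - s) powr (- \<alpha>) * w s) integrable_on {0..t m}"
      using weighted_lip_integrand[OF w \<kappa> \<delta>, of "1 - \<alpha>" "t m"] \<alpha> tT[of m] tpos[of m] m
      by (auto simp: absolutely_integrable_on_def)
    have wm: "w integrable_on {0..t m}" using wabs[of m] by (simp add: absolutely_integrable_on_def)
    note cells = L1_truncation_cells[OF \<alpha> sm t0 wm Kw, of d]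
    have op: "L1_op \<alpha> t (\<lambda>k. frac_int 1 w (t k)) m - frac_int (1 - \<alpha>) w (t m) = (\<Sum>k<m. E k) / G"
      unfolding E_def G_def by (rule cells(1)) (simp add: d_def)
    have Eint: "(\<lambda>s. (t m - s) powr (- \<alpha>) * (d k - w s)) integrable_on {t k..t (k + 1)}" if "k < m" for k
      by (rule cells(2)) (use that in \<open>auto simp: d_def\<close>)
    define \<omega> where "\<omega> = (\<lambda>k. C * \<kappa> powr \<bar>\<delta> - 2\<bar> * (t (k + 1) - t k) * t (k + 1) powr (\<delta> - 2))"
    have osc: "\<bar>d k - w s\<bar> \<le> \<omega> k" if "1 \<le> k" "k < m" "s \<in> {t k..t (k + 1)}" for k s
      unfolding \<omega>_def
    proof (rule cell_oscillation[where T = T and \<kappa> = \<kappa>, OF _ _ _ _ C(1) C(3)])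
      show "t (k + 1) \<le> \<kappa> * t k" unfolding \<kappa>_def t_def using that T M by (intro graded_mesh_double) auto
    qed (use that tpos lt tT wint in \<open>auto simp: d_def\<close>)
    have \<omega>: "(t (k + 1) - t k) * \<omega> k \<le> A1 * P * real (k + 1) powr (- \<alpha>)" if "1 \<le> k" "k < m" for k
    proof -
      define b where "b = t (k + 1)"
      define j where "j = real (k + 1)"
      have j: "1 \<le> j" by (simp add: j_def)
      have b: "0 < b" unfolding b_def by (intro tpos) simp
      have h: "0 \<le> b - t k" "b - t k \<le> r * b / j"
        using lt[of k "k + 1"] graded_mesh_width[OF T M, of k] by (auto simp: b_def j_def t_def)
      have "(b - t k) * \<omega> k = C * \<kappa> powr \<bar>\<delta> - 2\<bar> * ((b - t k)\<^sup>2 * b powr (\<delta> - 2))"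
        by (simp add: \<omega>_def b_def power2_eq_square mult_ac)
      also have "\<dots> \<le> C * \<kappa> powr \<bar>\<delta> - 2\<bar> * ((r * b / j)\<^sup>2 * b powr (\<delta> - 2))"
        using h C(1) by (intro mult_left_mono mult_right_mono power_mono) auto
      also have "(r * b / j)\<^sup>2 * b powr (\<delta> - 2) = r\<^sup>2 * (b powr \<delta> / j\<^sup>2)"
      proof -
        have "b powr (\<delta> - 2) = b powr \<delta> / b\<^sup>2" using b by (simp add: powr_diff powr_numeral)
        then show ?thesis using b by (simp add: power_divide power_mult_distrib)
      qed
      also have "C * \<kappa> powr \<bar>\<delta> - 2\<bar> * (r\<^sup>2 * (b powr \<delta> / j\<^sup>2)) \<le> C * \<kappa> powr \<bar>\<delta> - 2\<bar> * (r\<^sup>2 * (P * D * j powr (- \<alpha>)))"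
      proof -
        have "b powr \<delta> / j\<^sup>2 \<le> j powr p * P * D / j\<^sup>2"
          using pw[of "k + 1"] that by (intro divide_right_mono) (auto simp: t_powr b_def j_def)
        also have "\<dots> = P * D * j powr (p - 2)" using j by (simp add: powr_diff powr_numeral)
        also have "\<dots> \<le> P * D * j powr (- \<alpha>)"
          using p j PX D by (intro mult_left_mono powr_mono) auto
        finally show ?thesis using C(1) by (intro mult_left_mono) auto
      qed
      finally show ?thesis by (simp add: A1_def b_def j_def mult_ac)
    qed
    have "\<bar>\<Sum>k<m. E k\<bar> \<le> (A2 + 2 * 2 powr \<alpha> * A1 + A1 / (1 - \<alpha>) + A3) * (P * X)"
    proof (cases "m = 1")
      case True
      have "\<bar>E 0\<bar> \<le> (C / \<delta> / (1 - \<alpha>) + C * Beta (1 - \<alpha>) \<delta>) * (t 1 powr \<delta> * t 1 powr (- \<alpha>))"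
      proof -
        have E0: "E 0 = integral {0..t 1} (\<lambda>s. (t 1 - s) powr (- \<alpha>) * (d 0 - w s))"
          using True t0 by (simp add: E_def)
        have t1T: "t 1 \<le> T" using tT[of 1] True by simp
        show ?thesis unfolding E0
        proof (rule cell_error_single[OF _ \<alpha> \<delta> C(1)])
          show "0 < t 1" by (rule tpos) simp
          show "w absolutely_integrable_on {0..t 1}" using wabs[of 1] True by simp
          show "d 0 = integral {0..t 1} w / t 1" by (simp add: d_def t0)
          show "w \<in> borel_measurable (lebesgue_on {0<..<t 1})" by (rule weighted_lip_measurable[OF w \<kappa> t1T])
          show "\<bar>w s\<bar> \<le> C * s powr (\<delta> - 1)" if "s \<in> {0<..t 1}" for s
            using C(2)[of s] that t1T by auto
        qed
      qed
      also have "\<dots> \<le> (C / \<delta> / (1 - \<alpha>) + C * Beta (1 - \<alpha>) \<delta>) * (P * D * t 1 powr (- \<alpha>))"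
        using t1 C \<delta> \<alpha> Beta_real_pos[of "1 - \<alpha>" \<delta>] by (intro mult_left_mono mult_right_mono) auto
      also have "\<dots> = A3 * (P * X)" using True by (simp add: A3_def X_def mult_ac)
      also have "\<dots> \<le> (A2 + 2 * 2 powr \<alpha> * A1 + A1 / (1 - \<alpha>) + A3) * (P * X)"
        using A1 A2 \<alpha> PX by (intro mult_right_mono) auto
      finally show ?thesis using True by simp
    next
      case False
      then obtain n where n: "m = Suc (Suc n)" using m by (metis One_nat_def Suc_pred atLeastAtMost_iff gr0I le_antisym less_eq_Suc_le not_less_eq_eq)
      have first: "\<bar>E 0\<bar> \<le> A2 * (P * X)"
      proof -
        have "\<bar>E 0\<bar> \<le> (t m - t 1) powr (- \<alpha>) * (2 * C / \<delta> * t 1 powr \<delta>)"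
        proof -
          have E0: "E 0 = integral {0..t 1} (\<lambda>s. (t m - s) powr (- \<alpha>) * (d 0 - w s))"
            using t0 by (simp add: E_def)
          show ?thesis unfolding E0
          proof (rule cell_error_first[OF _ _ \<alpha>(1) \<delta> C(1)])
            show "0 < t 1" by (rule tpos) simp
            show "t 1 < t m" by (rule lt) (simp add: n)
            show "w absolutely_integrable_on {0..t 1}" using wabs[of 1] n by simp
            show "d 0 = integral {0..t 1} w / t 1" by (simp add: d_def t0)
            show "\<bar>w s\<bar> \<le> C * s powr (\<delta> - 1)" if "s \<in> {0<..t 1}" for s
              using C(2)[of s] that tT[of 1] n by auto
          qed
        qed
        also have "\<dots> \<le> (2 powr \<alpha> * X) * (2 * C / \<delta> * (P * D))"
        proof (intro mult_mono mult_left_mono t1)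
          have "(t m - t 1) powr (- \<alpha>) \<le> (real m / real (m - 1)) powr \<alpha> * t m powr (- \<alpha>)"
            unfolding t_def using n \<alpha> by (intro graded_mesh_kernel[OF T M]) auto
          also have "\<dots> \<le> 2 powr \<alpha> * t m powr (- \<alpha>)"
            using n \<alpha> by (intro mult_right_mono powr_mono2) (auto simp: field_simps)
          finally show "(t m - t 1) powr (- \<alpha>) \<le> 2 powr \<alpha> * X" by (simp add: X_def)
        qed (use C \<delta> PX in auto)
        finally show ?thesis by (simp add: A2_def mult_ac)
      qed
      have last: "\<bar>E (n + 1)\<bar> \<le> A1 / (1 - \<alpha>) * (P * X)"
      proof -
        have m': "t (n + 1 + 1) = t m" by (simp add: n)
        have "\<bar>E (n + 1)\<bar> \<le> (t m - t (n + 1)) powr (- \<alpha>) * ((t m - t (n + 1)) * \<omega> (n + 1)) / (1 - \<alpha>)"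
          unfolding E_def m'
          using lt[of "n + 1" m] Eint[of "n + 1"] osc[of "n + 1"] n
          by (intro cell_error_last \<alpha>) (auto simp: m')
        also have "\<dots> \<le> (real m powr \<alpha> * X) * (A1 * P * real m powr (- \<alpha>)) / (1 - \<alpha>)"
        proof (rule divide_right_mono[OF mult_mono])
          show "(t m - t (n + 1)) powr (- \<alpha>) \<le> real m powr \<alpha> * X"
            using graded_mesh_kernel[OF T M, of "n + 1" m \<alpha>] \<alpha> by (simp add: n t_def X_def)
          show "(t m - t (n + 1)) * \<omega> (n + 1) \<le> A1 * P * real m powr (- \<alpha>)"
            using \<omega>[of "n + 1"] n by simp
          show "0 \<le> (t m - t (n + 1)) * \<omega> (n + 1)"
            using lt[of "n + 1" m] n C by (auto simp: \<omega>_def)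
        qed (use PX \<alpha> in auto)
        also have "\<dots> = A1 / (1 - \<alpha>) * (P * X) * (real m powr \<alpha> * real m powr (- \<alpha>))" by simp
        also have "real m powr \<alpha> * real m powr (- \<alpha>) = 1" using n by (simp flip: powr_add)
        finally show ?thesis by simp
      qed
      have mid: "\<bar>\<Sum>k<n. E (k + 1)\<bar> \<le> 2 * 2 powr \<alpha> * A1 * (P * X)"
      proof -
        let ?g = "\<lambda>j. ((t m - t j) powr (- \<alpha>) - (t m - t (j - 1)) powr (- \<alpha>)) * real j powr (- \<alpha>)"
        have "\<bar>\<Sum>k<n. E (k + 1)\<bar> \<le> (\<Sum>k<n. \<bar>E (k + 1)\<bar>)" by (rule sum_abs)
        also have "\<dots> \<le> (\<Sum>k<n. A1 * P * ?g (k + 2))"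
        proof (rule sum_mono)
          fix k assume "k \<in> {..<n}"
          then have k: "1 \<le> k + 1" "k + 1 < m" "k + 2 < m" using n by auto
          have k2: "k + 1 + 1 = k + 2" by simp
          let ?\<Delta> = "(t m - t (k + 2)) powr (- \<alpha>) - (t m - t (k + 1)) powr (- \<alpha>)"
          have "\<bar>E (k + 1)\<bar> \<le> ?\<Delta> * ((t (k + 2) - t (k + 1)) * \<omega> (k + 1))"
            unfolding E_def k2
          proof (rule cell_error_interior[OF _ _ \<alpha>(1)])
            show "w absolutely_integrable_on {t (k + 1)..t (k + 2)}" using wabs'[OF k(2)] by simp
            show "d (k + 1) = integral {t (k + 1)..t (k + 2)} w / (t (k + 2) - t (k + 1))" by (simp add: d_def)
            show "\<bar>d (k + 1) - w s\<bar> \<le> \<omega> (k + 1)" if "s \<in> {t (k + 1)..t (k + 2)}" for s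
              using osc[OF k(1,2), of s] that by simp
          qed (use lt k in auto)
          also have "\<dots> \<le> ?\<Delta> * (A1 * P * real (k + 2) powr (- \<alpha>))"
          proof (rule mult_left_mono)
            show "(t (k + 2) - t (k + 1)) * \<omega> (k + 1) \<le> A1 * P * real (k + 2) powr (- \<alpha>)"
              using \<omega>[OF k(1,2)] by (simp only: k2)
            have "(t m - t (k + 1)) powr (- \<alpha>) \<le> (t m - t (k + 2)) powr (- \<alpha>)"
              using lt[of "k + 1" "k + 2"] lt[OF k(3)] \<alpha> by (intro powr_mono2') auto
            then show "0 \<le> ?\<Delta>" by simp
          qed
          finally show "\<bar>E (k + 1)\<bar> \<le> A1 * P * ?g (k + 2)" by (simp add: mult_ac)
        qed
        also have "\<dots> = A1 * P * (\<Sum>k<n. ?g (k + 2))" by (simp only: sum_distrib_left)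
        also have "(\<Sum>k<n. ?g (k + 2)) = (\<Sum>j=2..m-1. ?g j)"
          using sum.shift_bounds_nat_ivl[of ?g 0 2 n]
          by (simp add: n lessThan_atLeast0 atLeastLessThanSuc_atLeastAtMost[symmetric] numeral_2_eq_2 del: sum.shift_bounds_Suc_ivl)
        also have "A1 * P * (\<Sum>j=2..m-1. ?g j) \<le> A1 * P * (2 * 2 powr \<alpha> * t m powr (- \<alpha>))"
          unfolding t_def using A1 PX n \<alpha> by (intro mult_left_mono kernel_increment_sum[OF T M]) auto
        finally show ?thesis by (simp add: X_def mult_ac)
      qed
      have "(\<Sum>k<m. E k) = E 0 + (\<Sum>k<n. E (k + 1)) + E (n + 1)"
        using sum.lessThan_Suc[of E "Suc n"] sum.lessThan_Suc_shift[of E n] unfolding n by simp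
      then have "\<bar>\<Sum>k<m. E k\<bar> \<le> A2 * (P * X) + 2 * 2 powr \<alpha> * A1 * (P * X) + A1 / (1 - \<alpha>) * (P * X)"
        using first mid last by linarith
      also have "\<dots> \<le> (A2 + 2 * 2 powr \<alpha> * A1 + A1 / (1 - \<alpha>) + A3) * (P * X)"
        using A3 PX unfolding distrib_right by simp
      finally show ?thesis .
    qed
    then have "\<bar>\<Sum>k<m. E k\<bar> / G \<le> (A2 + 2 * 2 powr \<alpha> * A1 + A1 / (1 - \<alpha>) + A3) * (P * X) / G"
      using G by (intro divide_right_mono) auto
    then have "\<bar>(\<Sum>k<m. E k) / G\<bar> \<le> A * P * X" using G by (simp add: A_def abs_divide)
    then show "\<bar>L1_op \<alpha> (graded_mesh T r M) (\<lambda>k. frac_int 1 w (graded_mesh T r M k)) m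
        - frac_int (1 - \<alpha>) w (graded_mesh T r M m)\<bar>
       \<le> A * graded_step T r M powr p * graded_mesh T r M m powr (- \<alpha>)"
      unfolding op[unfolded t_def, symmetric] P_def X_def t_def \<tau>_def by (simp add: mult.assoc)
  qed
qed

section \<open>The error estimate\<close>

lemma L1_coeff_eq_last_weight:
  assumes \<alpha>: "0 < \<alpha>" "\<alpha> < 1" and t: "t (m - 1) < t m" "0 < m"
  shows "L1_coeff \<alpha> t m 0 = L1_weight \<alpha> t m (m - 1)"
proof -
  have "integral {t (m - 1)..t m} (\<lambda>s. (t m - s) powr (1 - \<alpha> - 1)) =
      ((t m - t (m - 1)) powr (1 - \<alpha>) - (t m - t m) powr (1 - \<alpha>)) / (1 - \<alpha>)"
    using t \<alpha> by (intro integral_unique kernel_has_integral) auto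
  then have "L1_coeff \<alpha> t m 0 =
      ((t m - t (m - 1)) powr (1 - \<alpha>) - (t m - t m) powr (1 - \<alpha>)) / (1 - \<alpha>) / (Gamma (1 - \<alpha>) * (t m - t (m - 1)))"
    by (simp add: L1_coeff_def frac_kernel_def)
  also have "\<dots> = L1_weight \<alpha> t m (m - 1)"
    using t by (simp add: L1_weight_def Gamma_2_minus[OF \<alpha>(2)] mult.assoc)
  finally show ?thesis .
qed

text \<open>
  The linear system for \<open>V\<close> is lower triangular with diagonal entries \<open>a\<^sub>0\<^bsup>(m)\<^esup> + \<lambda>\<close>.
\<close>

lemma L1_scheme_unique:
  assumes \<alpha>: "0 < \<alpha>" "\<alpha> < 1" and t: "strict_mono_on {..M} t"
    and nz: "\<And>m. m \<in> {1..M} \<Longrightarrow> L1_coeff \<alpha> t m 0 + lam \<noteq> 0"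
    and V: "L1_scheme \<alpha> lam n f t M V" and V': "L1_scheme \<alpha> lam n f t M V'"
  shows "m \<le> M \<Longrightarrow> V m = V' m"
proof (induction m rule: less_induct)
  case (less m)
  show ?case
  proof (cases m)
    case 0
    then show ?thesis using V V' by (simp add: L1_scheme_def)
  next
    case (Suc j)
    define e where "e = (\<lambda>k. V k - V' k)"
    have e0: "e k = 0" if "k < m" for k using less that by (simp add: e_def)
    have "L1_op \<alpha> t e m = L1_weight \<alpha> t m j * e m"
      unfolding L1_op_weight using e0 by (simp add: Suc)
    moreover have "L1_op \<alpha> t e m + lam * e m = 0"
      using V V' less.prems Suc unfolding e_def L1_op_diff L1_scheme_def by (simp add: algebra_simps)
    moreover have "L1_coeff \<alpha> t m 0 = L1_weight \<alpha> t m j"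
      using L1_coeff_eq_last_weight[OF \<alpha>, of t m] strict_mono_onD[OF t, of j m] less.prems Suc by simp
    ultimately have "(L1_coeff \<alpha> t m 0 + lam) * e m = 0" by (simp add: distrib_right)
    then show ?thesis using nz[of m] less.prems Suc by (simp add: e_def)
  qed
qed

theorem theorem2p4:
  fixes \<alpha> T lam r \<sigma> \<sigma>' f0 f0' C1 C2 :: real and n :: nat
    and f f' f'' u :: "real \<Rightarrow> real"
  assumes "0 < \<alpha>" and "\<alpha> < 1" and "0 < T" and "1 \<le> r"
    and "bounded (f ` {0..T})"
    and "\<And>t. t \<in> {0<..T} \<Longrightarrow> (f has_real_derivative f' t) (at t within {0<..T})"
    and "\<And>t. t \<in> {0<..T} \<Longrightarrow> (f' has_real_derivative f'' t) (at t within {0<..T})"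
    and "(f \<longlongrightarrow> f0) (at_right 0)"
    and "(f' \<longlongrightarrow> f0') (at_right 0)"
    and "\<sigma> < 1" and "\<sigma>' < 1"
    and "\<And>t. t \<in> {0<..T} \<Longrightarrow> \<bar>f' t\<bar> \<le> C1 * t powr (- \<sigma>)"
    and "\<And>t. t \<in> {0<..T} \<Longrightarrow> \<bar>f'' t\<bar> \<le> C2 * t powr (- \<sigma>')"
    and "frac_solution T \<alpha> lam f u"
  shows "\<exists>Q>0. \<forall>M\<ge>1. \<forall>V.
    (\<forall>m\<in>{1..M}. L1_coeff \<alpha> (graded_mesh T r M) m 0 + lam \<noteq> 0) \<longrightarrow>
    L1_scheme \<alpha> lam n f (graded_mesh T r M) M V \<longrightarrow>
    (\<forall>m\<in>{1..M}.
       \<bar>u (graded_mesh T r M m) - numerical_approx \<alpha> lam n f (graded_mesh T r M) V m\<bar>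
         \<le> Q * graded_step T r M powr (min (2 - \<alpha>) (r * (real n + 1) * \<alpha>)))"
proof -
  note \<alpha> = assms(1,2) and T = assms(3,4) and der = assms(6) and sol = assms(14)
  define \<kappa> where "\<kappa> = 2 powr r"
  have \<kappa>: "1 < \<kappa>" unfolding \<kappa>_def using T(2) by (intro gr_one_powr) auto
  define \<delta> where "\<delta> = real (Suc n) * \<alpha>"
  have \<delta>: "0 < \<delta>" unfolding \<delta>_def using \<alpha> by simp
  define p where "p = min (2 - \<alpha>) (r * (real n + 1) * \<alpha>)"
  have r\<delta>: "r * (real n + 1) * \<alpha> = r * \<delta>" by (simp add: \<delta>_def add.commute)
  have p: "p \<le> 2 - \<alpha>" "p \<le> r * \<delta>" unfolding p_def r\<delta> by simp_all
  have f: "bounded_measurable T f"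
  proof -
    have "continuous_on {0<..T} f" using der by (rule DERIV_continuous_on)
    then have "continuous_on {0<..<T} f" by (rule continuous_on_subset) auto
    moreover obtain B where "\<forall>s\<in>{0..T}. \<bar>f s\<bar> \<le> B" using assms(5) by (auto simp: bounded_iff)
    ultimately show ?thesis
      unfolding bounded_measurable_def by (intro conjI continuous_imp_measurable_on_sets_lebesgue exI[of _ B]) auto
  qed
  have u: "bounded_measurable T u"
  proof -
    have c: "continuous_on {0..T} u" using sol by (simp add: frac_solution_def)
    then have "bounded (u ` {0..T})" by (intro compact_imp_bounded compact_continuous_image) auto
    then obtain B where "\<forall>s\<in>{0..T}. \<bar>u s\<bar> \<le> B" by (auto simp: bounded_iff)
    moreover have "continuous_on {0<..<T} u" using c by (rule continuous_on_subset) auto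
    ultimately show ?thesis
      unfolding bounded_measurable_def by (intro conjI continuous_imp_measurable_on_sets_lebesgue exI[of _ B]) auto
  qed
  have "weighted_lip T \<kappa> (1 - max \<sigma> 0) f'"
    using assms(7,11-13) by (intro weighted_lip_derivative[where f'' = f'']) auto
  then obtain q0 where q0: "weighted_lip T \<kappa> \<alpha> q0" "\<And>t. t \<in> {0..T} \<Longrightarrow> frac_int \<alpha> f t = frac_int 1 q0 t"
    using frac_int_forcing[OF \<alpha>(1) \<kappa> der assms(8)] assms(10) by force
  have volterra: "u t = frac_int \<alpha> f t - lam * frac_int \<alpha> u t" if "t \<in> {0..T}" for t
    using frac_solution_volterra[OF \<alpha> sol f u that] .
  obtain w0 where w0: "weighted_lip T \<kappa> \<alpha> w0" "\<And>t. t \<in> {0..T} \<Longrightarrow> u t = frac_int 1 w0 t"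
    using volterra_regular[OF \<alpha>(1) _ \<kappa> f u volterra q0] \<alpha> by force
  have w0': "frac_int (1 - \<alpha>) w0 t = f t - lam * u t" if t: "t \<in> {0<..T}" for t
  proof -
    have "frac_int (1 - \<alpha>) w0 t = frac_int (1 - \<alpha>) (deriv u) t"
      using t deriv_frac_int_1[OF w0(1) \<kappa> \<alpha>(1) w0(2)] by (intro frac_int_cong) auto
    then show ?thesis using sol t by (auto simp: frac_solution_def frac_deriv_def algebra_simps)
  qed
  obtain w where w: "weighted_lip T \<kappa> \<delta> w"
     "\<And>t. t \<in> {0..T} \<Longrightarrow> frac_pow \<alpha> lam n u t = frac_int 1 w t"
     "\<And>t. t \<in> {0<..T} \<Longrightarrow> frac_int (1 - \<alpha>) w t = frac_pow \<alpha> lam n f t - lam * frac_pow \<alpha> lam n u t"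
    using frac_pow_solution[OF \<alpha> \<kappa> f u w0 w0', of n] unfolding \<delta>_def by blast
  obtain A where A: "0 \<le> A" "\<And>M m. 1 \<le> M \<Longrightarrow> m \<in> {1..M} \<Longrightarrow>
     \<bar>L1_op \<alpha> (graded_mesh T r M) (\<lambda>k. frac_int 1 w (graded_mesh T r M k)) m
        - frac_int (1 - \<alpha>) w (graded_mesh T r M m)\<bar>
       \<le> A * graded_step T r M powr p * graded_mesh T r M m powr (- \<alpha>)"
    using L1_truncation[OF \<alpha> T \<delta> w(1)[unfolded \<kappa>_def] p] by blast
  define R where "R = 2 * Gamma (1 - \<alpha>) * \<bar>lam\<bar> * exp 2"
  have G: "0 < Gamma (1 - \<alpha>)" using \<alpha> by (intro Gamma_real_pos) auto
  have R: "0 \<le> R" using G by (simp add: R_def)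
  \<comment> \<open>The smallest rate that dominates \<open>\<lambda>\<close> in the barrier, plus 1 to keep it positive for \<open>\<lambda> = 0\<close>.\<close>
  define \<mu> where "\<mu> = 2 * R powr (1 / \<alpha>) + 1"
  have \<mu>: "0 < \<mu>" by (simp add: \<mu>_def add_nonneg_pos)
  have R_le: "R \<le> (\<mu> / 2) powr \<alpha>"
  proof -
    have "R = (R powr (1 / \<alpha>)) powr \<alpha>" using R \<alpha> by (simp add: powr_powr)
    also have "\<dots> \<le> (\<mu> / 2) powr \<alpha>" using \<alpha> by (intro powr_mono2) (auto simp: \<mu>_def)
    finally show ?thesis .
  qed
  define admissible where "admissible = (\<lambda>M V. (\<forall>m\<in>{1..M}. L1_coeff \<alpha> (graded_mesh T r M) m 0 + lam \<noteq> 0) \<and>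
    L1_scheme \<alpha> lam n f (graded_mesh T r M) M V)"
  define err where "err = (\<lambda>M V m. \<bar>u (graded_mesh T r M m) - numerical_approx \<alpha> lam n f (graded_mesh T r M) V m\<bar>)"
  define Q1 where "Q1 = 2 * Gamma (1 - \<alpha>) * A * exp (\<mu> * T)"
  have Q1: "0 \<le> Q1" using G A(1) by (simp add: Q1_def)
  \<comment> \<open>Steps are at most \<open>r T / M\<close>, so that the barrier is available for these \<open>M\<close>.\<close>
  have fine: "err M V m \<le> Q1 * graded_step T r M powr p"
    if M: "1 \<le> M" "r * T * \<mu> \<le> real M" and V: "admissible M V" and m: "m \<in> {1..M}" for M V m
  proof -
    define t where "t = graded_mesh T r M"
    define \<epsilon> where "\<epsilon> = A * graded_step T r M powr p"
    have \<epsilon>: "0 \<le> \<epsilon>" using A(1) by (simp add: \<epsilon>_def)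
    define v where "v = (\<lambda>k. frac_int 1 w (t k))"
    define e where "e = (\<lambda>k. v k - V k)"
    have tT: "t k \<in> {0..T}" if "k \<le> M" for k
      using graded_mesh_le[OF T M(1) that] graded_mesh_nonneg by (simp add: t_def)
    have sm: "strict_mono_on {..M} t" unfolding t_def using T M by (intro graded_mesh_strict_mono)
    have t0: "t 0 = 0" by (simp add: t_def graded_mesh_0)
    have V': "V 0 = 0" "\<And>k. k \<in> {1..M} \<Longrightarrow> L1_op \<alpha> t V k + lam * V k = frac_pow \<alpha> lam n f (t k)"
      using V by (auto simp: admissible_def L1_scheme_def t_def)
    have "\<bar>e m\<bar> \<le> 2 * Gamma (1 - \<alpha>) * \<epsilon> * barrier \<mu> t m"
    proof (rule L1_stability[OF \<alpha> sm t0 \<mu> _ R_le[unfolded R_def] _ \<epsilon>])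
      show "e 0 = 0" by (simp add: e_def v_def t0 frac_int_0 V')
      show "m \<le> M" using m by simp
      show "t (k + 1) - t k \<le> 1 / \<mu>" if "k < M" for k
      proof -
        have "t (k + 1) - t k \<le> r * T / real M"
          unfolding t_def using graded_mesh_width_uniform[OF T M(1) that] .
        also have "\<dots> \<le> 1 / \<mu>" using M \<mu> by (simp add: field_simps)
        finally show ?thesis .
      qed
      fix k assume k: "k \<in> {1..M}"
      have tk: "t k \<in> {0<..T}" using tT[of k] strict_mono_onD[OF sm, of 0 k] k t0 by auto
      have "L1_op \<alpha> t e k + lam * e k = L1_op \<alpha> t v k - frac_int (1 - \<alpha>) w (t k)"
        using V'(2)[OF k] w(2)[of "t k"] w(3)[OF tk] tk
        unfolding e_def L1_op_diff by (simp add: v_def algebra_simps)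
      then show "\<bar>L1_op \<alpha> t e k + lam * e k\<bar> \<le> \<epsilon> * t k powr (- \<alpha>)"
        using A(2)[OF M(1) k] by (simp add: t_def v_def \<epsilon>_def)
    qed
    also have "\<dots> \<le> 2 * Gamma (1 - \<alpha>) * \<epsilon> * exp (\<mu> * T)"
      using G \<epsilon> \<mu> tT[of m] m by (intro mult_left_mono) (auto simp: barrier_def)
    also have "\<dots> = Q1 * graded_step T r M powr p" by (simp add: Q1_def \<epsilon>_def mult_ac)
    finally have "\<bar>e m\<bar> \<le> Q1 * graded_step T r M powr p" .
    moreover have "u (t m) - numerical_approx \<alpha> lam n f t V m = e m"
      using solution_expansion[OF \<alpha> \<kappa> f u w0 w0' tT[of m], of n] w(2)[OF tT[of m]] m
      by (simp add: numerical_approx_def e_def v_def)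
    ultimately show ?thesis by (simp add: err_def t_def)
  qed
  \<comment> \<open>For a single \<open>M\<close> the scheme has at most one solution and finitely many mesh points.\<close>
  have "\<exists>B\<ge>0. \<forall>V. admissible M V \<longrightarrow> (\<forall>m\<in>{1..M}. err M V m \<le> B * graded_step T r M powr p)" if M: "1 \<le> M" for M
  proof (cases "\<exists>V. admissible M V")
    case True
    then obtain V0 where V0: "admissible M V0" by blast
    define B where "B = (\<Sum>m\<le>M. err M V0 m) / graded_step T r M powr p"
    have sp: "0 < graded_step T r M powr p" using graded_step_pos[OF T(1) M, of r] by simp
    show ?thesis
    proof (intro exI[of _ B] conjI allI impI ballI)
      show "0 \<le> B" using sp by (auto simp: B_def err_def intro!: divide_nonneg_nonneg sum_nonneg)
      fix V m assume V: "admissible M V" and m: "m \<in> {1..M}"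
      have "V m = V0 m"
        using V V0 m graded_mesh_strict_mono[OF T M]
        by (intro L1_scheme_unique[OF \<alpha>, of M "graded_mesh T r M" lam n f]) (auto simp: admissible_def)
      then have "err M V m = err M V0 m" by (simp add: err_def numerical_approx_def)
      also have "\<dots> \<le> (\<Sum>m\<le>M. err M V0 m)"
        using m by (intro member_le_sum) (auto simp: err_def)
      finally show "err M V m \<le> B * graded_step T r M powr p" using sp by (simp add: B_def)
    qed
  qed (intro exI[of _ 0], auto)
  then obtain B where B: "\<And>M. 1 \<le> M \<Longrightarrow> 0 \<le> B M"
    "\<And>M V m. 1 \<le> M \<Longrightarrow> admissible M V \<Longrightarrow> m \<in> {1..M} \<Longrightarrow> err M V m \<le> B M * graded_step T r M powr p"
    by metis
  obtain M0 :: nat where M0: "r * T * \<mu> \<le> real M0" using real_arch_simple by blast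
  define Q where "Q = Q1 + (\<Sum>M=1..M0. B M) + 1"
  have Bsum: "0 \<le> (\<Sum>M=1..M0. B M)" using B(1) by (intro sum_nonneg) auto
  have "err M V m \<le> Q * graded_step T r M powr p" if M: "1 \<le> M" and V: "admissible M V" and m: "m \<in> {1..M}" for M V m
  proof (cases "M \<le> M0")
    case True
    have "B M \<le> (\<Sum>M=1..M0. B M)" using True M B(1) by (intro member_le_sum) auto
    then have "B M \<le> Q" using Q1 by (simp add: Q_def)
    then have "B M * graded_step T r M powr p \<le> Q * graded_step T r M powr p" by (rule mult_right_mono) simp
    then show ?thesis using B(2)[OF M V m] by linarith
  next
    case False
    then have "r * T * \<mu> \<le> real M" using M0 by simp
    then have "err M V m \<le> Q1 * graded_step T r M powr p" using fine M V m by blast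
    also have "\<dots> \<le> Q * graded_step T r M powr p" using Bsum by (intro mult_right_mono) (auto simp: Q_def)
    finally show ?thesis .
  qed
  moreover have "0 < Q" using Q1 Bsum by (simp add: Q_def)
  ultimately show ?thesis unfolding p_def[symmetric] admissible_def err_def by blast
qed

end
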